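(* Let $\Gamma$ be a concave, strictly decreasing curve in the first quadrant with both intercepts equal to $L>0$, given by $y=f(x)$ with inverse function $x=g(y)$. Let $(\alpha,\beta)\in\Gamma$ be a point with $\alpha,\beta>0$. Assume $f\in PC^2(0,\alpha]$ with $f'<0$ and $f''<0$, and $f''$ is monotonic on each subinterval of the partition. Similarly assume $g\in PC^2(0,\beta]$ with $g'<0$ and $g''<0$, and $g''$ is monotonic on each subinterval of the partition. Suppose there are numbers $a_1,a_2,b_1,b_2>0$ and positive-valued functions $\delta(r)$ and $\epsilon(r)$ such that, as $r\to\infty$, $$\delta(r)=O(r^{-2a_1}),\qquad f''(\delta(r))^{-1}=O(r^{1-4a_2}),$$ $$\epsilon(r)=O(r^{-2b_1}),\qquad g''(\epsilon(r))^{-1}=O(r^{1-4b_2}).$$ Let $e=\min\{\tfrac16,a_1,a_2,b_1,b_2\}$. Then the optimal stretch factor for maximizing $N(r,s)$ approaches $1$ as $r\to\infty$, with $$S(r)\subset\big[1-O(r^{-e}),\,1+O(r^{-e})\big]$$ (that is, there exist $C,r_0>0$ such that $|s-1|\le Cr^{-e}$ for all $r\ge r_0$ and all $s\in S(r)$), and the maximal lattice count satisfies $$\max_{s>0}N(r,s)=r^2\operatorname{Area}(\Gamma)-rL+O(r^{1-2e})\qquad\text{as } r\to\infty .$$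
   Context: $\mathbb{N}=\{1,2,3,\dots\}$. The curve $\Gamma$ is the graph $y=f(x)$, $x\in[0,L]$, of a continuous, concave, strictly decreasing function $f:[0,L]\to[0,L]$ with $f(0)=L$ and $f(L)=0$; $g:[0,L]\to[0,L]$ is the inverse function of $f$. $\operatorname{Area}(\Gamma)$ is the area enclosed by $\Gamma$ and the coordinate axes. For $r,s>0$, the curve $r\Gamma(s)$ is the image of $\Gamma$ under $(x,y)\mapsto(rs^{-1}x,\,rsy)$, i.e. the graph of $x\mapsto rsf(sx/r)$ on $[0,rs^{-1}L]$. The number of positive-integer lattice points inside or on $r\Gamma(s)$ is $$N(r,s)=\#\{(j,k)\in\mathbb{N}\times\mathbb{N}: js/r\le L,\ k\le rsf(js/r)\}.$$ For each $r>0$ the function $s\mapsto N(r,s)$ attains its maximum over $s>0$, and $S(r)=\operatorname{arg\,max}_{s>0}N(r,s)$ denotes the set of all maximizing values of $s$. Piecewise smoothness: $f\in PC^2(0,\alpha]$ means $f$ is continuous and there is a partition $0=\alpha_0<\alpha_1<\dots<\alpha_l=\alpha$ such that $f\in C^2(0,\alpha_1]$ and $f\in C^2[\alpha_{i-1},\alpha_i]$ for $i=2,\dots,l$ (restrictions of $f$, with one-sided derivatives at the partition points). Then $f'<0$ means that $f'$ is negative on each of the subintervals $(0,\alpha_1]$ and $[\alpha_{i-1},\alpha_i]$, $i=2,\dots,l$, with derivatives taken in the one-sided senses at the partition points; $f''<0$ is understood analogously. The subintervals of the partition are these same subintervals. The definitions for $g\in PC^2(0,\beta]$ are the same, with a partition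 $0=\beta_0<\beta_1<\dots<\beta_m=\beta$. *)

theory Defs
  imports "HOL-Analysis.Analysis" "HOL-Library.Landau_Symbols"
begin

text \<open>
  First and second derivatives of \<open>f\<close> relative to an interval \<open>I\<close>: they are one-sided at those
  endpoints that belong to \<open>I\<close>, and describe the restriction of \<open>f\<close> to \<open>I\<close> only.
\<close>

definition deriv1_on :: "real set \<Rightarrow> (real \<Rightarrow> real) \<Rightarrow> real \<Rightarrow> real" where
  "deriv1_on I f x = vector_derivative f (at x within I)"

definition deriv2_on :: "real set \<Rightarrow> (real \<Rightarrow> real) \<Rightarrow> real \<Rightarrow> real" where
  "deriv2_on I f = deriv1_on I (deriv1_on I f)"

definition C2_on :: "real set \<Rightarrow> (real \<Rightarrow> real) \<Rightarrow> bool" where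
  "C2_on I f \<longleftrightarrow>
     f differentiable_on I \<and> deriv1_on I f differentiable_on I \<and> continuous_on I (deriv2_on I f)"

definition is_partition :: "real \<Rightarrow> nat \<Rightarrow> (nat \<Rightarrow> real) \<Rightarrow> bool" where
  "is_partition a n p \<longleftrightarrow> 0 < n \<and> p 0 = 0 \<and> p n = a \<and> (\<forall>i<n. p i < p (Suc i))"

text \<open>The first subinterval is half-open, since no smoothness is required at 0.\<close>

definition subinterval :: "(nat \<Rightarrow> real) \<Rightarrow> nat \<Rightarrow> real set" where
  "subinterval p i = (if i = 0 then {0<..p 1} else {p i..p (Suc i)})"

text \<open>\<open>f\<close> is in \<open>PC\<^sup>2(0, a]\<close>, witnessed by the partition \<open>p 0 < \<dots> < p n\<close>.\<close>

definition PC2_on :: "real \<Rightarrow> nat \<Rightarrow> (nat \<Rightarrow> real) \<Rightarrow> (real \<Rightarrow> real) \<Rightarrow> bool" where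
  "PC2_on a n p f \<longleftrightarrow>
     is_partition a n p \<and> continuous_on {0<..a} f \<and> (\<forall>i<n. C2_on (subinterval p i) f)"

definition curve_area :: "(real \<Rightarrow> real) \<Rightarrow> real \<Rightarrow> real" where
  "curve_area f L = measure lebesgue {(x, y). 0 \<le> x \<and> x \<le> L \<and> 0 \<le> y \<and> y \<le> f x}"

definition lattice_count :: "(real \<Rightarrow> real) \<Rightarrow> real \<Rightarrow> real \<Rightarrow> real \<Rightarrow> nat" where
  "lattice_count f L r s =
     card {(j :: nat, k :: nat). 1 \<le> j \<and> 1 \<le> k \<and>
       real j * s / r \<le> L \<and> real k \<le> r * s * f (real j * s / r)}"

definition optimal_stretch :: "(real \<Rightarrow> real) \<Rightarrow> real \<Rightarrow> real \<Rightarrow> real set" where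
  "optimal_stretch f L r = {s. is_arg_max (lattice_count f L r) (\<lambda>s. 0 < s) s}"

text \<open>
  \<open>Max\<close> is only meaningful on finite nonempty sets; the counts for a fixed \<open>r\<close> form such a set
  whenever \<open>f \<le> L\<close> on \<open>[0, L]\<close>.
\<close>

definition max_lattice_count :: "(real \<Rightarrow> real) \<Rightarrow> real \<Rightarrow> real \<Rightarrow> nat" where
  "max_lattice_count f L r = Max (lattice_count f L r ` {0<..})"

lemma lattice_count_le:
  assumes f: "\<And>x. x \<in> {0..L} \<Longrightarrow> f x \<le> L" and "0 < L" "0 < r" "0 < s"
  shows "lattice_count f L r s \<le> nat \<lfloor>(r * L)\<^sup>2\<rfloor>"
proof -
  let ?A = "{(j :: nat, k :: nat). 1 \<le> j \<and> 1 \<le> k \<and>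
       real j * s / r \<le> L \<and> real k \<le> r * s * f (real j * s / r)}"
  let ?a = "nat \<lfloor>r * L / s\<rfloor>" and ?b = "nat \<lfloor>r * s * L\<rfloor>"
  have sub: "?A \<subseteq> {1..?a} \<times> {1..?b}"
  proof clarify
    fix j k :: nat
    assume 1: "1 \<le> j" "1 \<le> k" and j: "real j * s / r \<le> L"
      and k: "real k \<le> r * s * f (real j * s / r)"
    have "f (real j * s / r) \<le> L"
      using assms j by (intro f) auto
    hence "r * s * f (real j * s / r) \<le> r * s * L"
      using assms by (intro mult_left_mono) auto
    hence "real k \<le> r * s * L"
      using k by simp
    moreover have "real j \<le> r * L / s"
      using j assms by (simp add: field_simps)
    ultimately show "j \<in> {1..?a} \<and> k \<in> {1..?b}"
      using 1 by (simp add: le_nat_floor)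
  qed
  have "lattice_count f L r s \<le> card ({1..?a} \<times> {1..?b})"
    unfolding lattice_count_def by (intro card_mono sub) auto
  also have "\<dots> = ?a * ?b"
    by (simp add: card_cartesian_product)
  also have "\<dots> \<le> nat \<lfloor>(r * L)\<^sup>2\<rfloor>"
  proof (rule le_nat_floor)
    have "real (?a * ?b) \<le> (r * L / s) * (r * s * L)"
      unfolding of_nat_mult using assms by (intro mult_mono) auto
    also have "\<dots> = (r * L)\<^sup>2"
      using assms by (simp add: power2_eq_square)
    finally show "real (?a * ?b) \<le> (r * L)\<^sup>2" .
  qed
  finally show ?thesis .
qed

lemma finite_lattice_counts:
  assumes "\<And>x. x \<in> {0..L} \<Longrightarrow> f x \<le> L" and "0 < L" "0 < r"
  shows "finite (lattice_count f L r ` {0<..})"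
proof (rule finite_subset)
  show "lattice_count f L r ` {0<..} \<subseteq> {..nat \<lfloor>(r * L)\<^sup>2\<rfloor>}"
    using lattice_count_le[OF assms] by auto
qed auto

end

theory Submission
  imports Defs
begin

text \<open>
  Write \<open>\<psi>(y) = frac y - 1/2\<close>, so that \<open>\<lfloor>y\<rfloor> = y - 1/2 - \<psi>(y)\<close>, and let \<open>A\<close> be the area under the curve.
  Cut the region at the point \<open>(\<alpha>, \<beta>)\<close>: columns over \<open>(0, \<alpha>]\<close> are counted by \<open>\<lfloor>r s f(j s/r)\<rfloor>\<close>, rows
  below \<open>\<beta>\<close> by \<open>\<lfloor>(r/s) g(k/(r s))\<rfloor>\<close>, and the points in both families form a rectangle. The
  trapezoidal rule evaluates the two sums without \<open>\<psi>\<close>; since the curve is concave and decreasing, the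
  errors of the single trapezoids telescope to something bounded. The result is
  \<open>N(r, s) = r\<^sup>2 A - r L (s + 1/s) / 2 - (two sums of \<psi>) + O(1)\<close>, uniformly for \<open>s\<close> in a compact
  subset of \<open>(0, \<infinity>)\<close> (lemma \<open>lattice_count_two_term\<close>).

  If both sums of \<open>\<psi>\<close> are \<open>O(r\<^bsup>1-2e\<^esup>)\<close>, the theorem follows by comparing a maximizer \<open>s\<close> with \<open>s = 1\<close>.
  A crude bound \<open>N(r, s) \<le> r\<^sup>2 A - const r s\<close>, valid as long as there is a column at all, together with its
  mirror image under \<open>s \<mapsto> 1/s\<close>, confines all maximizers to a fixed compact set; there the two-term formula gives
  \<open>r L (s + 1/s - 2) / 2 = O(r\<^bsup>1-2e\<^esup>)\<close>, that is \<open>(s - 1)\<^sup>2 = O(r\<^bsup>-2e\<^esup>)\<close>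
  (lemma \<open>optimal_stretch_asymptotics\<close>).

  The sums of \<open>\<psi>\<close> are bounded by van der Corput's method. Up to an error \<open>t\<close>, the sawtooth \<open>\<psi>\<close> lies
  between difference quotients of \<open>\<psi>\<^sup>2/2\<close> with step \<open>t\<close>, and \<open>\<psi>\<^sup>2\<close> has an absolutely convergent cosine
  series. This reduces sums of \<open>\<psi>\<close> to exponential sums (lemma \<open>sum_sawtooth_le\<close>), and these are bounded
  by the second derivative test, which rests on the Kusmin-Landau inequality. With \<open>t = r\<^bsup>-1/3\<^esup>\<close> the
  outcome is \<open>O(r\<^bsup>2/3\<^esup>)\<close> on every piece of the partition on which \<open>f''\<close> stays away from 0. Only on the
  first piece can \<open>f''\<close> tend to 0, and then only at the origin. There the points of \<open>(0, \<delta>(r)]\<close> are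
  estimated trivially, which costs \<open>O(r \<delta>(r)) = O(r\<^bsup>1-2a1\<^esup>)\<close>, and the rest is cut into subintervals on
  which \<open>f''\<close> changes by at most a factor 2; the geometric series that appears is dominated by its term at
  \<open>\<delta>(r)\<close>, which is \<open>r\<^bsup>1/2\<^esup> \<bar>f''(\<delta>(r))\<bar>\<^bsup>-1/2\<^esup> = O(r\<^bsup>1-2a2\<^esup>)\<close>.
\<close>

section \<open>The sawtooth function and its square\<close>

definition sawtooth :: "real \<Rightarrow> real" where
  "sawtooth x = frac x - 1/2"

lemma dirichlet_kernel:
  "sin (x/2) * (1/2 + (\<Sum>k=1..n. cos (real k * x))) = sin ((real n + 1/2) * x) / 2"
proof (induction n)
  case 0
  then show ?case by simp
next
  case (Suc n)
  have "sin ((real (Suc n) + 1/2) * x) - sin ((real n + 1/2) * x)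
      = 2 * sin (x/2) * cos (real (Suc n) * x)"
  proof -
    have a: "(real (Suc n) + 1/2) * x = real (Suc n) * x + x/2"
      and b: "(real n + 1/2) * x = real (Suc n) * x - x/2"
      by (simp_all add: algebra_simps)
    show ?thesis unfolding a b sin_add sin_diff by simp
  qed
  with Suc show ?case by (simp add: algebra_simps)
qed

lemma abs_le_from_deriv_bound:
  fixes F F' :: "real \<Rightarrow> real"
  assumes der: "\<And>x. x \<in> {a..b} \<Longrightarrow> (F has_real_derivative F' x) (at x)"
    and bd: "\<And>x. x \<in> {a..b} \<Longrightarrow> \<bar>F' x\<bar> \<le> K"
    and "x \<in> {a..b}" "y \<in> {a..b}"
  shows "\<bar>F x - F y\<bar> \<le> K * \<bar>x - y\<bar>"
  using field_differentiable_bound[of "{a..b}" F F' K x y] assms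
  by (auto simp: has_field_derivative_at_within)

text \<open>
  Up to sign, the derivative of the remainder is a Dirichlet kernel. One integration by parts, carried out
  by subtracting the boundary term explicitly, gains the factor \<open>1/n\<close>. What remains vanishes at
  \<open>x = pi\<close>, so that a bound for its derivative suffices.
\<close>

lemma sine_series_remainder:
  assumes "0 < a" "a \<le> pi" "x \<in> {a..2*pi-a}"
  shows "\<bar>(pi - x)/2 - (\<Sum>k=1..n. sin (real k * x) / real k)\<bar>
           \<le> 3 / ((2 * real n + 1) * (sin (a/2))\<^sup>2)"
proof -
  define \<sigma> where "\<sigma> = sin (a/2)"
  have \<sigma>: "0 < \<sigma>" "\<sigma> \<le> 1" using assms by (auto simp: \<sigma>_def intro!: sin_gt_zero)
  have sin_ge: "\<sigma> \<le> sin (y/2)" if "y \<in> {a..2*pi-a}" for y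
  proof (cases "y \<le> pi")
    case True
    then show ?thesis unfolding \<sigma>_def
      using that assms by (intro sin_monotone_2pi_le) auto
  next
    case False
    have "sin (a/2) \<le> sin (pi - y/2)"
      using that assms False by (intro sin_monotone_2pi_le) auto
    then show ?thesis by (simp add: \<sigma>_def)
  qed
  define N where "N = 2 * real n + 1"
  have N: "N > 0" by (simp add: N_def)
  define Q where "Q = (\<lambda>y. (pi - y)/2 - (\<Sum>k=1..n. sin (real k * y) / real k)
                     - cos (N/2 * y) / (N * sin (y/2)))"
  define Q' where "Q' = (\<lambda>y. cos (N/2 * y) * cos (y/2) / (2 * N * (sin (y/2))\<^sup>2))"
  have Q': "(Q has_real_derivative Q' y) (at y)" if y: "y \<in> {a..2*pi-a}" for y
  proof -
    have s: "sin (y/2) > 0" using sin_ge[OF y] \<sigma> by simp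
    have "sin (y/2) * (1/2 + (\<Sum>k=1..n. cos (real k * y))) = sin (N/2 * y) / 2"
      using dirichlet_kernel[of y n] by (simp add: N_def add_divide_distrib)
    then have d: "1/2 + (\<Sum>k=1..n. cos (real k * y)) = sin (N/2 * y) / (2 * sin (y/2))"
      using s by (simp add: field_simps)
    have sm: "((\<lambda>y. \<Sum>k=1..n. sin (real k * y) / real k) has_real_derivative
           (\<Sum>k=1..n. cos (real k * y))) (at y)"
      by (rule DERIV_sum) (auto intro!: derivative_eq_intros)
    have "(Q has_real_derivative
        (- (1/2) - (\<Sum>k=1..n. cos (real k * y))
          - ((- sin (N/2*y) * (N/2)) * (N * sin (y/2)) - cos (N/2*y) * (N * (cos (y/2) * (1/2))))
             / (N * sin (y/2))\<^sup>2)) (at y)"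
      unfolding Q_def power2_eq_square
      by (rule sm derivative_eq_intros refl | use s N in simp)+
    moreover have "(- (1/2) - (\<Sum>k=1..n. cos (real k * y))
          - ((- sin (N/2*y) * (N/2)) * (N * sin (y/2)) - cos (N/2*y) * (N * (cos (y/2) * (1/2))))
             / (N * sin (y/2))\<^sup>2) = Q' y"
    proof -
      have "- (1/2) - (\<Sum>k=1..n. cos (real k * y)) = - (sin (N/2 * y) / (2 * sin (y/2)))"
        using d by linarith
      then show ?thesis
        unfolding Q'_def using s N by (simp add: field_simps power2_eq_square)
    qed
    ultimately show ?thesis by simp
  qed
  have Q'_le: "\<bar>Q' y\<bar> \<le> 1 / (2 * N * \<sigma>\<^sup>2)" if y: "y \<in> {a..2*pi-a}" for y
  proof -
    have "\<bar>Q' y\<bar> = \<bar>cos (N/2*y)\<bar> * \<bar>cos (y/2)\<bar> / (2 * N * (sin (y/2))\<^sup>2)"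
      using N by (simp add: Q'_def abs_mult)
    also have "\<dots> \<le> 1 * 1 / (2 * N * \<sigma>\<^sup>2)"
      using N \<sigma> sin_ge[OF y] by (intro frac_le mult_mono power_mono mult_pos_pos) auto
    finally show ?thesis by simp
  qed
  have Qpi: "Q pi = 0"
  proof -
    have "cos (N/2 * pi) = 0"
      unfolding N_def by (simp add: add_divide_distrib distrib_right cos_add)
    then show ?thesis by (simp add: Q_def)
  qed
  have "\<bar>Q x - Q pi\<bar> \<le> 1 / (2 * N * \<sigma>\<^sup>2) * \<bar>x - pi\<bar>"
    by (rule abs_le_from_deriv_bound[OF Q' Q'_le]) (use assms in auto)
  also have "\<dots> \<le> 1 / (2 * N * \<sigma>\<^sup>2) * pi"
    using assms N by (intro mult_left_mono) auto
  also have "\<dots> \<le> 2 / (N * \<sigma>\<^sup>2)"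
    using pi_less_4 N \<sigma> by (simp add: field_simps)
  finally have 1: "\<bar>Q x\<bar> \<le> 2 / (N * \<sigma>\<^sup>2)" using Qpi by simp
  have "\<bar>cos (N/2 * x) / (N * sin (x/2))\<bar> \<le> 1 / (N * \<sigma>)"
  proof -
    have "\<bar>cos (N/2 * x) / (N * sin (x/2))\<bar> = \<bar>cos (N/2 * x)\<bar> / (N * sin (x/2))"
      using N \<sigma> sin_ge[OF assms(3)] by (simp add: abs_mult)
    also have "\<dots> \<le> 1 / (N * \<sigma>)"
      using N \<sigma> sin_ge[OF assms(3)] by (intro frac_le mult_mono) auto
    finally show ?thesis .
  qed
  also have "\<dots> \<le> 1 / (N * \<sigma>\<^sup>2)"
    using N \<sigma> by (intro divide_left_mono mult_left_mono mult_pos_pos) (auto simp: power2_eq_square mult_le_cancel_left1)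
  finally have 2: "\<bar>cos (N/2 * x) / (N * sin (x/2))\<bar> \<le> 1 / (N * \<sigma>\<^sup>2)" .
  have "\<bar>(pi - x)/2 - (\<Sum>k=1..n. sin (real k * x) / real k)\<bar>
      \<le> \<bar>Q x\<bar> + \<bar>cos (N/2 * x) / (N * sin (x/2))\<bar>"
    unfolding Q_def by linarith
  also have "\<dots> \<le> 3 / (N * \<sigma>\<^sup>2)" using 1 2 by (simp add: add_divide_distrib[symmetric] field_simps)
  finally show ?thesis by (simp add: N_def \<sigma>_def)
qed

lemma summable_cos_over_squares: "summable (\<lambda>n. cos (real (Suc n) * x) / (real (Suc n))\<^sup>2)"
proof (rule summable_comparison_test')
  show "summable (\<lambda>n. 1 / (real (Suc n))\<^sup>2)"
    using inverse_power_summable[of 2, where 'a=real]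
    by (subst summable_Suc_iff) (simp add: field_simps)
  show "norm (cos (real (Suc n) * x) / (real (Suc n))\<^sup>2) \<le> 1 / (real (Suc n))\<^sup>2" if "n \<ge> 0" for n
    by (simp add: divide_right_mono)
qed

lemma continuous_cos_over_squares:
  "continuous_on UNIV (\<lambda>x. \<Sum>n. cos (real (Suc n) * x) / (real (Suc n))\<^sup>2)"
proof (rule uniform_limit_theorem)
  have s: "summable (\<lambda>n. 1 / (real (Suc n))\<^sup>2)"
    using summable_cos_over_squares[of 0] by simp
  show "uniform_limit UNIV (\<lambda>n x. \<Sum>i<n. cos (real (Suc i) * x) / (real (Suc i))\<^sup>2)
     (\<lambda>x. \<Sum>n. cos (real (Suc n) * x) / (real (Suc n))\<^sup>2) sequentially"
    by (rule Weierstrass_m_test[OF _ s]) (simp add: divide_right_mono)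
qed (auto intro!: always_eventually continuous_intros)

text \<open>
  The partial sums minus the parabola have the remainder of the sine series as derivative, so in the
  limit the difference is constant on the open interval, and by continuity on the closed one. The constant
  is left implicit, because only differences of values of the series enter later.
\<close>

lemma cos_over_squares_sum:
  "\<exists>c. \<forall>x\<in>{0..2*pi}. (\<Sum>n. cos (real (Suc n) * x) / (real (Suc n))\<^sup>2) = (pi - x)\<^sup>2 / 4 + c"
proof -
  define D where "D = (\<lambda>x. (\<Sum>n. cos (real (Suc n) * x) / (real (Suc n))\<^sup>2) - (pi - x)\<^sup>2 / 4)"
  have inner: "D x = D pi" if x: "x \<in> {0<..<2*pi}" for x
  proof -
    define a where "a = min x (2*pi - x)"
    have a: "0 < a" "a \<le> pi" "x \<in> {a..2*pi-a}" using x by (auto simp: a_def)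
    define Dn where "Dn = (\<lambda>n y. (\<Sum>k=1..n. cos (real k * y) / (real k)\<^sup>2) - (pi - y)\<^sup>2 / 4)"
    have lim: "(\<lambda>n. Dn n y) \<longlonglongrightarrow> D y" for y
    proof -
      have "(\<lambda>n. \<Sum>k<n. cos (real (Suc k) * y) / (real (Suc k))\<^sup>2) \<longlonglongrightarrow>
        (\<Sum>n. cos (real (Suc n) * y) / (real (Suc n))\<^sup>2)"
        using summable_LIMSEQ[OF summable_cos_over_squares] .
      moreover have "(\<Sum>k<n. cos (real (Suc k) * y) / (real (Suc k))\<^sup>2)
          = (\<Sum>k=1..n. cos (real k * y) / (real k)\<^sup>2)" for n
        by (rule sum.reindex_bij_witness[of _ "\<lambda>k. k - 1" Suc]) auto
      ultimately show ?thesis unfolding Dn_def D_def by (intro tendsto_diff) simp_all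
    qed
    define s where "s = (sin (a/2))\<^sup>2"
    have s: "s > 0" unfolding s_def using a by (intro zero_less_power sin_gt_zero) auto
    have "\<bar>Dn n x - Dn n pi\<bar> \<le> 3 / ((2 * real n + 1) * s) * \<bar>x - pi\<bar>" for n
    proof (rule abs_le_from_deriv_bound)
      fix y assume y: "y \<in> {a..2*pi-a}"
      show "(Dn n has_real_derivative ((pi - y)/2 - (\<Sum>k=1..n. sin (real k * y) / real k))) (at y)"
      proof -
        have "((\<lambda>y. \<Sum>k=1..n. cos (real k * y) / (real k)\<^sup>2) has_real_derivative
           (\<Sum>k=1..n. - (sin (real k * y) / real k))) (at y)"
          by (rule DERIV_sum) (auto intro!: derivative_eq_intros simp: power2_eq_square)
        moreover have "((\<lambda>y. (pi - y)\<^sup>2 / 4) has_real_derivative - ((pi - y)/2)) (at y)"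
          by (auto intro!: derivative_eq_intros simp: field_simps)
        ultimately show ?thesis unfolding Dn_def
          by (auto dest: DERIV_diff simp: sum_negf)
      qed
      show "\<bar>(pi - y)/2 - (\<Sum>k=1..n. sin (real k * y) / real k)\<bar> \<le> 3 / ((2 * real n + 1) * s)"
        unfolding s_def by (rule sine_series_remainder[OF a(1,2) y])
    qed (use a in auto)
    moreover have "3 / ((2 * real n + 1) * s) \<le> 3 / s * inverse (real (Suc n))" for n
    proof -
      have "3 / ((2 * real n + 1) * s) \<le> 3 / (real (Suc n) * s)"
        using s by (intro divide_left_mono mult_right_mono mult_pos_pos) auto
      then show ?thesis by (simp add: divide_inverse mult_ac)
    qed
    ultimately have bd: "\<bar>Dn n x - Dn n pi\<bar> \<le> 3 / s * inverse (real (Suc n)) * \<bar>x - pi\<bar>" for n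
      by (meson abs_ge_zero mult_right_mono order_trans)
    have "(\<lambda>n. \<bar>Dn n x - Dn n pi\<bar>) \<longlonglongrightarrow> \<bar>D x - D pi\<bar>"
      by (intro tendsto_intros lim)
    moreover have "(\<lambda>n. 3 / s * inverse (real (Suc n)) * \<bar>x - pi\<bar>) \<longlonglongrightarrow> 3 / s * 0 * \<bar>x - pi\<bar>"
      by (intro tendsto_intros LIMSEQ_inverse_real_of_nat)
    ultimately have "\<bar>D x - D pi\<bar> \<le> 0"
      using bd by (intro LIMSEQ_le) auto
    then show ?thesis by simp
  qed
  have "D x = D pi" if "x \<in> {0..2*pi}" for x
  proof (rule continuous_constant_on_closure[of "{0<..<2*pi}" D])
    show "continuous_on (closure {0<..<2*pi}) D" unfolding D_def
      by (intro continuous_intros continuous_on_subset[OF continuous_cos_over_squares]) auto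
  qed (erule inner, use that in simp)
  moreover have "(\<Sum>n. cos (real (Suc n) * x) / (real (Suc n))\<^sup>2) = (pi - x)\<^sup>2 / 4 + D x" for x
    by (simp add: D_def)
  ultimately show ?thesis by metis
qed

lemma sawtooth_sq_sums:
  "\<exists>c. \<forall>y. (\<lambda>n. cos (2 * pi * real (Suc n) * y) / (pi * real (Suc n))\<^sup>2) sums ((sawtooth y)\<^sup>2 + c)"
proof -
  obtain c where c: "\<And>x. x \<in> {0..2*pi} \<Longrightarrow>
     (\<Sum>n. cos (real (Suc n) * x) / (real (Suc n))\<^sup>2) = (pi - x)\<^sup>2 / 4 + c"
    using cos_over_squares_sum by blast
  show ?thesis
  proof (intro exI[of _ "c / pi\<^sup>2"] allI)
    fix y :: real
    have "frac y \<in> {0..1}" using frac_ge_0[of y] frac_lt_1[of y] by auto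
    then have x: "2 * pi * frac y \<in> {0..2*pi}" by (auto simp: mult_le_cancel_left1)
    have cs: "cos (2 * pi * real k * y) = cos (real k * (2 * pi * frac y))" for k
    proof -
      have "2 * pi * real k * y = real k * (2 * pi * frac y) + 2 * pi * of_int (int k * \<lfloor>y\<rfloor>)"
        by (simp add: frac_def algebra_simps)
      then have "cos (2 * pi * real k * y)
          = cos (real k * (2 * pi * frac y)) * cos (2 * pi * of_int (int k * \<lfloor>y\<rfloor>))
          - sin (real k * (2 * pi * frac y)) * sin (2 * pi * of_int (int k * \<lfloor>y\<rfloor>))"
        by (simp only: cos_add)
      then show ?thesis by (simp only: cos_int_2pin sin_int_2pin)
    qed
    have "(\<lambda>n. cos (real (Suc n) * (2 * pi * frac y)) / (real (Suc n))\<^sup>2) sums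
           ((pi - 2 * pi * frac y)\<^sup>2 / 4 + c)"
      unfolding c[OF x, symmetric] by (intro summable_sums summable_cos_over_squares)
    from sums_divide[OF this, of "pi\<^sup>2"]
    have "(\<lambda>n. cos (2 * pi * real (Suc n) * y) / (pi * real (Suc n))\<^sup>2) sums
           (((pi - 2 * pi * frac y)\<^sup>2 / 4 + c) / pi\<^sup>2)"
      by (simp only: cs power_mult_distrib divide_divide_eq_left mult.commute[of "pi\<^sup>2"])
    moreover have "((pi - 2 * pi * frac y)\<^sup>2 / 4 + c) / pi\<^sup>2 = (sawtooth y)\<^sup>2 + c / pi\<^sup>2"
      by (simp add: sawtooth_def field_simps power2_eq_square)
    ultimately show "(\<lambda>n. cos (2 * pi * real (Suc n) * y) / (pi * real (Suc n))\<^sup>2) sums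
      ((sawtooth y)\<^sup>2 + c / pi\<^sup>2)" by simp
  qed
qed

text \<open>
  This lemma and the next replace the sawtooth by an average of it over a window of length \<open>t\<close>: the
  primitive of the sawtooth is half its square, and the sawtooth increases with slope 1 and jumps
  only downwards, so it exceeds its average over the window to the left by at most \<open>t\<close>, and its average
  over the window to the right exceeds it by at most \<open>t\<close>. The gain is a Fourier series that converges
  absolutely.
\<close>

lemma sawtooth_le_difference_quotient:
  assumes "0 < t" "t < 1"
  shows "sawtooth x \<le> t + ((sawtooth x)\<^sup>2 - (sawtooth (x - t))\<^sup>2) / (2 * t)"
proof -
  define y where "y = frac x"
  have y: "0 \<le> y" "y < 1" by (auto simp: y_def frac_lt_1)
  show ?thesis
  proof (cases "t \<le> y")
    case True
    have "frac (x - t) = y - t"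
      unfolding frac_unique_iff using True y assms by (auto simp: y_def frac_def)
    moreover have "((y - 1/2)\<^sup>2 - (y - t - 1/2)\<^sup>2) / (2 * t) = y - 1/2 - t/2"
      using assms by (simp add: field_simps power2_eq_square)
    ultimately show ?thesis unfolding sawtooth_def y_def[symmetric] using assms by simp
  next
    case False
    have fr: "frac (x - t) = y - t + 1"
    proof -
      have "x - t - (y - t + 1) = of_int (\<lfloor>x\<rfloor> - 1)" by (simp add: y_def frac_def)
      then show ?thesis unfolding frac_unique_iff using False y assms by (auto simp del: of_int_diff)
    qed
    moreover have "((y - 1/2)\<^sup>2 - (y - t + 1 - 1/2)\<^sup>2) / (2 * t)
        = y - 1/2 - t/2 + 1 - y/t"
      using assms by (simp add: field_simps power2_eq_square)
    moreover have "y / t \<le> 1" using False assms by simp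
    ultimately show ?thesis unfolding sawtooth_def y_def[symmetric] fr using assms by linarith
  qed
qed

lemma sawtooth_ge_difference_quotient:
  assumes "0 < t" "t < 1"
  shows "sawtooth x \<ge> - t + ((sawtooth (x + t))\<^sup>2 - (sawtooth x)\<^sup>2) / (2 * t)"
proof -
  define y where "y = frac x"
  have y: "0 \<le> y" "y < 1" by (auto simp: y_def frac_lt_1)
  show ?thesis
  proof (cases "y + t < 1")
    case True
    have "frac (x + t) = y + t"
      unfolding frac_unique_iff using True y assms by (auto simp: y_def frac_def)
    moreover have "((y + t - 1/2)\<^sup>2 - (y - 1/2)\<^sup>2) / (2 * t) = y - 1/2 + t/2"
      using assms by (simp add: field_simps power2_eq_square)
    ultimately show ?thesis unfolding sawtooth_def y_def[symmetric] using assms by simp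
  next
    case False
    have fr: "frac (x + t) = y + t - 1"
    proof -
      have "x + t - (y + t - 1) = of_int (\<lfloor>x\<rfloor> + 1)" by (simp add: y_def frac_def)
      then show ?thesis unfolding frac_unique_iff using False y assms by (auto simp del: of_int_add)
    qed
    moreover have "((y + t - 1 - 1/2)\<^sup>2 - (y - 1/2)\<^sup>2) / (2 * t)
        = y - 1/2 + t/2 - 1 + (1 - y)/t"
      using assms by (simp add: field_simps power2_eq_square)
    moreover have "(1 - y) / t \<le> 1" using False assms by simp
    ultimately show ?thesis unfolding sawtooth_def y_def[symmetric] fr using assms by linarith
  qed
qed

text \<open>
  Comparison with the integral of \<open>1 / (sqrt x * (1 + x * t))\<close>, whose primitive is a multiple of
  \<open>arctan (sqrt (x * t))\<close> and therefore bounded by a multiple of \<open>1 / sqrt t\<close>.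
\<close>

lemma sum_arctan_telescope:
  assumes "0 < t"
  shows "(\<Sum>k=1..n. 1 / (sqrt (real k) * (1 + real k * t))) \<le> 4 / sqrt t"
proof -
  define \<phi> where "\<phi> = (\<lambda>x. 2 / sqrt t * arctan (sqrt (x * t)))"
  have step: "1 / (sqrt (real (Suc k)) * (1 + real (Suc k) * t)) \<le> \<phi> (real (Suc k)) - \<phi> (real k)" for k
  proof -
    have "\<exists>\<xi>\<in>{real k<..<real (Suc k)}. \<phi> (real (Suc k)) - \<phi> (real k)
        = (\<lambda>h. h * (1 / (sqrt \<xi> * (1 + \<xi> * t)))) (real (Suc k) - real k)"
    proof (rule mvt)
      show "continuous_on {real k..real (Suc k)} \<phi>"
        unfolding \<phi>_def by (intro continuous_intros)
      fix x assume x: "real k < x" "x < real (Suc k)"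
      have x0: "x > 0" using x by simp
      then have xt: "x * t > 0" using assms by simp
      have "(\<phi> has_real_derivative 2 / sqrt t * (inverse (1 + (sqrt (x*t))\<^sup>2) * (inverse (sqrt (x*t)) / 2 * t))) (at x)"
        unfolding \<phi>_def
      proof (rule DERIV_cmult)
        show "((\<lambda>x. arctan (sqrt (x * t))) has_real_derivative
            inverse (1 + (sqrt (x*t))\<^sup>2) * (inverse (sqrt (x*t)) / 2 * t)) (at x)"
          using xt by (auto intro!: derivative_eq_intros)
      qed
      moreover have "2 / sqrt t * (inverse (1 + (sqrt (x*t))\<^sup>2) * (inverse (sqrt (x*t)) / 2 * t))
          = 1 / (sqrt x * (1 + x * t))"
      proof -
        have "t = sqrt t * sqrt t" using assms by simp
        then have "2 / sqrt t * (inverse (1 + x*t) * (inverse (sqrt x * sqrt t) / 2 * t))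
            = 2 / sqrt t * (inverse (1 + x*t) * (inverse (sqrt x * sqrt t) / 2 * (sqrt t * sqrt t)))"
          by simp
        also have "\<dots> = 1 / (sqrt x * (1 + x * t))"
          using assms by (simp add: divide_simps)
        finally show ?thesis unfolding real_sqrt_pow2[OF less_imp_le[OF xt]] by (simp only: real_sqrt_mult)
      qed
      ultimately have "(\<phi> has_real_derivative 1 / (sqrt x * (1 + x * t))) (at x)" by simp
      then show "(\<phi> has_derivative (\<lambda>h. h * (1 / (sqrt x * (1 + x * t))))) (at x)"
        unfolding has_field_derivative_def by (rule has_derivative_eq_rhs) (auto simp: fun_eq_iff)
    qed (simp, meson greaterThanLessThan_iff)
    then obtain \<xi> where \<xi>: "real k < \<xi>" "\<xi> < real (Suc k)"
      "\<phi> (real (Suc k)) - \<phi> (real k) = 1 / (sqrt \<xi> * (1 + \<xi> * t))" by auto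
    have "0 < sqrt \<xi> * (1 + \<xi> * t)"
      using \<xi> assms by (intro mult_pos_pos add_pos_nonneg) auto
    moreover have "sqrt \<xi> * (1 + \<xi> * t) \<le> sqrt (real (Suc k)) * (1 + real (Suc k) * t)"
      using \<xi> assms by (intro mult_mono add_mono) auto
    ultimately show ?thesis unfolding \<xi>(3) by (intro frac_le) auto
  qed
  have "(\<Sum>k=1..n. 1 / (sqrt (real k) * (1 + real k * t))) \<le> \<phi> (real n)"
  proof (induction n)
    case 0
    then show ?case by (simp add: \<phi>_def)
  next
    case (Suc n)
    then show ?case using step[of n] by simp
  qed
  also have "\<phi> (real n) \<le> 2 / sqrt t * (pi/2)"
    unfolding \<phi>_def using assms
    by (intro mult_left_mono less_imp_le[OF arctan_ubound]) simp
  also have "\<dots> \<le> 4 / sqrt t" using pi_less_4 assms by (simp add: field_simps)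
  finally show ?thesis .
qed

lemma sum_inverse_three_halves_le:
  "(\<Sum>k=1..n. 1 / (real k * sqrt (real k))) \<le> 3"
proof -
  have "(\<Sum>k=1..Suc n. 1 / (real k * sqrt (real k))) \<le> 3 - 2 / sqrt (real (Suc n))" for n
  proof (induction n)
    case 0
    then show ?case by simp
  next
    case (Suc n)
    define a where "a = sqrt (real (Suc n))"
    define b where "b = sqrt (real (Suc (Suc n)))"
    have ab: "0 < a" "a \<le> b" "b * b - a * a = 1" "b * b = real (Suc (Suc n))"
      by (auto simp: a_def b_def)
    have "a * (a + b) \<le> b * (b + b)" using ab by (intro mult_mono) auto
    then have "b * (a * (a + b)) \<le> b * (b * (b + b))" using ab by (intro mult_left_mono) auto
    then have "2 / (b * (b * (b + b))) \<le> 2 / (b * (a * (a + b)))"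
      using ab by (intro divide_left_mono mult_pos_pos) auto
    also have "\<dots> = 2 * (b * b - a * a) / (b * (a * (a + b)))" using ab by simp
    also have "\<dots> = 2 / a - 2 / b"
    proof -
      have "b * b - a * a = (b - a) * (a + b)" by (simp add: algebra_simps)
      then show ?thesis using ab by (simp add: divide_simps) (simp add: algebra_simps)
    qed
    finally have "1 / (b * b * b) \<le> 2 / a - 2 / b" using ab by (simp add: divide_simps mult_ac)
    then have "1 / (real (Suc (Suc n)) * sqrt (real (Suc (Suc n)))) \<le> 2 / a - 2 / b"
      using ab by (simp only: b_def[symmetric])
    with Suc show ?case unfolding a_def[symmetric] b_def[symmetric]
      by (simp add: a_def[symmetric] b_def[symmetric] del: of_nat_Suc)
  qed
  moreover have "3 - 2 / sqrt (real (Suc n)) \<le> 3" for n by simp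
  ultimately have "(\<Sum>k=1..Suc n. 1 / (real k * sqrt (real k))) \<le> 3" for n
    by (meson order_trans)
  then show ?thesis by (cases n) (simp_all del: sum.cl_ivl_Suc)
qed

text \<open>
  The right-hand side is a smooth substitute for \<open>min 2 (2 * pi * u)\<close>, chosen so that the weighted sums
  over the frequencies can be compared with a primitive in closed form.
\<close>

lemma norm_one_minus_cis_le:
  assumes "0 < u" "\<bar>v\<bar> = u"
  shows "norm (1 - cis (2 * pi * v)) \<le> 4 * pi * u / (1 + u)"
proof -
  have *: "norm (1 - cis (2 * pi * v)) = 2 * \<bar>sin (pi * v)\<bar>"
    using dist_exp_i_1[of "2 * pi * v"]
    by (simp add: norm_minus_commute cis_conv_exp)
  show ?thesis
  proof (cases "u \<le> 1")
    case True
    have "2 * \<bar>sin (pi * v)\<bar> \<le> 2 * pi * u"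
      using abs_sin_x_le_abs_x[of "pi * v"] assms by (simp add: abs_mult)
    also have "\<dots> \<le> 4 * pi * u / (1 + u)" using True assms by (simp add: field_simps)
    finally show ?thesis using * by simp
  next
    case False
    have "1 + u \<le> 2 * u" using False by simp
    also have "\<dots> \<le> 2 * pi * u" using assms pi_gt3 by simp
    finally have "2 \<le> 4 * pi * u / (1 + u)" using assms by (simp add: field_simps)
    moreover have "2 * \<bar>sin (pi * v)\<bar> \<le> 2" by simp
    ultimately show ?thesis using * by linarith
  qed
qed

text \<open>
  The cosine series turns each difference of squares into exponential sums, with weight of size
  \<open>1 / (k * (1 + k * t))\<close> at frequency \<open>k\<close> after division by \<open>2 * t\<close>. The two terms in the hypothesis on
  the exponential sums are those of the second derivative test. Against these weights, the first
  sums to \<open>O(P / sqrt t)\<close> and the second to \<open>O(Q)\<close>.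
\<close>

lemma sum_sawtooth_sq_diff_le:
  fixes y :: "'a \<Rightarrow> real"
  assumes t: "0 < t" "\<bar>\<tau>\<bar> = t" and PQ: "0 \<le> P" "0 \<le> Q"
    and S: "\<And>k. k \<ge> 1 \<Longrightarrow> norm (\<Sum>n\<in>A. cis (2 * pi * (real k * y n))) \<le> P * sqrt (real k) + Q / sqrt (real k)"
  shows "\<bar>\<Sum>n\<in>A. (sawtooth (y n))\<^sup>2 - (sawtooth (y n - \<tau>))\<^sup>2\<bar> / (2 * t) \<le> 4 * P / sqrt t + 3 * Q"
proof -
  obtain c where c: "\<And>y. (\<lambda>n. cos (2 * pi * real (Suc n) * y) / (pi * real (Suc n))\<^sup>2) sums ((sawtooth y)\<^sup>2 + c)"
    using sawtooth_sq_sums by blast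
  define T where "T = (\<lambda>k. \<Sum>n\<in>A. cos (2 * pi * real k * y n) - cos (2 * pi * real k * (y n - \<tau>)))"
  have T: "\<bar>T k / (pi * real k)\<^sup>2\<bar> / (2*t)
      \<le> P * (1 / (sqrt (real k) * (1 + real k * t))) + Q * (1 / (real k * sqrt (real k)))" if k: "k \<ge> 1" for k
  proof -
    have "T k = Re ((1 - cis (2 * pi * (- (real k * \<tau>)))) * (\<Sum>n\<in>A. cis (2 * pi * (real k * y n))))"
      unfolding T_def sum_distrib_left Re_sum
      by (rule sum.cong) (auto simp: algebra_simps cos_add cos_diff)
    then have "\<bar>T k\<bar> \<le> norm (1 - cis (2 * pi * (- (real k * \<tau>)))) * norm (\<Sum>n\<in>A. cis (2 * pi * (real k * y n)))"
      using abs_Re_le_cmod by (metis norm_mult)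
    also have "\<dots> \<le> (4 * pi * (real k * t) / (1 + real k * t)) * (P * sqrt (real k) + Q / sqrt (real k))"
      using k t S[OF k] by (intro mult_mono norm_one_minus_cis_le) (auto simp: abs_mult intro!: divide_nonneg_nonneg)
    finally have "\<bar>T k / (pi * real k)\<^sup>2\<bar> / (2*t) \<le>
        (4 * pi * (real k * t) / (1 + real k * t)) * (P * sqrt (real k) + Q / sqrt (real k)) / (pi * real k)\<^sup>2 / (2 * t)"
      unfolding abs_divide abs_power2 using t by (intro divide_right_mono) auto
    also have "\<dots> = 2 / pi * ((P * sqrt (real k) + Q / sqrt (real k)) / (real k * (1 + real k * t)))"
    proof -
      have "\<And>K w R :: real. 0 < K \<Longrightarrow> 0 < w \<Longrightarrow>
          (4 * pi * (K * t) / w) * R / (pi * K)\<^sup>2 / (2 * t) = 2 / pi * (R / (K * w))"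
        using t by (simp add: field_simps power2_eq_square)
      then show ?thesis by this (use k t in \<open>auto intro: add_pos_nonneg\<close>)
    qed
    also have "\<dots> \<le> 1 * ((P * sqrt (real k) + Q / sqrt (real k)) / (real k * (1 + real k * t)))"
      using k t PQ pi_gt3 by (intro mult_right_mono divide_nonneg_nonneg add_nonneg_nonneg mult_nonneg_nonneg) auto
    also have "\<dots> = P * (sqrt (real k) / real k / (1 + real k * t)) + Q * (1 / (real k * sqrt (real k)) / (1 + real k * t))"
      by (simp add: add_divide_distrib)
    also have "sqrt (real k) / real k = 1 / sqrt (real k)"
      using k by (simp add: field_simps)
    also have "1 / (real k * sqrt (real k)) / (1 + real k * t) \<le> 1 / (real k * sqrt (real k)) / 1"
      using k t by (intro divide_left_mono) (auto intro: add_pos_nonneg)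
    finally show ?thesis using PQ by (simp add: mult_left_mono)
  qed
  have partial: "\<bar>\<Sum>n<N. T (Suc n) / (pi * real (Suc n))\<^sup>2\<bar> / (2*t) \<le> 4 * P / sqrt t + 3 * Q" for N
  proof -
    have "\<bar>\<Sum>n<N. T (Suc n) / (pi * real (Suc n))\<^sup>2\<bar> / (2*t)
        \<le> (\<Sum>n<N. \<bar>T (Suc n) / (pi * real (Suc n))\<^sup>2\<bar>) / (2*t)"
      using t by (intro divide_right_mono sum_abs) auto
    also have "\<dots> = (\<Sum>k=1..N. \<bar>T k / (pi * real k)\<^sup>2\<bar> / (2*t))"
      unfolding sum_divide_distrib by (simp only: sum.atLeast1_atMost_eq One_nat_def)
    also have "\<dots> \<le> (\<Sum>k=1..N. P * (1 / (sqrt (real k) * (1 + real k * t))) + Q * (1 / (real k * sqrt (real k))))"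
      by (intro sum_mono T) simp
    also have "\<dots> = P * (\<Sum>k=1..N. 1 / (sqrt (real k) * (1 + real k * t))) + Q * (\<Sum>k=1..N. 1 / (real k * sqrt (real k)))"
      by (simp add: sum.distrib sum_distrib_left)
    also have "\<dots> \<le> P * (4 / sqrt t) + Q * 3"
      using PQ t by (intro add_mono mult_left_mono sum_arctan_telescope sum_inverse_three_halves_le) auto
    finally show ?thesis by simp
  qed
  have "(\<lambda>N. T (Suc N) / (pi * real (Suc N))\<^sup>2) sums (\<Sum>n\<in>A. ((sawtooth (y n))\<^sup>2 + c) - ((sawtooth (y n - \<tau>))\<^sup>2 + c))"
    unfolding T_def sum_divide_distrib diff_divide_distrib
    by (intro sums_sum sums_diff c)
  then have "(\<lambda>N. \<bar>\<Sum>n<N. T (Suc n) / (pi * real (Suc n))\<^sup>2\<bar> / (2*t)) \<longlonglongrightarrow>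
     \<bar>\<Sum>n\<in>A. ((sawtooth (y n))\<^sup>2 + c) - ((sawtooth (y n - \<tau>))\<^sup>2 + c)\<bar> / (2*t)"
    unfolding sums_def using t by (intro tendsto_intros) auto
  then have "\<bar>\<Sum>n\<in>A. ((sawtooth (y n))\<^sup>2 + c) - ((sawtooth (y n - \<tau>))\<^sup>2 + c)\<bar> / (2*t) \<le> 4 * P / sqrt t + 3 * Q"
    by (rule LIMSEQ_le_const2) (use partial in auto)
  then show ?thesis by simp
qed

lemma sum_sawtooth_le:
  fixes y :: "'a \<Rightarrow> real"
  assumes t: "0 < t" "t < 1" and PQ: "0 \<le> P" "0 \<le> Q"
    and S: "\<And>k. k \<ge> 1 \<Longrightarrow> norm (\<Sum>n\<in>A. cis (2 * pi * (real k * y n))) \<le> P * sqrt (real k) + Q / sqrt (real k)"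
  shows "\<bar>\<Sum>n\<in>A. sawtooth (y n)\<bar> \<le> real (card A) * t + 4 * P / sqrt t + 3 * Q"
proof -
  have "(\<Sum>n\<in>A. sawtooth (y n)) \<le> (\<Sum>n\<in>A. t + ((sawtooth (y n))\<^sup>2 - (sawtooth (y n - t))\<^sup>2) / (2 * t))"
    by (rule sum_mono) (rule sawtooth_le_difference_quotient[OF t])
  also have "\<dots> = real (card A) * t + (\<Sum>n\<in>A. (sawtooth (y n))\<^sup>2 - (sawtooth (y n - t))\<^sup>2) / (2 * t)"
    unfolding sum.distrib sum_divide_distrib by simp
  also have "\<dots> \<le> real (card A) * t + \<bar>\<Sum>n\<in>A. (sawtooth (y n))\<^sup>2 - (sawtooth (y n - t))\<^sup>2\<bar> / (2 * t)"
    using t by (intro add_left_mono divide_right_mono) auto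
  also have "\<dots> \<le> real (card A) * t + (4 * P / sqrt t + 3 * Q)"
    using t PQ S by (intro add_left_mono sum_sawtooth_sq_diff_le) auto
  finally have up: "(\<Sum>n\<in>A. sawtooth (y n)) \<le> real (card A) * t + (4 * P / sqrt t + 3 * Q)" .
  have "(\<Sum>n\<in>A. sawtooth (y n)) \<ge> (\<Sum>n\<in>A. - t + ((sawtooth (y n + t))\<^sup>2 - (sawtooth (y n))\<^sup>2) / (2 * t))"
    by (rule sum_mono) (rule sawtooth_ge_difference_quotient[OF t])
  also have "(\<Sum>n\<in>A. - t + ((sawtooth (y n + t))\<^sup>2 - (sawtooth (y n))\<^sup>2) / (2 * t))
     = (\<Sum>n\<in>A. - t - ((sawtooth (y n))\<^sup>2 - (sawtooth (y n - (-t)))\<^sup>2) / (2 * t))"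
    by (intro sum.cong refl) (simp add: diff_divide_distrib)
  also have "\<dots> = (\<Sum>n\<in>A. - t) - (\<Sum>n\<in>A. ((sawtooth (y n))\<^sup>2 - (sawtooth (y n - (-t)))\<^sup>2) / (2 * t))"
    by (rule sum_subtractf)
  also have "\<dots> = - (real (card A) * t) - (\<Sum>n\<in>A. (sawtooth (y n))\<^sup>2 - (sawtooth (y n - (-t)))\<^sup>2) / (2 * t)"
    unfolding sum_divide_distrib by simp
  finally have "(\<Sum>n\<in>A. sawtooth (y n)) \<ge>
     - (real (card A) * t) - \<bar>\<Sum>n\<in>A. (sawtooth (y n))\<^sup>2 - (sawtooth (y n - (-t)))\<^sup>2\<bar> / (2 * t)"
    using t divide_right_mono[OF abs_ge_self, of "2*t" "\<Sum>n\<in>A. (sawtooth (y n))\<^sup>2 - (sawtooth (y n - (-t)))\<^sup>2"]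
    by linarith
  moreover have "\<bar>\<Sum>n\<in>A. (sawtooth (y n))\<^sup>2 - (sawtooth (y n - (-t)))\<^sup>2\<bar> / (2 * t) \<le> 4 * P / sqrt t + 3 * Q"
    using t PQ S by (intro sum_sawtooth_sq_diff_le) auto
  ultimately show ?thesis using up by linarith
qed

section \<open>Exponential sums\<close>

lemma cot_antimono:
  assumes "0 < a" "a \<le> b" "b < pi"
  shows "cot b \<le> cot a"
proof -
  have s: "sin a > 0" "sin b > 0" using assms by (auto intro!: sin_gt_zero)
  have "cot a - cot b = sin (b - a) / (sin a * sin b)"
    using s by (simp add: cot_def sin_diff field_simps)
  also have "\<dots> \<ge> 0" using assms s by (intro divide_nonneg_nonneg sin_ge_zero) auto
  finally show ?thesis by simp
qed

lemma inverse_one_minus_cis: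
  assumes "sin (pi * d) \<noteq> 0"
  shows "1 / (1 - cis (2 * pi * d)) = Complex (1/2) (cot (pi * d) / 2)"
proof -
  have c: "cos (2 * pi * d) = 1 - 2 * (sin (pi * d))\<^sup>2" and s: "sin (2 * pi * d) = 2 * sin (pi * d) * cos (pi * d)"
    using cos_double_sin[of "pi * d"] sin_double[of "pi * d"] by (simp_all add: mult_ac)
  have "Complex (1/2) (cot (pi * d) / 2) * (1 - cis (2 * pi * d)) = 1"
  proof (rule complex_eqI)
    show "Re (Complex (1/2) (cot (pi * d) / 2) * (1 - cis (2 * pi * d))) = Re 1"
      using assms sin_cos_squared_add[of "pi * d"]
      by (simp add: c s cot_def power2_eq_square)
    show "Im (Complex (1/2) (cot (pi * d) / 2) * (1 - cis (2 * pi * d))) = Im 1"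
      using assms by (simp add: c s cot_def power2_eq_square)
  qed
  moreover have "1 - cis (2 * pi * d) \<noteq> 0"
    using calculation by auto
  ultimately show ?thesis by (simp add: divide_eq_eq)
qed

lemma sum_by_parts_differences:
  fixes c e :: "nat \<Rightarrow> complex"
  shows "(\<Sum>n<Suc M. c n * (e n - e (Suc n)))
    = c 0 * e 0 - c M * e (Suc M) + (\<Sum>n<M. (c (Suc n) - c n) * e (Suc n))"
  by (induction M) (simp_all add: algebra_simps)

text \<open>
  The Kusmin-Landau inequality. If the step \<open>d\<close> from \<open>x n\<close> to \<open>x (Suc n)\<close> were constant, the sum would be
  geometric with ratio \<open>cis (2 * pi * d)\<close> away from 1. In general each term is a multiple
  \<open>c n = 1 / (1 - cis (2 * pi * d n))\<close> of the difference of consecutive terms, and summation by parts leaves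
  the total variation of \<open>c\<close>. Its real part is constantly \<open>1/2\<close> and its imaginary part is half a
  cotangent of a monotone argument, so the variation telescopes.
\<close>

lemma kusmin_landau_nat:
  fixes x :: "nat \<Rightarrow> real"
  assumes \<theta>: "0 < \<theta>" "\<theta> \<le> 1/2"
    and mono: "\<And>n. Suc n < M \<Longrightarrow> x (Suc n) - x n \<le> x (Suc (Suc n)) - x (Suc n)"
    and bd: "\<And>n. n < M \<Longrightarrow> real_of_int \<nu> + \<theta> \<le> x (Suc n) - x n \<and> x (Suc n) - x n \<le> real_of_int \<nu> + 1 - \<theta>"
  shows "norm (\<Sum>n\<le>M. cis (2 * pi * x n)) \<le> 2 / \<theta>"
proof (cases M)
  case 0
  then show ?thesis using \<theta> by (simp add: field_simps)
next
  case (Suc m)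
  define d where "d = (\<lambda>n. x (Suc n) - x n - real_of_int \<nu>)"
  define C where "C = (\<lambda>n. Complex (1/2) (cot (pi * d n) / 2))"
  define e where "e = (\<lambda>n. cis (2 * pi * x n))"
  define \<sigma> where "\<sigma> = sin (pi * \<theta>)"
  have \<sigma>2: "2 * \<theta> \<le> \<sigma>"
  proof -
    have "concave_on {0..pi/2} sin"
      unfolding concave_on_def
      by (rule f''_ge0_imp_convex[where f' = "\<lambda>x. - cos x" and f'' = sin])
         (auto intro!: derivative_eq_intros sin_ge_zero)
    then have "sin ((1 - 2*\<theta>) *\<^sub>R 0 + (2*\<theta>) *\<^sub>R (pi/2)) \<ge> (1 - 2*\<theta>) * sin 0 + (2*\<theta>) * sin (pi/2)"
      using \<theta> pi_gt_zero by (intro concave_onD) auto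
    then show ?thesis by (simp add: \<sigma>_def mult_ac)
  qed
  have \<sigma>: "0 < \<sigma>" using \<sigma>2 \<theta> by simp
  have d: "\<theta> \<le> d n" "d n \<le> 1 - \<theta>" if "n < M" for n
    using bd[OF that] by (auto simp: d_def)
  have pid: "0 < pi * d n" "pi * d n < pi" "pi * \<theta> \<le> pi * d n" "pi * d n \<le> pi * (1 - \<theta>)" if "n < M" for n
    using d[OF that] \<theta> by auto
  have dm: "d n \<le> d (Suc n)" if "Suc n < M" for n using mono[OF that] by (simp add: d_def)
  have sn: "\<sigma> \<le> sin (pi * d n)" if "n < M" for n
  proof (cases "d n \<le> 1/2")
    case True
    then show ?thesis unfolding \<sigma>_def using pid[OF that] \<theta>
      mult_left_mono[of "d n" "1/2" pi] True order_trans[OF _ less_imp_le[OF mult_pos_pos[OF pi_gt_zero \<theta>(1)]]]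
      by (intro sin_monotone_2pi_le) auto
  next
    case False
    have "sin (pi * \<theta>) \<le> sin (pi - pi * d n)"
    proof (rule sin_monotone_2pi_le)
      show "pi * \<theta> \<le> pi - pi * d n" using pid(4)[OF that] by (simp add: algebra_simps)
      have "pi * (1/2) \<le> pi * d n" using False by (intro mult_left_mono) auto
      then show "pi - pi * d n \<le> pi / 2" by simp
      show "- (pi/2) \<le> pi * \<theta>" using \<theta> pi_gt_zero mult_pos_pos[of pi \<theta>] by linarith
    qed
    then show ?thesis by (simp add: \<sigma>_def)
  qed
  have step: "e n = C n * (e n - e (Suc n))" if "n < M" for n
  proof -
    have "2 * pi * x (Suc n) = 2 * pi * x n + 2 * pi * d n + 2 * pi * of_int \<nu>"
      by (simp add: d_def algebra_simps)
    then have "e (Suc n) = e n * cis (2 * pi * d n) * cis (2 * pi * of_int \<nu>)"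
      by (simp only: e_def cis_mult)
    moreover have "cis (2 * pi * of_int \<nu>) = 1" by (rule cis_multiple_2pi) auto
    ultimately have "e (Suc n) = e n * cis (2 * pi * d n)" by simp
    then have "C n * (e n - e (Suc n)) = e n * (C n * (1 - cis (2 * pi * d n)))"
      by (simp add: algebra_simps)
    moreover have sn0: "sin (pi * d n) \<noteq> 0" using sn[OF that] \<sigma> by auto
    have "1 / (1 - cis (2 * pi * d n)) = C n" using inverse_one_minus_cis[OF sn0] by (simp add: C_def)
    moreover have "1 - cis (2 * pi * d n) \<noteq> 0"
    proof
      assume "1 - cis (2 * pi * d n) = 0"
      then have "C n = 0" using \<open>1 / (1 - cis (2 * pi * d n)) = C n\<close> by simp
      then show False by (simp add: C_def complex_eq_iff)
    qed
    ultimately show ?thesis by (metis mult.right_neutral nonzero_eq_divide_eq)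
  qed
  have nC: "norm (C n) \<le> 1 / (2 * \<sigma>)" if "n < M" for n
  proof -
    have s: "sin (pi * d n) > 0" using sn[OF that] \<sigma> by simp
    have "(norm (C n))\<^sup>2 = (1 / (2 * sin (pi * d n)))\<^sup>2"
    proof -
      have "(1/2)\<^sup>2 + (c / S / 2)\<^sup>2 = (S\<^sup>2 + c\<^sup>2) / (2 * S)\<^sup>2" if "S > 0" for c S :: real
        using that by (simp add: field_simps power2_eq_square)
      from this[OF s, of "cos (pi * d n)"] show ?thesis
        by (simp add: C_def cmod_power2 cot_def power_one_over)
    qed
    then have "norm (C n) = 1 / (2 * sin (pi * d n))"
      using s by (metis norm_ge_zero power2_eq_imp_eq divide_nonneg_pos zero_le_one mult_pos_pos zero_less_numeral)
    also have "\<dots> \<le> 1 / (2 * \<sigma>)" using sn[OF that] \<sigma> by (intro divide_left_mono) auto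
    finally show ?thesis .
  qed
  have cotb: "\<bar>cot (pi * d n)\<bar> \<le> 1 / \<sigma>" if "n < M" for n
  proof -
    have "\<bar>cot (pi * d n)\<bar> = \<bar>cos (pi * d n)\<bar> / \<bar>sin (pi * d n)\<bar>" by (simp add: cot_def)
    also have "\<dots> \<le> 1 / \<sigma>" using sn[OF that] \<sigma> by (intro frac_le) auto
    finally show ?thesis .
  qed
  have ne: "norm (e n) = 1" for n by (simp add: e_def)
  have telescope: "(\<Sum>n<k. (g n - g (Suc n)) / 2) = (g 0 - g k) / 2" for g :: "nat \<Rightarrow> real" and k
    by (induction k) (simp_all add: field_simps)
  have "(\<Sum>n<M. e n) = (\<Sum>n<Suc m. C n * (e n - e (Suc n)))"
    using step unfolding Suc by (intro sum.cong) auto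
  also have "\<dots> = C 0 * e 0 - C m * e (Suc m) + (\<Sum>n<m. (C (Suc n) - C n) * e (Suc n))"
    by (rule sum_by_parts_differences)
  finally have "norm (\<Sum>n<M. e n) \<le> norm (C 0 * e 0) + norm (C m * e (Suc m)) + norm (\<Sum>n<m. (C (Suc n) - C n) * e (Suc n))"
    using norm_triangle_ineq[of "C 0 * e 0 - C m * e (Suc m)" "\<Sum>n<m. (C (Suc n) - C n) * e (Suc n)"]
      norm_triangle_ineq4[of "C 0 * e 0" "C m * e (Suc m)"] by simp
  also have "\<dots> \<le> 1 / (2 * \<sigma>) + 1 / (2 * \<sigma>) + 1 / \<sigma>"
  proof (intro add_mono)
    show "norm (C 0 * e 0) \<le> 1 / (2 * \<sigma>)" "norm (C m * e (Suc m)) \<le> 1 / (2 * \<sigma>)"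
      using nC[of 0] nC[of m] Suc by (simp_all add: norm_mult ne)
    have "norm (\<Sum>n<m. (C (Suc n) - C n) * e (Suc n)) \<le> (\<Sum>n<m. norm ((C (Suc n) - C n) * e (Suc n)))"
      by (rule norm_sum)
    also have "\<dots> = (\<Sum>n<m. (cot (pi * d n) - cot (pi * d (Suc n))) / 2)"
    proof (rule sum.cong[OF refl])
      fix n assume "n \<in> {..<m}"
      then have n: "n < M" "Suc n < M" using Suc by auto
      have "C (Suc n) - C n = Complex 0 ((cot (pi * d (Suc n)) - cot (pi * d n)) / 2)"
        by (simp add: C_def complex_eq_iff diff_divide_distrib)
      moreover have "cot (pi * d (Suc n)) \<le> cot (pi * d n)"
        using pid[OF n(1)] pid[OF n(2)] dm[OF n(2)] by (intro cot_antimono) auto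
      ultimately have "norm (C (Suc n) - C n) = (cot (pi * d n) - cot (pi * d (Suc n))) / 2"
        by (simp add: complex_norm)
      then show "norm ((C (Suc n) - C n) * e (Suc n)) = (cot (pi * d n) - cot (pi * d (Suc n))) / 2"
        by (simp only: norm_mult ne mult_1_right)
    qed
    also have "\<dots> = (cot (pi * d 0) - cot (pi * d m)) / 2"
      by (rule telescope)
    also have "\<dots> \<le> 1 / \<sigma>" using cotb[of 0] cotb[of m] Suc by simp
    finally show "norm (\<Sum>n<m. (C (Suc n) - C n) * e (Suc n)) \<le> 1 / \<sigma>" .
  qed
  also have "\<dots> = 2 / \<sigma>" using \<sigma> by (simp add: field_simps)
  also have "\<dots> \<le> 1 / \<theta>" using \<sigma>2 \<sigma> \<theta> by (simp add: field_simps)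
  finally have "norm (\<Sum>n<M. e n) \<le> 1 / \<theta>" .
  moreover have "(\<Sum>n\<le>M. e n) = (\<Sum>n<M. e n) + e M" by (simp add: lessThan_Suc_atMost[symmetric])
  ultimately have "norm (\<Sum>n\<le>M. e n) \<le> 1 / \<theta> + 1"
    using norm_triangle_ineq[of "\<Sum>n<M. e n" "e M"] ne[of M] by simp
  also have "\<dots> \<le> 2 / \<theta>" using \<theta> by (simp add: field_simps)
  finally show ?thesis by (simp add: e_def)
qed

lemma finite_int_interval:
  fixes A :: "int set"
  assumes "finite A" "A \<noteq> {}" and conv: "\<And>i j k. i \<in> A \<Longrightarrow> k \<in> A \<Longrightarrow> i \<le> j \<Longrightarrow> j \<le> k \<Longrightarrow> j \<in> A"
  shows "A = {Min A..Max A}"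
proof (intro equalityI subsetI)
  fix j assume "j \<in> {Min A..Max A}"
  then show "j \<in> A" by (intro conv[OF Min_in Max_in] assms(1,2)) simp_all
qed (use assms(1) in auto)

lemma kusmin_landau:
  fixes x :: "int \<Rightarrow> real"
  assumes \<theta>: "0 < \<theta>" "\<theta> \<le> 1/2"
    and mono: "\<And>n. u \<le> n \<Longrightarrow> n + 1 < v \<Longrightarrow> x (n + 1) - x n \<le> x (n + 2) - x (n + 1)"
    and bd: "\<And>n. u \<le> n \<Longrightarrow> n < v \<Longrightarrow> real_of_int \<nu> + \<theta> \<le> x (n + 1) - x n \<and> x (n + 1) - x n \<le> real_of_int \<nu> + 1 - \<theta>"
  shows "norm (\<Sum>n\<in>{u..v}. cis (2 * pi * x n)) \<le> 2 / \<theta>"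
proof (cases "u \<le> v")
  case True
  define M where "M = nat (v - u)"
  have "(\<Sum>n\<in>{u..v}. cis (2 * pi * x n)) = (\<Sum>n\<le>M. cis (2 * pi * x (u + int n)))"
    by (rule sum.reindex_bij_witness[of _ "\<lambda>n. u + int n" "\<lambda>n. nat (n - u)"])
       (use True in \<open>auto simp: M_def\<close>)
  also have "norm \<dots> \<le> 2 / \<theta>"
  proof (rule kusmin_landau_nat[OF \<theta>, of _ _ \<nu>])
    fix n assume "Suc n < M"
    then show "x (u + int (Suc n)) - x (u + int n) \<le> x (u + int (Suc (Suc n))) - x (u + int (Suc n))"
      using mono[of "u + int n"] by (simp add: M_def algebra_simps)
  next
    fix n assume "n < M"
    then show "real_of_int \<nu> + \<theta> \<le> x (u + int (Suc n)) - x (u + int n) \<and>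
       x (u + int (Suc n)) - x (u + int n) \<le> real_of_int \<nu> + 1 - \<theta>"
      using bd[of "u + int n"] by (simp add: M_def algebra_simps)
  qed
  finally show ?thesis .
qed (use \<theta> in auto)

lemma card_int_le_diameter:
  fixes A :: "int set"
  assumes "finite A" "\<And>i j. i \<in> A \<Longrightarrow> j \<in> A \<Longrightarrow> i \<le> j \<Longrightarrow> real_of_int (j - i) \<le> w" "0 \<le> w"
  shows "real (card A) \<le> w + 1"
proof (cases "A = {}")
  case False
  have "A \<subseteq> {Min A..Max A}" using assms by auto
  then have "card A \<le> card {Min A..Max A}" by (intro card_mono) auto
  moreover have "Min A \<le> Max A" using assms False by auto
  moreover have "real_of_int (Max A - Min A) \<le> w"
    using assms False by auto
  ultimately show ?thesis by simp
qed (use assms in auto)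

text \<open>
  Van der Corput's second derivative test, with second differences in place of second derivatives.
  The steps \<open>d n\<close> increase by at least \<open>lam\<close>, so few of them are close to a given integer; between two
  consecutive integers the steps stay at distance \<open>\<Delta>\<close> from both, and the Kusmin-Landau inequality applies. The
  choice \<open>\<Delta> = sqrt lam / 2\<close> balances the two contributions. For \<open>lam > 1\<close> the claim is the trivial bound by
  the number of terms, which is at most \<open>V / lam + 2\<close>; this case occurs for high frequencies.
\<close>

lemma second_derivative_test:
  fixes x :: "int \<Rightarrow> real"
  defines "d \<equiv> (\<lambda>n. x (n + 1) - x n)"
  assumes lam: "0 < lam"
    and gap: "\<And>n. u \<le> n \<Longrightarrow> n + 1 < v \<Longrightarrow> d n + lam \<le> d (n + 1)"
    and V: "\<And>m n. u \<le> m \<Longrightarrow> m \<le> n \<Longrightarrow> n < v \<Longrightarrow> d n - d m \<le> V" "0 \<le> V"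
  shows "norm (\<Sum>n\<in>{u..v}. cis (2 * pi * x n)) \<le> 13 * (V + 1) / sqrt lam + 2 * sqrt lam"
proof (cases "u \<le> v")
  case False
  then show ?thesis using V lam by simp
next
  case uv: True
  have gap': "d m + lam * real_of_int (n - m) \<le> d n" if "u \<le> m" "m \<le> n" "n < v" for m n
    using that(2,3)
  proof (induction n rule: int_ge_induct)
    case base
    then show ?case by simp
  next
    case (step i)
    then show ?case using gap[of i] \<open>u \<le> m\<close> by (simp add: algebra_simps)
  qed
  have sl: "sqrt lam * sqrt lam = lam" "sqrt lam > 0" using lam by auto
  show ?thesis
  proof (cases "lam \<le> 1")
    case False
    have s1: "1 \<le> sqrt lam" using False by simp
    have "norm (\<Sum>n\<in>{u..v}. cis (2 * pi * x n)) \<le> (\<Sum>n\<in>{u..v}. norm (cis (2 * pi * x n)))"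
      by (rule norm_sum)
    also have "\<dots> = real_of_int (v - u) + 1" using uv by simp
    also have "\<dots> \<le> V / sqrt lam + 2 * sqrt lam"
    proof (cases "u < v")
      case True
      have "sqrt lam * (sqrt lam * real_of_int (v - 1 - u)) \<le> V"
        using gap'[of u "v - 1"] V(1)[of u "v - 1"] True sl by (simp flip: mult.assoc)
      moreover have "1 * real_of_int (v - 1 - u) \<le> sqrt lam * real_of_int (v - 1 - u)"
        using s1 True by (intro mult_right_mono) auto
      then have "sqrt lam * (1 * real_of_int (v - 1 - u)) \<le> sqrt lam * (sqrt lam * real_of_int (v - 1 - u))"
        using sl by (intro mult_left_mono) auto
      ultimately have "sqrt lam * real_of_int (v - 1 - u) \<le> V"
        by simp
      then have "real_of_int (v - 1 - u) \<le> V / sqrt lam" using sl by (simp add: field_simps)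
      then show ?thesis using s1 by linarith
    next
      case False
      then have "real_of_int (v - u) = 0" using uv by simp
      moreover have "0 \<le> V / sqrt lam" using V sl by simp
      ultimately show ?thesis using s1 by linarith
    qed
    also have "V / sqrt lam \<le> 13 * (V + 1) / sqrt lam"
      using V sl by (intro divide_right_mono) auto
    finally show ?thesis by simp
  next
    case True
    have s1: "sqrt lam \<le> 1" using True by simp
    define \<Delta> where "\<Delta> = sqrt lam / 2"
    have \<Delta>: "0 < \<Delta>" "\<Delta> \<le> 1/2" using sl s1 by (auto simp: \<Delta>_def)
    define F where "F = (\<lambda>n. \<lfloor>d n + \<Delta>\<rfloor>)"
    define I where "I = {u..<v}"
    have finI: "finite I" by (simp add: I_def)
    have dmono: "d m \<le> d n" if "u \<le> m" "m \<le> n" "n < v" for m n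
    proof -
      have "0 \<le> lam * real_of_int (n - m)" using lam that by (intro mult_nonneg_nonneg) auto
      then show ?thesis using gap'[OF that] by linarith
    qed
    (* Group the terms by the integer nu with nu - Delta <= d n < nu + 1 - Delta; B collects the
       steps within Delta of nu, G the remaining ones. *)
    have fib: "norm (\<Sum>n\<in>{n\<in>I. F n = \<nu>}. cis (2 * pi * x n)) \<le> 6 / sqrt lam" for \<nu>
    proof -
      define B where "B = {n\<in>I. F n = \<nu> \<and> d n < of_int \<nu> + \<Delta>}"
      define G where "G = {n\<in>I. F n = \<nu> \<and> of_int \<nu> + \<Delta> \<le> d n}"
      have fin: "finite B" "finite G" using finI by (simp_all add: B_def G_def)
      have Fi: "of_int \<nu> - \<Delta> \<le> d n" "d n < of_int \<nu> + 1 - \<Delta>" if "F n = \<nu>" for n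
        using that floor_correct[of "d n + \<Delta>"] unfolding F_def by linarith+
      have "norm (\<Sum>n\<in>B. cis (2 * pi * x n)) \<le> (\<Sum>n\<in>B. norm (cis (2 * pi * x n)))" by (rule norm_sum)
      also have "\<dots> = real (card B)" by simp
      also have "\<dots> \<le> 2 * \<Delta> / lam + 1"
      proof (rule card_int_le_diameter[OF fin(1)])
        fix i j assume ij: "i \<in> B" "j \<in> B" "i \<le> j"
        then have "d i + lam * real_of_int (j - i) \<le> d j" by (intro gap') (auto simp: B_def I_def)
        moreover have "d j < of_int \<nu> + \<Delta>" "of_int \<nu> - \<Delta> \<le> d i" using ij Fi[of i] by (auto simp: B_def)
        ultimately show "real_of_int (j - i) \<le> 2 * \<Delta> / lam" using lam by (simp add: field_simps)
      qed (use \<Delta> lam in auto)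
      also have "2 * \<Delta> / lam = 1 / sqrt lam" using sl by (simp add: \<Delta>_def field_simps)
      finally have 1: "norm (\<Sum>n\<in>B. cis (2 * pi * x n)) \<le> 1 / sqrt lam + 1" .
      have 2: "norm (\<Sum>n\<in>G. cis (2 * pi * x n)) \<le> 2 / \<Delta>"
      proof (cases "G = {}")
        case False
        have conv: "j \<in> G" if "i \<in> G" "k \<in> G" "i \<le> j" "j \<le> k" for i j k
        proof -
          have "d i \<le> d j" "d j \<le> d k" using that by (auto intro!: dmono simp: G_def I_def)
          moreover have "of_int \<nu> + \<Delta> \<le> d i" "d k < of_int \<nu> + 1 - \<Delta>" using that Fi[of k] by (auto simp: G_def)
          ultimately have "of_int \<nu> + \<Delta> \<le> d j" "d j < of_int \<nu> + 1 - \<Delta>" by linarith+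
          moreover from this have "F j = \<nu>"
            unfolding F_def using \<Delta> by (intro floor_unique) linarith+
          ultimately show ?thesis using that by (auto simp: G_def I_def)
        qed
        have G: "G = {Min G..Max G}" by (rule finite_int_interval[OF fin(2) False conv])
        have inG: "n \<in> G" if "Min G \<le> n" "n \<le> Max G" for n by (subst G) (use that in simp)
        have KL: "norm (\<Sum>n\<in>{Min G..Max G}. cis (2 * pi * x n)) \<le> 2 / \<Delta>"
        proof (rule kusmin_landau[OF \<Delta>, of _ _ _ \<nu>])
          fix n assume n: "Min G \<le> n" "n + 1 < Max G"
          then have "n \<in> G" "n + 1 \<in> G" by (auto intro!: inG)
          then have "d n \<le> d (n + 1)" by (intro dmono) (auto simp: G_def I_def)
          then show "x (n + 1) - x n \<le> x (n + 2) - x (n + 1)" by (simp add: d_def add.assoc)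
        next
          fix n assume "Min G \<le> n" "n < Max G"
          then have "n \<in> G" by (auto intro!: inG)
          then have "of_int \<nu> + \<Delta> \<le> d n" "d n < of_int \<nu> + 1 - \<Delta>" using Fi[of n] by (auto simp: G_def)
          then show "real_of_int \<nu> + \<Delta> \<le> x (n + 1) - x n \<and> x (n + 1) - x n \<le> real_of_int \<nu> + 1 - \<Delta>"
            by (simp add: d_def)
        qed
        show ?thesis by (subst G) (rule KL)
      qed (use \<Delta> in simp)
      have "{n\<in>I. F n = \<nu>} = B \<union> G" by (auto simp: B_def G_def)
      then have "(\<Sum>n\<in>{n\<in>I. F n = \<nu>}. cis (2 * pi * x n)) = (\<Sum>n\<in>B. cis (2 * pi * x n)) + (\<Sum>n\<in>G. cis (2 * pi * x n))"
        using fin by (simp add: sum.union_disjoint[symmetric] B_def G_def disjoint_iff)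
      then have "norm (\<Sum>n\<in>{n\<in>I. F n = \<nu>}. cis (2 * pi * x n)) \<le> (1 / sqrt lam + 1) + 2 / \<Delta>"
        using 1 2 norm_triangle_ineq[of "\<Sum>n\<in>B. cis (2 * pi * x n)" "\<Sum>n\<in>G. cis (2 * pi * x n)"] by simp
      also have "\<dots> \<le> 6 / sqrt lam"
      proof -
        have "1 \<le> 1 / sqrt lam" using sl s1 by simp
        moreover have "6 / sqrt lam = 1 / sqrt lam + 1 / sqrt lam + 2 / \<Delta>"
          by (simp add: \<Delta>_def add_divide_distrib[symmetric])
        ultimately show ?thesis by linarith
      qed
      finally show ?thesis .
    qed
    have cI: "real (card (F ` I)) \<le> V + 2"
    proof (cases "I = {}")
      case False
      have "real (card (F ` I)) \<le> (V + 1) + 1"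
      proof (rule card_int_le_diameter)
        fix i j assume "i \<in> F ` I" "j \<in> F ` I" "i \<le> j"
        then obtain m n where mn: "m \<in> I" "n \<in> I" "i = F m" "j = F n" by blast
        have "d n - d m \<le> V"
        proof (cases "m \<le> n")
          case True
          then show ?thesis using mn V(1)[of m n] by (auto simp: I_def)
        next
          case False
          then show ?thesis using mn dmono[of n m] V(2) by (auto simp: I_def)
        qed
        then show "real_of_int (j - i) \<le> V + 1"
          unfolding mn F_def of_int_diff
          using floor_correct[of "d n + \<Delta>"] floor_correct[of "d m + \<Delta>"] by linarith
      qed (use finI V in auto)
      then show ?thesis by simp
    qed (use V in auto)
    have "(\<Sum>n\<in>I. cis (2 * pi * x n)) = (\<Sum>\<nu>\<in>F ` I. \<Sum>n\<in>{n\<in>I. F n = \<nu>}. cis (2 * pi * x n))"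
      using finI by (intro sum.group[symmetric]) auto
    also have "norm \<dots> \<le> (\<Sum>\<nu>\<in>F ` I. norm (\<Sum>n\<in>{n\<in>I. F n = \<nu>}. cis (2 * pi * x n)))" by (rule norm_sum)
    also have "\<dots> \<le> (\<Sum>\<nu>\<in>F ` I. 6 / sqrt lam)" by (rule sum_mono) (rule fib)
    also have "\<dots> = real (card (F ` I)) * (6 / sqrt lam)" by simp
    also have "\<dots> \<le> (V + 2) * (6 / sqrt lam)" using cI sl by (intro mult_right_mono) auto
    finally have 1: "norm (\<Sum>n\<in>I. cis (2 * pi * x n)) \<le> (V + 2) * (6 / sqrt lam)" .
    have "{u..v} = insert v I" using uv by (auto simp: I_def)
    then have "(\<Sum>n\<in>{u..v}. cis (2 * pi * x n)) = cis (2 * pi * x v) + (\<Sum>n\<in>I. cis (2 * pi * x n))"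
      using finI by (simp add: I_def)
    then have "norm (\<Sum>n\<in>{u..v}. cis (2 * pi * x n)) \<le> 1 + (V + 2) * (6 / sqrt lam)"
      using 1 norm_triangle_ineq[of "cis (2 * pi * x v)" "\<Sum>n\<in>I. cis (2 * pi * x n)"] by simp
    also have "\<dots> \<le> 1 / sqrt lam + (V + 2) * (6 / sqrt lam)" using sl s1 by simp
    also have "\<dots> = (6 * V + 13) / sqrt lam" by (simp add: add_divide_distrib distrib_right)
    also have "\<dots> \<le> 13 * (V + 1) / sqrt lam" using V sl by (intro divide_right_mono) auto
    finally show ?thesis using sl(2) by linarith
  qed
qed

section \<open>Sawtooth sums along a concave function\<close>

text \<open>
  Half-open intervals make the index sets of adjacent pieces of a partition disjoint. For \<open>a = 0\<close> the indices
  start at 1, as lattice points on the axes are not counted.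
\<close>

definition multiples :: "real \<Rightarrow> real \<Rightarrow> real \<Rightarrow> int set" where
  "multiples \<eta> a b = {n. a < of_int n * \<eta> \<and> of_int n * \<eta> \<le> b}"

lemma multiples_eq:
  assumes "0 < \<eta>"
  shows "multiples \<eta> a b = {\<lfloor>a / \<eta>\<rfloor> + 1..\<lfloor>b / \<eta>\<rfloor>}"
proof -
  have "a < of_int n * \<eta> \<longleftrightarrow> \<lfloor>a / \<eta>\<rfloor> < n" for n :: int
    using assms by (simp add: floor_less_iff divide_less_eq)
  moreover have "of_int n * \<eta> \<le> b \<longleftrightarrow> n \<le> \<lfloor>b / \<eta>\<rfloor>" for n :: int
    using assms by (simp add: le_floor_iff le_divide_eq)
  ultimately show ?thesis by (auto simp: multiples_def)
qed

lemma finite_multiples [simp]: "0 < \<eta> \<Longrightarrow> finite (multiples \<eta> a b)"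
  by (simp add: multiples_eq)

lemma multiples_split:
  assumes "a \<le> c" "c \<le> b"
  shows "multiples \<eta> a b = multiples \<eta> a c \<union> multiples \<eta> c b"
    and "multiples \<eta> a c \<inter> multiples \<eta> c b = {}"
  using assms by (auto simp: multiples_def)

lemma sum_multiples_split:
  fixes h :: "int \<Rightarrow> real"
  assumes "a \<le> c" "c \<le> b" "0 < \<eta>"
  shows "(\<Sum>n\<in>multiples \<eta> a b. h n) = (\<Sum>n\<in>multiples \<eta> a c. h n) + (\<Sum>n\<in>multiples \<eta> c b. h n)"
  using multiples_split[OF assms(1,2)] assms(3) by (simp add: sum.union_disjoint)

lemma card_multiples_split:
  assumes "a \<le> c" "c \<le> b" "0 < \<eta>"
  shows "card (multiples \<eta> a b) = card (multiples \<eta> a c) + card (multiples \<eta> c b)"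
  using multiples_split[OF assms(1,2)] assms(3) by (simp add: card_Un_disjoint)

lemma card_multiples_le:
  assumes "0 < \<eta>" "0 \<le> a" "a \<le> b"
  shows "real (card (multiples \<eta> a b)) \<le> b / \<eta>"
proof -
  have "\<lfloor>a / \<eta>\<rfloor> \<ge> 0" "\<lfloor>a / \<eta>\<rfloor> \<le> \<lfloor>b / \<eta>\<rfloor>"
    using assms by (auto intro!: floor_mono divide_right_mono)
  then have "real (card (multiples \<eta> a b)) \<le> of_int \<lfloor>b / \<eta>\<rfloor>"
    using assms by (simp add: multiples_eq)
  also have "\<dots> \<le> b / \<eta>" by simp
  finally show ?thesis .
qed

lemma mvt_within:
  fixes f f' :: "real \<Rightarrow> real"
  assumes der: "\<And>x. x \<in> I \<Longrightarrow> (f has_real_derivative f' x) (at x within I)"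
    and "is_interval I" "x \<in> I" "y \<in> I" "x < y"
  obtains z where "x < z" "z < y" "z \<in> I" "f y - f x = (y - x) * f' z"
proof -
  have sub: "{x..y} \<subseteq> I"
    using assms(2-4) unfolding is_interval_1 by (meson atLeastAtMost_iff subsetI)
  have d: "(f has_derivative (*) (f' z)) (at z within {x..y})" if "x \<le> z" "z \<le> y" for z
    unfolding has_field_derivative_def[symmetric]
    by (rule DERIV_subset[OF der sub]) (use that sub in auto)
  from mvt_simple[OF \<open>x < y\<close> d] obtain z where "z \<in> {x<..<y}" "f y - f x = f' z * (y - x)"
    by auto
  with sub show ?thesis by (intro that[of z]) (auto simp: mult.commute)
qed

text \<open>
  The mean value theorem is applied to \<open>z \<mapsto> f (z + \<eta>) - f z\<close>. Applying it to the two first differences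
  separately would give intermediate points whose distance is not bounded below.
\<close>

lemma second_difference_le:
  fixes f D :: "real \<Rightarrow> real"
  assumes der: "\<And>x. x \<in> I \<Longrightarrow> (f has_real_derivative D x) (at x within I)"
    and I: "is_interval I"
    and gap: "\<And>x y. x \<in> I \<Longrightarrow> y \<in> I \<Longrightarrow> x \<le> y \<Longrightarrow> D y + l0 * (y - x) \<le> D x"
    and x: "x \<in> I" "x + 2 * \<eta> \<in> I" "0 < \<eta>"
  shows "f (x + 2 * \<eta>) - f (x + \<eta>) + l0 * \<eta>\<^sup>2 \<le> f (x + \<eta>) - f x"
proof -
  have mem: "z \<in> I" if "x \<le> z" "z \<le> x + 2 * \<eta>" for z
    using I x that unfolding is_interval_1 by blast
  have "((\<lambda>z. f (z + \<eta>) - f z) has_real_derivative D (z + \<eta>) - D z) (at z within {x..x+\<eta>})"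
    if z: "z \<in> {x..x+\<eta>}" for z
  proof (rule DERIV_diff)
    have "(f has_real_derivative D (z + \<eta>)) (at (z + \<eta>) within (\<lambda>z. z + \<eta>) ` {x..x+\<eta>})"
      by (rule DERIV_subset[OF der]) (use z x in \<open>auto intro!: mem\<close>)
    then have "(f \<circ> (\<lambda>z. z + \<eta>) has_real_derivative D (z + \<eta>) * 1) (at z within {x..x+\<eta>})"
      by (rule DERIV_image_chain) (auto intro!: derivative_eq_intros)
    then show "((\<lambda>z. f (z + \<eta>)) has_real_derivative D (z + \<eta>)) (at z within {x..x+\<eta>})"
      by (simp add: o_def)
    show "(f has_real_derivative D z) (at z within {x..x+\<eta>})"
      by (rule DERIV_subset[OF der]) (use z x in \<open>auto intro!: mem\<close>)
  qed
  from mvt_within[OF this is_interval_cc, of x "x + \<eta>"] x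
  obtain z where z: "x < z" "z < x + \<eta>"
    "(f (x + \<eta> + \<eta>) - f (x + \<eta>)) - (f (x + \<eta>) - f x) = \<eta> * (D (z + \<eta>) - D z)" by auto
  have "D (z + \<eta>) + l0 * (z + \<eta> - z) \<le> D z"
    using z x by (intro gap mem) auto
  then have "\<eta> * (D (z + \<eta>) - D z) \<le> \<eta> * (- (l0 * \<eta>))"
    using x by (intro mult_left_mono) auto
  moreover have e: "x + \<eta> + \<eta> = x + 2 * \<eta>" by simp
  moreover have "\<eta> * (- (l0 * \<eta>)) = - (l0 * \<eta>\<^sup>2)" by (simp add: power2_eq_square)
  ultimately show ?thesis using z(3)[unfolded e] by linarith
qed

text \<open>
  The phase \<open>k * \<rho> * f (n * \<eta>)\<close> has second differences at most \<open>- k * lam\<close> for \<open>lam = \<rho> * \<eta>\<^sup>2 * l0\<close>, and its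
  first differences vary by at most \<open>k * \<rho> * \<eta> * V0\<close>. This is the input of the second derivative test for
  frequency \<open>k\<close>. The interval is open at \<open>a\<close> so that the lemma applies to a second derivative that is
  unbounded there. The condition \<open>lam\<^sup>2 \<le> t\<close> absorbs the term \<open>sqrt (lam / t)\<close> that comes from high
  frequencies.
\<close>

lemma sum_sawtooth_strongly_concave:
  fixes f D :: "real \<Rightarrow> real"
  assumes der: "\<And>x. x \<in> {a<..b} \<Longrightarrow> (f has_real_derivative D x) (at x within {a<..b})"
    and gap: "\<And>x y. x \<in> {a<..b} \<Longrightarrow> y \<in> {a<..b} \<Longrightarrow> x \<le> y \<Longrightarrow> D y + l0 * (y - x) \<le> D x"
    and V: "\<And>x y. x \<in> {a<..b} \<Longrightarrow> y \<in> {a<..b} \<Longrightarrow> x \<le> y \<Longrightarrow> D x - D y \<le> V0" "0 \<le> V0"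
    and pos: "0 < l0" "0 < \<rho>" "0 < \<eta>" and t: "0 < t" "t < 1" "(\<rho> * \<eta>\<^sup>2 * l0)\<^sup>2 \<le> t"
  shows "\<bar>\<Sum>n\<in>multiples \<eta> a b. sawtooth (\<rho> * f (of_int n * \<eta>))\<bar>
    \<le> real (card (multiples \<eta> a b)) * t
      + 60 * (\<rho> * \<eta> * V0 / sqrt (\<rho> * \<eta>\<^sup>2 * l0 * t) + 1 / sqrt (\<rho> * \<eta>\<^sup>2 * l0))"
proof -
  define lam where "lam = \<rho> * \<eta>\<^sup>2 * l0"
  define W where "W = \<rho> * \<eta> * V0"
  have lam: "0 < lam" using pos by (simp add: lam_def)
  have W: "0 \<le> W" using pos V by (simp add: W_def)
  define y where "y = (\<lambda>n::int. \<rho> * f (of_int n * \<eta>))"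
  have fin: "is_interval {a<..b}" by (rule is_interval_oc)
  have S: "norm (\<Sum>n\<in>multiples \<eta> a b. cis (2 * pi * (real k * y n)))
     \<le> (13 * W / sqrt lam + 2 * sqrt lam) * sqrt (real k) + (13 / sqrt lam) / sqrt (real k)"
    if k: "k \<ge> 1" for k
  proof -
    (* The test wants a convex phase; the sign change only conjugates the exponential sum. *)
    define x where "x = (\<lambda>n. - (real k * y n))"
    define u where "u = \<lfloor>a / \<eta>\<rfloor> + 1"
    define v where "v = \<lfloor>b / \<eta>\<rfloor>"
    have uv: "multiples \<eta> a b = {u..v}" using pos by (simp add: multiples_eq u_def v_def)
    have mem: "of_int n * \<eta> \<in> {a<..b}" if "u \<le> n" "n \<le> v" for n
    proof -
      have "n \<in> multiples \<eta> a b" using uv that by simp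
      then show ?thesis by (simp add: multiples_def)
    qed
    have "norm (\<Sum>n\<in>{u..v}. cis (2 * pi * x n)) \<le> 13 * (real k * W + 1) / sqrt (real k * lam) + 2 * sqrt (real k * lam)"
    proof (rule second_derivative_test)
      show "0 < real k * lam" using k lam by simp
      show "0 \<le> real k * W" using W by simp
    next
      fix n assume n: "u \<le> n" "n + 1 < v"
      have "of_int n * \<eta> \<in> {a<..b}" by (rule mem) (use n in auto)
      moreover have "of_int (n + 2) * \<eta> \<in> {a<..b}" by (rule mem) (use n in auto)
      moreover have "of_int (n + 2) * \<eta> = of_int n * \<eta> + 2 * \<eta>" by (simp add: algebra_simps)
      ultimately have a: "of_int n * \<eta> \<in> {a<..b}" "of_int n * \<eta> + 2 * \<eta> \<in> {a<..b}" by simp_all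
      have "f (of_int n * \<eta> + 2 * \<eta>) - f (of_int n * \<eta> + \<eta>) + l0 * \<eta>\<^sup>2 \<le> f (of_int n * \<eta> + \<eta>) - f (of_int n * \<eta>)"
        by (rule second_difference_le[OF der fin gap a pos(3)])
      then have "real k * \<rho> * (f (of_int n * \<eta> + 2 * \<eta>) - f (of_int n * \<eta> + \<eta>) + l0 * \<eta>\<^sup>2)
         \<le> real k * \<rho> * (f (of_int n * \<eta> + \<eta>) - f (of_int n * \<eta>))"
        using pos by (intro mult_left_mono) auto
      moreover have "of_int (n + 1) * \<eta> = of_int n * \<eta> + \<eta>" "of_int (n + 1 + 1) * \<eta> = of_int n * \<eta> + 2 * \<eta>"
        by (simp_all add: algebra_simps)
      ultimately show "x (n + 1) - x n + real k * lam \<le> x (n + 1 + 1) - x (n + 1)"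
        unfolding x_def y_def lam_def by (simp add: algebra_simps)
    next
      fix m n assume mn: "u \<le> m" "m \<le> n" "n < v"
      have st: "\<exists>z. of_int i * \<eta> < z \<and> z < of_int (i + 1) * \<eta> \<and> z \<in> {a<..b} \<and> x (i + 1) - x i = real k * \<rho> * \<eta> * (- D z)"
        if i: "u \<le> i" "i < v" for i
      proof -
        have "of_int i * \<eta> \<in> {a<..b}" by (rule mem) (use i in auto)
        moreover have "of_int (i + 1) * \<eta> \<in> {a<..b}" by (rule mem) (use i in auto)
        moreover have "of_int i * \<eta> < of_int (i + 1) * \<eta>" using pos by simp
        ultimately have "of_int i * \<eta> \<in> {a<..b}" "of_int (i + 1) * \<eta> \<in> {a<..b}" "of_int i * \<eta> < of_int (i + 1) * \<eta>" .
        from mvt_within[OF der fin this] obtain z where z: "of_int i * \<eta> < z" "z < of_int (i + 1) * \<eta>" "z \<in> {a<..b}"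
          "f (of_int (i + 1) * \<eta>) - f (of_int i * \<eta>) = (of_int (i + 1) * \<eta> - of_int i * \<eta>) * D z" by blast
        have "x (i + 1) - x i = - (real k * \<rho>) * (f (of_int (i + 1) * \<eta>) - f (of_int i * \<eta>))"
          unfolding x_def y_def by (simp add: algebra_simps)
        also have "\<dots> = real k * \<rho> * \<eta> * (- D z)" unfolding z(4) by (simp add: algebra_simps)
        finally show ?thesis using z by blast
      qed
      show "x (n + 1) - x n - (x (m + 1) - x m) \<le> real k * W"
      proof (cases "m = n")
        case True
        then show ?thesis using W by simp
      next
        case False
        obtain z where z: "z < of_int (m + 1) * \<eta>" "z \<in> {a<..b}" "x (m + 1) - x m = real k * \<rho> * \<eta> * (- D z)"
          using st[of m] mn by auto
        obtain z' where z': "of_int n * \<eta> < z'" "z' \<in> {a<..b}" "x (n + 1) - x n = real k * \<rho> * \<eta> * (- D z')"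
          using st[of n] mn by auto
        have "of_int (m + 1) * \<eta> \<le> of_int n * \<eta>" using mn False pos by (intro mult_right_mono) auto
        then have "D z - D z' \<le> V0" using z z' by (intro V) auto
        then have "real k * \<rho> * \<eta> * (D z - D z') \<le> real k * \<rho> * \<eta> * V0"
          using pos by (intro mult_left_mono) auto
        then show ?thesis unfolding z z' W_def by (simp add: algebra_simps)
      qed
    qed
    moreover have "norm (\<Sum>n\<in>{u..v}. cis (2 * pi * x n)) = norm (\<Sum>n\<in>multiples \<eta> a b. cis (2 * pi * (real k * y n)))"
    proof -
      have "(\<Sum>n\<in>{u..v}. cis (2 * pi * x n)) = cnj (\<Sum>n\<in>multiples \<eta> a b. cis (2 * pi * (real k * y n)))"
        unfolding uv cnj_sum by (simp add: x_def cis_cnj)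
      then show ?thesis by (simp only: complex_mod_cnj)
    qed
    moreover have "13 * (real k * W + 1) / sqrt (real k * lam) + 2 * sqrt (real k * lam)
      = (13 * W / sqrt lam + 2 * sqrt lam) * sqrt (real k) + (13 / sqrt lam) / sqrt (real k)"
    proof -
      have "\<And>K s. K > 0 \<Longrightarrow> s > 0 \<Longrightarrow> 13 * (K * K * W + 1) / (K * s) + 2 * (K * s) = (13 * W / s + 2 * s) * K + (13 / s) / K"
        by (simp add: field_simps)
      from this[of "sqrt (real k)" "sqrt lam"] show ?thesis
        using k lam by (simp add: real_sqrt_mult)
    qed
    ultimately show ?thesis by simp
  qed
  have "\<bar>\<Sum>n\<in>multiples \<eta> a b. sawtooth (y n)\<bar> \<le> real (card (multiples \<eta> a b)) * t
     + 4 * (13 * W / sqrt lam + 2 * sqrt lam) / sqrt t + 3 * (13 / sqrt lam)"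
    using S lam W t by (intro sum_sawtooth_le) auto
  also have "4 * (13 * W / sqrt lam + 2 * sqrt lam) / sqrt t = 52 * (W / sqrt (lam * t)) + 8 * (sqrt lam / sqrt t)"
    by (simp add: real_sqrt_mult add_divide_distrib)
  also have "sqrt lam / sqrt t \<le> 1 / sqrt lam"
  proof -
    have "lam \<le> sqrt t" using t lam by (intro real_le_rsqrt) (simp add: lam_def)
    moreover have "sqrt lam * sqrt lam = lam" using lam by simp
    ultimately show ?thesis using lam t by (simp add: field_simps)
  qed
  also have "3 * (13 / sqrt lam) = 39 * (1 / sqrt lam)" by simp
  finally have "\<bar>\<Sum>n\<in>multiples \<eta> a b. sawtooth (y n)\<bar> \<le> real (card (multiples \<eta> a b)) * t
     + (52 * (W / sqrt (lam * t)) + 8 * (1 / sqrt lam)) + 39 * (1 / sqrt lam)"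
    by simp
  also have "\<dots> \<le> real (card (multiples \<eta> a b)) * t + 60 * (W / sqrt (lam * t) + 1 / sqrt lam)"
  proof -
    have "0 \<le> W / sqrt (lam * t)" "0 \<le> 1 / sqrt lam" using W lam t by auto
    then show ?thesis unfolding distrib_left by linarith
  qed
  finally show ?thesis by (simp only: y_def lam_def W_def)
qed

text \<open>
  Here \<open>F = - f''\<close> increases, possibly by a large factor. Cut the interval where \<open>F\<close> doubles. On a part
  \<open>(c, d]\<close> with \<open>F d \<le> 2 * F c\<close> the first error term of the preceding lemma is proportional to the length
  \<open>d - c\<close>, so that these terms add up to one for the whole interval; the second error terms decrease by a factor
  \<open>sqrt 2\<close> from one part to the next and are dominated by the first one.
\<close>

lemma sum_sawtooth_dyadic:
  fixes f D F :: "real \<Rightarrow> real"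
  assumes f: "\<And>x. x \<in> {a..b} \<Longrightarrow> (f has_real_derivative D x) (at x within {a..b})"
    and D: "\<And>x. x \<in> {a..b} \<Longrightarrow> (D has_real_derivative - F x) (at x within {a..b})"
    and F: "continuous_on {a..b} F" "mono_on {a..b} F" "0 < F a" and ab: "a \<le> b"
    and pos: "0 < \<rho>" "0 < \<eta>" and t: "0 < t" "t < 1" "(\<rho> * \<eta>\<^sup>2 * F b)\<^sup>2 \<le> t"
  shows "\<bar>\<Sum>n\<in>multiples \<eta> a b. sawtooth (\<rho> * f (of_int n * \<eta>))\<bar>
    \<le> real (card (multiples \<eta> a b)) * t
      + 60 * (2 * (b - a) * sqrt (\<rho> * F b / t) + 4 / sqrt (\<rho> * \<eta>\<^sup>2 * F a))"
proof -
  have Fpos: "0 < F x" if "x \<in> {a..b}" for x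
    using mono_onD[OF F(2), of a x] that F(3) by auto
  have single: "\<bar>\<Sum>n\<in>multiples \<eta> c d. sawtooth (\<rho> * f (of_int n * \<eta>))\<bar>
    \<le> real (card (multiples \<eta> c d)) * t
      + 60 * (2 * (d - c) * sqrt (\<rho> * F b / t) + 1 / sqrt (\<rho> * \<eta>\<^sup>2 * F c))"
    if cd: "a \<le> c" "c \<le> d" "d \<le> b" and F2: "F d \<le> 2 * F c" for c d
  proof -
    have sub: "{c<..d} \<subseteq> {a..b}" using cd by auto
    have Fc: "0 < F c" "F c \<le> F b" using cd Fpos mono_onD[OF F(2), of c b] by auto
    have mv: "F c * (y - x) \<le> D x - D y \<and> D x - D y \<le> 2 * F c * (d - c)"
      if xy: "x \<in> {c<..d}" "y \<in> {c<..d}" "x \<le> y" for x y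
    proof (cases "x = y")
      case True
      then show ?thesis using cd Fc by simp
    next
      case False
      with xy cd obtain z where z: "x < z" "z < y" "D y - D x = (y - x) * (- F z)"
        using mvt_within[OF D is_interval_cc, of x y] by auto
      have 1: "F c \<le> F z" "F z \<le> 2 * F c"
        using mono_onD[OF F(2), of c z] mono_onD[OF F(2), of z d] z xy cd F2 by auto
      have "F c * (y - x) \<le> F z * (y - x)" using 1 z by (intro mult_right_mono) auto
      moreover have "F z * (y - x) \<le> 2 * F c * (d - c)" using 1 z xy Fc by (intro mult_mono) auto
      ultimately show ?thesis using z(3) by (simp add: algebra_simps)
    qed
    have "\<bar>\<Sum>n\<in>multiples \<eta> c d. sawtooth (\<rho> * f (of_int n * \<eta>))\<bar>
      \<le> real (card (multiples \<eta> c d)) * t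
      + 60 * (\<rho> * \<eta> * (2 * F c * (d - c)) / sqrt (\<rho> * \<eta>\<^sup>2 * F c * t) + 1 / sqrt (\<rho> * \<eta>\<^sup>2 * F c))"
    proof (rule sum_sawtooth_strongly_concave)
      show "(f has_real_derivative D x) (at x within {c<..d})" if "x \<in> {c<..d}" for x
        using DERIV_subset[OF f sub] sub that by auto
      have "(\<rho> * \<eta>\<^sup>2 * F c)\<^sup>2 \<le> (\<rho> * \<eta>\<^sup>2 * F b)\<^sup>2"
        using Fc pos by (intro power_mono mult_left_mono) auto
      with t show "(\<rho> * \<eta>\<^sup>2 * F c)\<^sup>2 \<le> t" by simp
      show "D y + F c * (y - x) \<le> D x" if "x \<in> {c<..d}" "y \<in> {c<..d}" "x \<le> y" for x y
        using mv[OF that] by simp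
      show "D x - D y \<le> 2 * F c * (d - c)" if "x \<in> {c<..d}" "y \<in> {c<..d}" "x \<le> y" for x y
        using mv[OF that] by simp
    qed (use Fc pos t cd in auto)
    also have "\<rho> * \<eta> * (2 * F c * (d - c)) / sqrt (\<rho> * \<eta>\<^sup>2 * F c * t) = 2 * (d - c) * sqrt (\<rho> * F c / t)"
    proof -
      have s: "sqrt \<rho> * sqrt \<rho> = \<rho>" "sqrt (F c) * sqrt (F c) = F c" "sqrt \<rho> \<noteq> 0" "sqrt (F c) \<noteq> 0" "sqrt t \<noteq> 0"
        using pos Fc t by auto
      have "(r * r) * \<eta> * (2 * (g * g) * (d - c)) / (r * \<eta> * g * s) = 2 * (d - c) * (r * g / s)"
        if "r \<noteq> 0" "g \<noteq> 0" "s \<noteq> 0" for r g s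
        using that pos by (simp add: field_simps)
      from this[OF s(3-5)] show ?thesis
        using pos unfolding s(1,2) by (simp add: real_sqrt_mult real_sqrt_divide mult_ac)
    qed
    also have "2 * (d - c) * sqrt (\<rho> * F c / t) \<le> 2 * (d - c) * sqrt (\<rho> * F b / t)"
      using Fc pos t cd by (intro mult_left_mono real_sqrt_le_mono divide_right_mono) auto
    finally show ?thesis by simp
  qed
  have main: "\<bar>\<Sum>n\<in>multiples \<eta> c b. sawtooth (\<rho> * f (of_int n * \<eta>))\<bar>
    \<le> real (card (multiples \<eta> c b)) * t
      + 60 * (2 * (b - c) * sqrt (\<rho> * F b / t) + 4 / sqrt (\<rho> * \<eta>\<^sup>2 * F c))"
    if "c \<in> {a..b}" "F b \<le> 2 ^ K * F c" for c K
    using that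
  proof (induction K arbitrary: c)
    case 0
    have Fc: "0 < F c" using 0 Fpos by auto
    have "0 \<le> 1 / sqrt (\<rho> * \<eta>\<^sup>2 * F c)" using Fc pos by simp
    moreover have "4 / sqrt (\<rho> * \<eta>\<^sup>2 * F c) = 4 * (1 / sqrt (\<rho> * \<eta>\<^sup>2 * F c))" by simp
    ultimately have "1 / sqrt (\<rho> * \<eta>\<^sup>2 * F c) \<le> 4 / sqrt (\<rho> * \<eta>\<^sup>2 * F c)" by linarith
    then show ?case using single[of c b] 0 Fc by force
  next
    case (Suc K)
    have Fc: "0 < F c" using Suc Fpos by auto
    define X where "X = 1 / sqrt (\<rho> * \<eta>\<^sup>2 * F c)"
    have X: "0 \<le> X" using Fc pos by (simp add: X_def)
    have X4: "4 / sqrt (\<rho> * \<eta>\<^sup>2 * F c) = 4 * X" by (simp add: X_def)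
    show ?case
    proof (cases "F b \<le> 2 * F c")
      case True
      then show ?thesis using single[of c b] Suc X unfolding X4 X_def[symmetric] by force
    next
      case False
      have "continuous_on {c..b} F" using F(1) Suc by (auto intro: continuous_on_subset)
      moreover have "F c \<le> 2 * F c" "2 * F c \<le> F b" using Fc False by auto
      ultimately obtain d where d: "c \<le> d" "d \<le> b" "F d = 2 * F c"
        using IVT'[of F c "2 * F c" b] Suc by auto
      have 1: "\<bar>\<Sum>n\<in>multiples \<eta> c d. sawtooth (\<rho> * f (of_int n * \<eta>))\<bar>
        \<le> real (card (multiples \<eta> c d)) * t + 60 * (2 * (d - c) * sqrt (\<rho> * F b / t) + X)"
        unfolding X_def using single[of c d] d Suc by auto
      have "\<bar>\<Sum>n\<in>multiples \<eta> d b. sawtooth (\<rho> * f (of_int n * \<eta>))\<bar>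
        \<le> real (card (multiples \<eta> d b)) * t + 60 * (2 * (b - d) * sqrt (\<rho> * F b / t) + 4 / sqrt (\<rho> * \<eta>\<^sup>2 * F d))"
        using d Suc.prems by (intro Suc.IH) auto
      also have "4 / sqrt (\<rho> * \<eta>\<^sup>2 * F d) = 4 * (X / sqrt 2)"
        unfolding d X_def by (simp add: real_sqrt_mult)
      (* sqrt 2 >= 4/3 turns 1 + 4 / sqrt 2 <= 4 into rational arithmetic. *)
      also have "X / sqrt 2 \<le> X / (4/3)"
      proof (intro divide_left_mono X)
        show "4/3 \<le> sqrt 2" by (rule real_le_rsqrt) (simp add: power2_eq_square)
      qed auto
      finally have 2: "\<bar>\<Sum>n\<in>multiples \<eta> d b. sawtooth (\<rho> * f (of_int n * \<eta>))\<bar>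
        \<le> real (card (multiples \<eta> d b)) * t + 60 * (2 * (b - d) * sqrt (\<rho> * F b / t) + 3 * X)"
        by simp
      have "\<bar>\<Sum>n\<in>multiples \<eta> c b. sawtooth (\<rho> * f (of_int n * \<eta>))\<bar> \<le>
          \<bar>\<Sum>n\<in>multiples \<eta> c d. sawtooth (\<rho> * f (of_int n * \<eta>))\<bar>
        + \<bar>\<Sum>n\<in>multiples \<eta> d b. sawtooth (\<rho> * f (of_int n * \<eta>))\<bar>"
        unfolding sum_multiples_split[OF d(1,2) pos(2)] by (rule abs_triangle_ineq)
      moreover have "real (card (multiples \<eta> c b)) * t = real (card (multiples \<eta> c d)) * t + real (card (multiples \<eta> d b)) * t"
        using card_multiples_split[OF d(1,2) pos(2)] by (simp add: distrib_right)
      moreover define E E1 E2 where E_def: "E = 2 * (b - c) * sqrt (\<rho> * F b / t)"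
        and E1_def: "E1 = 2 * (d - c) * sqrt (\<rho> * F b / t)" and E2_def: "E2 = 2 * (b - d) * sqrt (\<rho> * F b / t)"
      moreover have "E = E1 + E2"
        unfolding E_def E1_def E2_def by (simp add: left_diff_distrib right_diff_distrib)
      ultimately show ?thesis unfolding X4 E_def[symmetric] distrib_left
        using 1[folded E1_def, unfolded distrib_left] 2[folded E2_def, unfolded distrib_left] by linarith
    qed
  qed
  obtain K where "F b / F a < 2 ^ K" using real_arch_pow[of 2 "F b / F a"] by auto
  then have "F b \<le> 2 ^ K * F a" using F(3) by (simp add: divide_less_eq)
  with main[of a K] ab show ?thesis by auto
qed

section \<open>Concave curves, area and trapezoidal sums\<close>

lemma measure_under_graph_vertical:
  fixes v :: "real \<Rightarrow> real"
  assumes v: "continuous_on {a..b} v" and c: "\<And>x. x \<in> {a..b} \<Longrightarrow> c \<le> v x"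
  defines "C \<equiv> {(x, y). a \<le> x \<and> x \<le> b \<and> c \<le> y \<and> y \<le> v x}"
  shows "closed C" and "measure lebesgue C = integral {a..b} (\<lambda>x. v x - c)"
proof -
  have "C = {p \<in> {a..b} \<times> {c..}. snd p \<le> v (fst p)}" by (auto simp: C_def)
  moreover have "closed {p \<in> {a..b} \<times> {c..}. snd p \<le> v (fst p)}"
    by (intro continuous_on_closed_Collect_le closed_Times continuous_intros
          continuous_on_compose2[OF v]) auto
  ultimately show cl: "closed C" by simp
  then have bor: "C \<in> sets borel" by (rule borel_closed)
  have I: "(\<lambda>x. v x - c) integrable_on {a..b}"
    by (intro integrable_continuous_real continuous_intros v)
  have "emeasure lborel C = emeasure (lborel \<Otimes>\<^sub>M lborel) C" by (simp add: lborel_prod)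
  also have "\<dots> = (\<integral>\<^sup>+x. emeasure lborel (Pair x -` C) \<partial>lborel)"
    by (rule lborel.emeasure_pair_measure_alt) (use bor in \<open>unfold lborel_prod sets_lborel\<close>)
  also have "\<dots> = (\<integral>\<^sup>+x. ennreal (v x - c) * indicator {a..b} x \<partial>lborel)"
  proof (rule nn_integral_cong)
    fix x
    show "emeasure lborel (Pair x -` C) = ennreal (v x - c) * indicator {a..b} x"
    proof (cases "x \<in> {a..b}")
      case True
      then have "Pair x -` C = {c..v x}" by (auto simp: C_def)
      then show ?thesis using True c by simp
    next
      case False
      then have "Pair x -` C = {}" by (auto simp: C_def)
      then show ?thesis using False by simp
    qed
  qed
  also have "\<dots> = ennreal (integral {a..b} (\<lambda>x. v x - c))"
    by (rule nn_integral_has_integral_lebesgue')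
       (use I c in \<open>auto intro: integrable_integral\<close>)
  finally have "emeasure lborel C = ennreal (integral {a..b} (\<lambda>x. v x - c))" .
  moreover have "0 \<le> integral {a..b} (\<lambda>x. v x - c)"
    using c I by (intro integral_nonneg) auto
  ultimately have "measure lborel C = integral {a..b} (\<lambda>x. v x - c)"
    by (simp add: measure_def)
  then show "measure lebesgue C = integral {a..b} (\<lambda>x. v x - c)"
    using bor by (simp add: measure_completion)
qed

lemma measure_lebesgue_swap:
  fixes C :: "(real \<times> real) set"
  assumes "closed C"
  shows "measure lebesgue (prod.swap ` C) = measure lebesgue C"
proof -
  have bor: "C \<in> sets (lborel \<Otimes>\<^sub>M lborel)" unfolding lborel_prod sets_lborel by (rule borel_closed[OF assms])
  have sw: "prod.swap ` C = prod.swap -` C" by (auto simp: image_iff) (metis swap_simp)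
  have "closed (prod.swap -` C)"
    by (rule closed_vimage[OF assms]) (auto simp: prod.swap_def intro!: continuous_intros)
  then have bor': "prod.swap ` C \<in> sets (lborel \<Otimes>\<^sub>M lborel)"
    unfolding sw lborel_prod sets_lborel by (rule borel_closed)
  have "emeasure (lborel \<Otimes>\<^sub>M lborel) (prod.swap ` C) = (\<integral>\<^sup>+x. emeasure lborel (Pair x -` (prod.swap ` C)) \<partial>lborel)"
    by (rule lborel.emeasure_pair_measure_alt[OF bor'])
  also have "\<dots> = (\<integral>\<^sup>+x. emeasure lborel ((\<lambda>y. (y, x)) -` C) \<partial>lborel)"
    unfolding sw vimage_comp by (simp add: o_def prod.swap_def)
  also have "\<dots> = emeasure (lborel \<Otimes>\<^sub>M lborel) C"
    by (rule lborel_pair.emeasure_pair_measure_alt2[OF bor, symmetric])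
  finally have "emeasure lborel (prod.swap ` C) = emeasure lborel C" by (simp add: lborel_prod)
  then have "measure lborel (prod.swap ` C) = measure lborel C" by (simp add: measure_def)
  then show ?thesis using bor bor' unfolding lborel_prod by (simp add: measure_completion)
qed

lemma integral_linear:
  fixes A B c \<eta> :: real
  assumes "0 \<le> \<eta>"
  shows "((\<lambda>x. A + B * (x - c)) has_integral (\<eta> * A + B * \<eta>\<^sup>2 / 2)) {c..c + \<eta>}"
proof -
  have "((\<lambda>x. A + B * (x - c)) has_integral
      (A * (c + \<eta> - c) + B * (c + \<eta> - c)\<^sup>2 / 2) - (A * (c - c) + B * (c - c)\<^sup>2 / 2)) {c..c + \<eta>}"
    by (rule fundamental_theorem_of_calculus)
       (use assms in \<open>auto intro!: derivative_eq_intros simp: has_real_derivative_iff_has_vector_derivative[symmetric]\<close>)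
  then show ?thesis by (simp add: mult.commute)
qed

lemma sum_multiples_nat:
  assumes "0 < \<eta>" "0 \<le> \<alpha>"
  shows "(\<Sum>j\<in>multiples \<eta> 0 \<alpha>. h (of_int j)) = (\<Sum>j=1..nat \<lfloor>\<alpha> / \<eta>\<rfloor>. h (real j))"
  using assms
  by (intro sum.reindex_bij_witness[of _ int nat]) (auto simp: multiples_eq)

text \<open>
  The assumptions are symmetric in \<open>f\<close> and \<open>g\<close> (lemma \<open>inverse_curve\<close>), so that every statement about
  columns has a mirror image about rows.
\<close>

locale concave_curve =
  fixes f g :: "real \<Rightarrow> real" and L :: real
  assumes L: "0 < L"
    and f_mem: "f \<in> {0..L} \<rightarrow> {0..L}" and f_cont: "continuous_on {0..L} f"
    and f_concave: "concave_on {0..L} f" and f_anti: "strict_antimono_on {0..L} f"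
    and f_0: "f 0 = L" and f_L: "f L = 0"
    and g_mem: "g \<in> {0..L} \<rightarrow> {0..L}"
    and g_f: "\<And>x. x \<in> {0..L} \<Longrightarrow> g (f x) = x" and f_g: "\<And>y. y \<in> {0..L} \<Longrightarrow> f (g y) = y"
begin

lemma f_less: "x \<in> {0..L} \<Longrightarrow> y \<in> {0..L} \<Longrightarrow> x < y \<Longrightarrow> f y < f x"
  using f_anti by (auto simp: monotone_on_def)

lemma f_le: "x \<in> {0..L} \<Longrightarrow> y \<in> {0..L} \<Longrightarrow> x \<le> y \<Longrightarrow> f y \<le> f x"
  using f_less by (cases "x = y") force+

lemma f_ge0: "x \<in> {0..L} \<Longrightarrow> 0 \<le> f x" and f_leL: "x \<in> {0..L} \<Longrightarrow> f x \<le> L"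
  using f_mem by auto

lemma inverse_curve: "concave_curve g f L"
proof
  have g_less: "g y < g x" if "x \<in> {0..L}" "y \<in> {0..L}" "x < y" for x y
  proof (rule ccontr)
    assume "\<not> g y < g x"
    then have "f (g y) \<le> f (g x)" using that g_mem by (intro f_le) auto
    then show False using that f_g by simp
  qed
  then show "strict_antimono_on {0..L} g" by (auto simp: monotone_on_def)
  have "f ` {0..L} = {0..L}"
  proof (intro equalityI subsetI)
    fix y assume "y \<in> {0..L}"
    then show "y \<in> f ` {0..L}" using f_g[of y] g_mem by (intro image_eqI[of _ _ "g y"]) auto
  qed (use f_mem in auto)
  then show "continuous_on {0..L} g"
    using continuous_on_inv[OF f_cont compact_Icc, of g] g_f by auto
  have g_le: "g y \<le> g x" if "x \<in> {0..L}" "y \<in> {0..L}" "x \<le> y" for x y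
    using g_less[of x y] that by (cases "x = y") auto
  show "concave_on {0..L} g"
    unfolding concave_on_iff
  proof (intro conjI ballI allI impI)
    fix x y u v :: real
    assume a: "x \<in> {0..L}" "y \<in> {0..L}" "0 \<le> u" "0 \<le> v" "u + v = 1"
    have gx: "g x \<in> {0..L}" "g y \<in> {0..L}" using a g_mem by auto
    have m1: "u *\<^sub>R x + v *\<^sub>R y \<in> {0..L}"
      by (rule convexD[OF convex_real_interval(5)]) (use a in auto)
    have m2: "u *\<^sub>R g x + v *\<^sub>R g y \<in> {0..L}"
      by (rule convexD[OF convex_real_interval(5)]) (use a gx in auto)
    have "u * f (g x) + v * f (g y) \<le> f (u *\<^sub>R g x + v *\<^sub>R g y)"
      using f_concave a gx unfolding concave_on_iff by blast
    then have "u *\<^sub>R x + v *\<^sub>R y \<le> f (u *\<^sub>R g x + v *\<^sub>R g y)" using f_g a by simp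
    then have "g (f (u *\<^sub>R g x + v *\<^sub>R g y)) \<le> g (u *\<^sub>R x + v *\<^sub>R y)"
      using m1 m2 f_mem by (intro g_le) auto
    then show "u * g x + v * g y \<le> g (u *\<^sub>R x + v *\<^sub>R y)" using g_f[OF m2] by simp
  qed simp
  show "g 0 = L" using g_f[of L] f_L L by simp
  show "g L = 0" using g_f[of 0] f_0 L by simp
qed (use L f_mem g_mem g_f f_g in auto)

lemma under_graph_iff:
  assumes "0 \<le> x" "0 \<le> y"
  shows "x \<le> L \<and> y \<le> f x \<longleftrightarrow> y \<le> L \<and> x \<le> g y"
proof -
  interpret inv: concave_curve g f L by (rule inverse_curve)
  show ?thesis
  proof
    assume a: "x \<le> L \<and> y \<le> f x"
    then have y: "y \<le> L" using f_leL[of x] assms by auto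
    have "g (f x) \<le> g y" using a assms y f_mem by (intro inv.f_le) auto
    then show "y \<le> L \<and> x \<le> g y" using y g_f[of x] a assms by auto
  next
    assume a: "y \<le> L \<and> x \<le> g y"
    then have x: "x \<le> L" using inv.f_leL[of y] assms by auto
    have "f (g y) \<le> f x" using a assms x g_mem by (intro f_le) auto
    then show "x \<le> L \<and> y \<le> f x" using x f_g[of y] a assms by auto
  qed
qed

lemma integral_split:
  assumes "\<alpha> \<in> {0..L}"
  shows "integral {0..L} f = integral {0..\<alpha>} f + integral {\<alpha>..L} f"
  using assms integrable_continuous_real[OF f_cont]
  by (intro Henstock_Kurzweil_Integration.integral_combine[symmetric]) auto

lemma curve_area_eq: "curve_area f L = integral {0..L} f"
  unfolding curve_area_def using measure_under_graph_vertical(2)[of 0 L f 0] f_cont f_ge0 by simp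

text \<open>
  Both sides are the area of the part of the region to the right of the line \<open>x = \<alpha>\<close>, computed by vertical and
  by horizontal slices.
\<close>

lemma integral_tail:
  assumes \<alpha>: "\<alpha> \<in> {0..L}"
  shows "integral {\<alpha>..L} f = integral {0..f \<alpha>} g - \<alpha> * f \<alpha>"
proof -
  interpret inv: concave_curve g f L by (rule inverse_curve)
  have \<beta>: "f \<alpha> \<in> {0..L}" using \<alpha> f_mem by auto
  define C where "C = {(x, y). \<alpha> \<le> x \<and> x \<le> L \<and> 0 \<le> y \<and> y \<le> f x}"
  define C' where "C' = {(x, y). 0 \<le> x \<and> x \<le> f \<alpha> \<and> \<alpha> \<le> y \<and> y \<le> g x}"
  have cf: "continuous_on {\<alpha>..L} f" using f_cont \<alpha> by (auto intro: continuous_on_subset)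
  have cg: "continuous_on {0..f \<alpha>} g" using inv.f_cont \<beta> by (auto intro: continuous_on_subset)
  have C: "closed C" "measure lebesgue C = integral {\<alpha>..L} (\<lambda>x. f x - 0)"
    unfolding C_def by (rule measure_under_graph_vertical; use \<alpha> cf f_ge0 in auto)+
  have ge: "\<alpha> \<le> g x" if "x \<in> {0..f \<alpha>}" for x
    using inv.f_le[of x "f \<alpha>"] that \<beta> g_f[OF \<alpha>] by auto
  have C': "measure lebesgue C' = integral {0..f \<alpha>} (\<lambda>x. g x - \<alpha>)"
    unfolding C'_def by (rule measure_under_graph_vertical) (use cg ge in auto)
  have "C' = prod.swap ` C"
  proof -
    have iff: "(y, x) \<in> C' \<longleftrightarrow> (x, y) \<in> C" for x y
    proof (cases "0 \<le> y \<and> \<alpha> \<le> x")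
      case True
      then have *: "x \<le> L \<and> y \<le> f x \<longleftrightarrow> y \<le> L \<and> x \<le> g y"
        using \<alpha> by (intro under_graph_iff) auto
      have "y \<le> f \<alpha>" if "x \<le> L" "y \<le> f x" using f_le[of \<alpha> x] \<alpha> True that by auto
      then show ?thesis using * True \<beta> by (auto simp: C_def C'_def)
    qed (auto simp: C_def C'_def)
    show ?thesis
    proof (intro set_eqI)
      fix p :: "real \<times> real"
      show "p \<in> C' \<longleftrightarrow> p \<in> prod.swap ` C" using iff[of "fst p" "snd p"]
        by (cases p) (force simp: iff image_iff)
    qed
  qed
  then have "integral {\<alpha>..L} f = integral {0..f \<alpha>} (\<lambda>x. g x - \<alpha>)"
    using measure_lebesgue_swap[OF C(1)] C(2) C' by simp
  also have "\<dots> = integral {0..f \<alpha>} g - integral {0..f \<alpha>} (\<lambda>x. \<alpha>)"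
    by (intro Henstock_Kurzweil_Integration.integral_diff integrable_continuous_real cg) auto
  finally show ?thesis using \<beta> by (simp add: mult.commute)
qed

lemma curve_area_inverse: "curve_area g L = curve_area f L"
proof -
  interpret inv: concave_curve g f L by (rule inverse_curve)
  show ?thesis using integral_tail[of 0] L f_0 by (simp add: curve_area_eq inv.curve_area_eq)
qed

lemma three_points:
  assumes "0 \<le> p" "p \<le> q" "q \<le> w" "w \<le> L"
  shows "(w - q) * f p + (q - p) * f w \<le> (w - p) * f q"
proof (cases "p = w")
  case True
  then show ?thesis using assms by simp
next
  case False
  then have pw: "p < w" using assms by simp
  define u where "u = (q - p) / (w - p)"
  have u: "0 \<le> u" "u \<le> 1" using assms pw by (auto simp: u_def)
  have uq: "u * (w - p) = q - p" using pw by (simp add: u_def)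
  have "(1 - u) * f p + u * f w \<le> f ((1 - u) *\<^sub>R p + u *\<^sub>R w)"
    using f_concave u assms by (intro concave_onD) auto
  also have "(1 - u) *\<^sub>R p + u *\<^sub>R w = q" using uq by (simp add: algebra_simps)
  finally have "(w - p) * ((1 - u) * f p + u * f w) \<le> (w - p) * f q"
    using pw by (intro mult_left_mono) auto
  moreover have "(w - p) * ((1 - u) * f p + u * f w) = ((w - p) - u * (w - p)) * f p + (u * (w - p)) * f w"
    by (simp add: algebra_simps)
  ultimately show ?thesis unfolding uq by (simp add: algebra_simps)
qed

text \<open>
  A concave function gets steeper, so up to \<open>\<alpha>\<close> it is not steeper than the chord from \<open>(\<alpha>, f \<alpha>)\<close> to the
  endpoint \<open>(L, 0)\<close>. This bounds the slopes of \<open>f\<close> on \<open>[0, \<alpha>]\<close> by concavity alone.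
\<close>

lemma chord_slope:
  assumes "0 \<le> x" "x \<le> y" "y \<le> \<alpha>" "\<alpha> < L"
  shows "f x - f y \<le> f \<alpha> / (L - \<alpha>) * (y - x)"
proof -
  have 1: "(L - y) * f x \<le> (L - x) * f y" using three_points[of x y L] assms f_L by simp
  have 2: "(L - \<alpha>) * f y \<le> (L - y) * f \<alpha>" using three_points[of y \<alpha> L] assms f_L by simp
  have "(L - y) * (f x - f y) \<le> (y - x) * f y" using 1 by (simp add: algebra_simps)
  then have "f x - f y \<le> (y - x) * (f y / (L - y))" using assms by (simp add: field_simps)
  also have "\<dots> \<le> (y - x) * (f \<alpha> / (L - \<alpha>))"
  proof (rule mult_left_mono)
    show "f y / (L - y) \<le> f \<alpha> / (L - \<alpha>)" using 2 assms by (simp add: field_simps)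
  qed (use assms in simp)
  finally show ?thesis by (simp only: mult.commute)
qed

lemma integrable_sub: "0 \<le> a \<Longrightarrow> b \<le> L \<Longrightarrow> f integrable_on {a..b}"
  using f_cont by (intro integrable_continuous_real continuous_on_subset[OF f_cont]) auto

text \<open>
  On \<open>[n * \<eta>, (n + 1) * \<eta>]\<close> the function lies above its chord and below the extension of the previous chord,
  so the error of one trapezoid is at most \<open>\<eta> / 2\<close> times the difference of two consecutive decrements. These
  differences telescope. For \<open>n = 0\<close> the role of the previous chord is played by the horizontal line at
  height \<open>L\<close>; truncated subtraction makes \<open>f (real (n - 1) * \<eta>) - f (real n * \<eta>)\<close> equal to 0 then.
\<close>

lemma trapezoid_error:
  assumes \<eta>: "0 < \<eta>" and "real n * \<eta> \<le> L"
  shows "0 \<le> integral {0..real n * \<eta>} f - (\<eta> * (\<Sum>j=1..n. f (real j * \<eta>)) + \<eta> * (L - f (real n * \<eta>)) / 2)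
    \<and> integral {0..real n * \<eta>} f - (\<eta> * (\<Sum>j=1..n. f (real j * \<eta>)) + \<eta> * (L - f (real n * \<eta>)) / 2)
      \<le> \<eta> / 2 * (f (real (n - 1) * \<eta>) - f (real n * \<eta>))"
  using assms(2)
proof (induction n)
  case 0
  then show ?case using f_0 by simp
next
  case (Suc n)
  define a where "a = real n * \<eta>"
  have a1: "real (Suc n) * \<eta> = a + \<eta>" by (simp add: a_def algebra_simps)
  have a: "0 \<le> a" "a + \<eta> \<le> L" using Suc \<eta> by (auto simp: a_def algebra_simps)
  define d where "d = f (real (n - 1) * \<eta>) - f a"
  have IH: "0 \<le> integral {0..a} f - (\<eta> * (\<Sum>j=1..n. f (real j * \<eta>)) + \<eta> * (L - f a) / 2)"
     "integral {0..a} f - (\<eta> * (\<Sum>j=1..n. f (real j * \<eta>)) + \<eta> * (L - f a) / 2) \<le> \<eta> / 2 * d"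
    using Suc.IH a \<eta> unfolding a_def d_def by auto
  have split: "integral {0..a + \<eta>} f = integral {0..a} f + integral {a..a+\<eta>} f"
    using a \<eta> integrable_sub[of 0 "a + \<eta>"] by (intro Henstock_Kurzweil_Integration.integral_combine[symmetric]) auto
  have lo: "\<eta> * f a + (f (a + \<eta>) - f a) / \<eta> * \<eta>\<^sup>2 / 2 \<le> integral {a..a+\<eta>} f"
  proof (rule has_integral_le[OF integral_linear integrable_integral[OF integrable_sub]])
    fix x assume x: "x \<in> {a..a+\<eta>}"
    then show "f a + (f (a + \<eta>) - f a) / \<eta> * (x - a) \<le> f x"
      using three_points[of a x "a + \<eta>"] a \<eta> by (simp add: field_simps)
  qed (use a \<eta> in auto)
  have up: "integral {a..a+\<eta>} f \<le> \<eta> * f a + (- d / \<eta>) * \<eta>\<^sup>2 / 2"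
  proof (rule has_integral_le[OF integrable_integral[OF integrable_sub] integral_linear])
    fix x assume x: "x \<in> {a..a+\<eta>}"
    show "f x \<le> f a + (- d / \<eta>) * (x - a)"
    proof (cases n)
      case 0
      then show ?thesis using f_le[of a x] x a \<eta> by (auto simp: d_def a_def)
    next
      case (Suc m)
      then have m: "real (n - 1) * \<eta> = a - \<eta>" "0 \<le> a - \<eta>" using \<eta> by (auto simp: a_def algebra_simps)
      have d: "d = f (a - \<eta>) - f a" unfolding d_def m(1) ..
      show ?thesis
        using three_points[of "a - \<eta>" a x] m(2) x a \<eta> unfolding d by (simp add: field_simps)
    qed
  qed (use a \<eta> in auto)
  have e1: "(f (a + \<eta>) - f a) / \<eta> * \<eta>\<^sup>2 / 2 = \<eta> * f (a + \<eta>) / 2 - \<eta> * f a / 2"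
    "(- d / \<eta>) * \<eta>\<^sup>2 / 2 = - (\<eta> / 2 * d)" "\<eta> * (L - f a) / 2 = \<eta> * L / 2 - \<eta> * f a / 2"
    "\<eta> * (L - f (a + \<eta>)) / 2 = \<eta> * L / 2 - \<eta> * f (a + \<eta>) / 2"
    "\<eta> / 2 * (f a - f (a + \<eta>)) = \<eta> * f a / 2 - \<eta> * f (a + \<eta>) / 2"
    using \<eta> by (simp_all add: field_simps power2_eq_square)
  have s1: "\<eta> * (\<Sum>j=1..Suc n. f (real j * \<eta>)) = \<eta> * (\<Sum>j=1..n. f (real j * \<eta>)) + \<eta> * f (a + \<eta>)"
    using a1 by (simp add: algebra_simps)
  show ?case
    unfolding a1 s1 split diff_Suc_1 a_def[symmetric] e1(4,5) using IH lo up unfolding e1(1-3) by linarith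
qed

text \<open>
  The last grid point \<open>\<lfloor>\<alpha> / \<eta>\<rfloor> * \<eta>\<close> need not be \<open>\<alpha>\<close>. The incomplete last step is treated as if \<open>f\<close> were
  equal to \<open>f \<alpha>\<close> there, which is harmless because \<open>f\<close> is Lipschitz on \<open>[0, \<alpha>]\<close>.
\<close>

lemma riemann_sum:
  assumes \<eta>: "0 < \<eta>" and \<alpha>: "0 \<le> \<alpha>" "\<alpha> < L"
  shows "\<bar>\<eta> * (\<Sum>j\<in>multiples \<eta> 0 \<alpha>. f (of_int j * \<eta>))
     - (integral {0..\<alpha>} f - (\<alpha> - of_int \<lfloor>\<alpha> / \<eta>\<rfloor> * \<eta>) * f \<alpha> - \<eta> * (L - f \<alpha>) / 2)\<bar>
     \<le> 2 * (f \<alpha> / (L - \<alpha>)) * \<eta>\<^sup>2"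
proof -
  define \<kappa> where "\<kappa> = f \<alpha> / (L - \<alpha>)"
  define n where "n = nat \<lfloor>\<alpha> / \<eta>\<rfloor>"
  have n: "real n = of_int \<lfloor>\<alpha> / \<eta>\<rfloor>" using \<eta> \<alpha> by (simp add: n_def)
  define a where "a = real n * \<eta>"
  have "real n \<le> \<alpha> / \<eta>" "\<alpha> / \<eta> < real n + 1" unfolding n by linarith+
  then have a: "0 \<le> a" "a \<le> \<alpha>" "\<alpha> - a \<le> \<eta>" using \<eta> by (auto simp: a_def field_simps)
  have \<kappa>: "0 \<le> \<kappa>" using \<alpha> f_ge0[of \<alpha>] by (simp add: \<kappa>_def)
  have E: "f (real (n - 1) * \<eta>) - f a \<le> \<kappa> * \<eta>"
  proof -
    have "f (real (n - 1) * \<eta>) - f a \<le> \<kappa> * (a - real (n - 1) * \<eta>)"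
      unfolding \<kappa>_def using a \<alpha> \<eta> by (intro chord_slope) (auto simp: a_def)
    also have "\<dots> \<le> \<kappa> * \<eta>"
      using \<kappa> \<eta> by (intro mult_left_mono) (cases n; auto simp: a_def algebra_simps)+
    finally show ?thesis .
  qed
  have "f a - f \<alpha> \<le> \<kappa> * (\<alpha> - a)" unfolding \<kappa>_def using a \<alpha> by (intro chord_slope) auto
  also have "\<dots> \<le> \<kappa> * \<eta>" using a \<kappa> by (intro mult_left_mono) auto
  finally have fa: "f \<alpha> \<le> f a" "f a \<le> f \<alpha> + \<kappa> * \<eta>" using f_le[of a \<alpha>] a \<alpha> by auto
  define S where "S = \<eta> * (\<Sum>j=1..n. f (real j * \<eta>))"
  define I where "I = integral {0..a} f"
  have T: "0 \<le> I - (S + \<eta> * (L - f a) / 2)" "I - (S + \<eta> * (L - f a) / 2) \<le> \<eta> / 2 * (\<kappa> * \<eta>)"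
  proof -
    have "real n * \<eta> \<le> L" using a \<alpha> by (simp add: a_def)
    note t = trapezoid_error[OF \<eta> this, folded a_def, folded S_def I_def]
    have "\<eta> / 2 * (f (real (n - 1) * \<eta>) - f a) \<le> \<eta> / 2 * (\<kappa> * \<eta>)"
      using E \<eta> by (intro mult_left_mono) auto
    then show "0 \<le> I - (S + \<eta> * (L - f a) / 2)" "I - (S + \<eta> * (L - f a) / 2) \<le> \<eta> / 2 * (\<kappa> * \<eta>)"
      using t by auto
  qed
  have split: "integral {0..\<alpha>} f = I + integral {a..\<alpha>} f" unfolding I_def
    using a \<alpha> integrable_sub[of 0 \<alpha>] by (intro Henstock_Kurzweil_Integration.integral_combine[symmetric]) auto
  have lo: "(\<alpha> - a) * f \<alpha> \<le> integral {a..\<alpha>} f"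
  proof -
    have "integral {a..\<alpha>} (\<lambda>x. f \<alpha>) \<le> integral {a..\<alpha>} f"
      using a \<alpha> by (intro integral_le integrable_sub) (auto intro!: f_le)
    then show ?thesis using a by simp
  qed
  have up: "integral {a..\<alpha>} f \<le> (\<alpha> - a) * f \<alpha> + \<eta> * (\<kappa> * \<eta>)"
  proof -
    have "f x \<le> f a" if "x \<in> {a..\<alpha>}" for x using a \<alpha> that by (intro f_le) auto
    then have "integral {a..\<alpha>} f \<le> integral {a..\<alpha>} (\<lambda>x. f \<alpha> + \<kappa> * \<eta>)"
      using a \<alpha> fa by (intro integral_le integrable_sub) (auto intro: order_trans)
    also have "\<dots> = (\<alpha> - a) * f \<alpha> + (\<alpha> - a) * (\<kappa> * \<eta>)" using a by (simp add: algebra_simps)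
    also have "(\<alpha> - a) * (\<kappa> * \<eta>) \<le> \<eta> * (\<kappa> * \<eta>)" using a \<kappa> \<eta> by (intro mult_right_mono) auto
    finally show ?thesis by simp
  qed
  have m: "\<eta> * f \<alpha> \<le> \<eta> * f a" "\<eta> * f a \<le> \<eta> * f \<alpha> + \<eta> * (\<kappa> * \<eta>)"
    using fa \<eta> mult_left_mono[OF fa(2), of \<eta>] by (auto simp: distrib_left)
  have S: "\<eta> * (\<Sum>j\<in>multiples \<eta> 0 \<alpha>. f (of_int j * \<eta>)) = S"
    unfolding S_def n_def using sum_multiples_nat[OF \<eta> \<alpha>(1), of "\<lambda>x. f (x * \<eta>)"] by simp
  have "0 \<le> \<eta> * (\<kappa> * \<eta>)" using \<eta> \<kappa> by simp
  then have "\<bar>S - (integral {0..\<alpha>} f - (\<alpha> - a) * f \<alpha> - \<eta> * (L - f \<alpha>) / 2)\<bar> \<le> 2 * (\<eta> * (\<kappa> * \<eta>))"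
    using T lo up m unfolding split by (auto simp: abs_le_iff right_diff_distrib diff_divide_distrib)
  then show ?thesis unfolding S n[symmetric] a_def[symmetric] \<kappa>_def[symmetric]
    by (simp add: power2_eq_square mult_ac)
qed

text \<open>
  Only the lower estimate for the trapezoidal error is used, which holds up to \<open>L\<close>. Since \<open>\<eta> \<le> L\<close>, the last grid
  point is at least \<open>L/2\<close>, so the loss of the columns against the integral is at least as stated.
\<close>

lemma riemann_sum_upper:
  assumes \<eta>: "0 < \<eta>" "\<eta> \<le> L"
  shows "\<eta> * (\<Sum>j\<in>multiples \<eta> 0 L. f (of_int j * \<eta>)) \<le> integral {0..L} f - \<eta> * (L - f (L/2)) / 2"
proof -
  define n where "n = nat \<lfloor>L / \<eta>\<rfloor>"
  have n: "real n = of_int \<lfloor>L / \<eta>\<rfloor>" using \<eta> L by (simp add: n_def)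
  define a where "a = real n * \<eta>"
  have "1 \<le> L / \<eta>" using \<eta> by simp
  then have "1 \<le> \<lfloor>L / \<eta>\<rfloor>" by (simp add: le_floor_iff)
  then have "1 \<le> real n" "real n \<le> L / \<eta>" "L / \<eta> < real n + 1" unfolding n by linarith+
  then have a: "\<eta> \<le> a" "a \<le> L" "L < a + \<eta>" using \<eta> by (auto simp: a_def field_simps)
  have "\<eta> * (\<Sum>j=1..n. f (real j * \<eta>)) \<le> integral {0..a} f - \<eta> * (L - f a) / 2"
    using trapezoid_error[OF \<eta>(1), of n] a unfolding a_def by auto
  also have "integral {0..a} f \<le> integral {0..L} f"
  proof -
    have "0 \<le> integral {a..L} f" using a \<eta> by (intro integral_nonneg integrable_sub) (auto intro!: f_ge0)
    then show ?thesis using integral_split[of a] a \<eta> by auto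
  qed
  also have "integral {0..L} f - \<eta> * (L - f a) / 2 \<le> integral {0..L} f - \<eta> * (L - f (L/2)) / 2"
    using \<eta> a L f_le[of "L/2" a] by (intro diff_left_mono divide_right_mono mult_left_mono) auto
  finally show ?thesis unfolding n_def
    using sum_multiples_nat[OF \<eta>(1), of L "\<lambda>x. f (x * \<eta>)"] L by simp
qed

end

section \<open>Counting lattice points under the curve\<close>

context concave_curve
begin

lemma card_under_graph:
  assumes "0 < \<eta>" "0 < \<rho>" "\<alpha> \<in> {0..L}"
  shows "real (card (SIGMA j:multiples \<eta> 0 \<alpha>. {1..\<lfloor>\<rho> * f (of_int j * \<eta>)\<rfloor>}))
    = (\<Sum>j\<in>multiples \<eta> 0 \<alpha>. of_int \<lfloor>\<rho> * f (of_int j * \<eta>)\<rfloor>)"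
proof -
  have "0 \<le> \<lfloor>\<rho> * f (of_int j * \<eta>)\<rfloor>" if "j \<in> multiples \<eta> 0 \<alpha>" for j
    using that assms f_ge0[of "of_int j * \<eta>"] by (auto simp: multiples_def)
  then have "(\<Sum>j\<in>multiples \<eta> 0 \<alpha>. real (nat \<lfloor>\<rho> * f (of_int j * \<eta>)\<rfloor>)) = (\<Sum>j\<in>multiples \<eta> 0 \<alpha>. of_int \<lfloor>\<rho> * f (of_int j * \<eta>)\<rfloor>)"
    by (intro sum.cong refl) simp
  then show ?thesis using assms by (simp add: card_SigmaI)
qed

lemma lattice_count_eq_card:
  assumes "0 < r" "0 < s"
  shows "lattice_count f L r s =
    card (SIGMA j:multiples (s / r) 0 L. {1..\<lfloor>r * s * f (of_int j * (s / r))\<rfloor>})"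
  unfolding lattice_count_def
proof (rule bij_betw_same_card)
  show "bij_betw (\<lambda>(j, k). (int j, int k))
    {(j, k). 1 \<le> j \<and> 1 \<le> k \<and> real j * s / r \<le> L \<and> real k \<le> r * s * f (real j * s / r)}
    (SIGMA j:multiples (s / r) 0 L. {1..\<lfloor>r * s * f (of_int j * (s / r))\<rfloor>})"
    by (rule bij_betw_byWitness[where f' = "\<lambda>(j, k). (nat j, nat k)"])
       (use assms in \<open>auto simp: multiples_def le_floor_iff zero_less_mult_iff zero_less_divide_iff\<close>)
qed

lemma mem_Sigma_iff:
  assumes "0 < \<eta>" "0 < \<rho>"
  shows "(j, k) \<in> (SIGMA j:multiples \<eta> 0 \<alpha>. {1..\<lfloor>\<rho> * f (of_int j * \<eta>)\<rfloor>}) \<longleftrightarrow>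
     0 < j \<and> 0 < k \<and> of_int j * \<eta> \<le> \<alpha> \<and> of_int k * (1 / \<rho>) \<le> f (of_int j * \<eta>)"
  using assms by (auto simp: multiples_def le_floor_iff zero_less_mult_iff field_simps)

text \<open>
  Inclusion and exclusion: a point under the curve is in one of the columns up to \<open>\<alpha>\<close> or in one of the rows up
  to \<open>f \<alpha>\<close>, and a point with both properties is an arbitrary point of a rectangle.
\<close>

lemma lattice_count_split:
  assumes rs: "0 < r" "0 < s" and \<alpha>: "\<alpha> \<in> {0..L}"
  shows "real (lattice_count f L r s) =
     (\<Sum>j\<in>multiples (s / r) 0 \<alpha>. of_int \<lfloor>r * s * f (of_int j * (s / r))\<rfloor>)
   + (\<Sum>k\<in>multiples (1 / (r * s)) 0 (f \<alpha>). of_int \<lfloor>r / s * g (of_int k * (1 / (r * s)))\<rfloor>)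
   - of_int \<lfloor>\<alpha> * r / s\<rfloor> * of_int \<lfloor>r * s * f \<alpha>\<rfloor>"
proof -
  interpret inv: concave_curve g f L by (rule inverse_curve)
  define \<eta> where "\<eta> = s / r"
  define \<eta>' where "\<eta>' = 1 / (r * s)"
  have \<eta>: "0 < \<eta>" "0 < \<eta>'" "r * s = 1 / \<eta>'" "r / s = 1 / \<eta>" "0 < r * s" "0 < r / s"
    using rs by (auto simp: \<eta>_def \<eta>'_def)
  have \<beta>: "f \<alpha> \<in> {0..L}" using \<alpha> f_mem by auto
  define A where "A = (SIGMA j:multiples \<eta> 0 \<alpha>. {1..\<lfloor>1 / \<eta>' * f (of_int j * \<eta>)\<rfloor>})"
  define B where "B = (SIGMA k:multiples \<eta>' 0 (f \<alpha>). {1..\<lfloor>1 / \<eta> * g (of_int k * \<eta>')\<rfloor>})"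
  define S where "S = (SIGMA j:multiples \<eta> 0 L. {1..\<lfloor>1 / \<eta>' * f (of_int j * \<eta>)\<rfloor>})"
  have p: "0 < 1 / \<eta>'" "0 < 1 / \<eta>" using \<eta> by auto
  have memA: "(j, k) \<in> A \<longleftrightarrow> 0 < j \<and> 0 < k \<and> of_int j * \<eta> \<le> \<alpha> \<and> of_int k * \<eta>' \<le> f (of_int j * \<eta>)" for j k
    unfolding A_def mem_Sigma_iff[OF \<eta>(1) p(1)] by simp
  have memS: "(j, k) \<in> S \<longleftrightarrow> 0 < j \<and> 0 < k \<and> of_int j * \<eta> \<le> L \<and> of_int k * \<eta>' \<le> f (of_int j * \<eta>)" for j k
    unfolding S_def mem_Sigma_iff[OF \<eta>(1) p(1)] by simp
  have memB: "(k, j) \<in> B \<longleftrightarrow> 0 < k \<and> 0 < j \<and> of_int k * \<eta>' \<le> f \<alpha> \<and> of_int j * \<eta> \<le> g (of_int k * \<eta>')" for j k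
    unfolding B_def inv.mem_Sigma_iff[OF \<eta>(2) p(2)] by simp
  have finAB: "finite A" "finite B" using \<eta> by (auto simp: A_def B_def)
  have S: "S = A \<union> prod.swap ` B"
  proof (intro set_eqI)
    fix z :: "int \<times> int"
    obtain j k where z: "z = (j, k)" by (cases z)
    have sw: "z \<in> prod.swap ` B \<longleftrightarrow> (k, j) \<in> B" using z by (force simp: image_iff)
    show "z \<in> S \<longleftrightarrow> z \<in> A \<union> prod.swap ` B"
    proof (cases "0 < j \<and> 0 < k")
      case False
      then show ?thesis using z sw memA memB memS by auto
    next
      case True
      define x where "x = of_int j * \<eta>"
      define y where "y = of_int k * \<eta>'"
      have xy: "0 \<le> x" "0 \<le> y" using True \<eta> by (auto simp: x_def y_def)
      have "x \<le> L \<and> y \<le> f x \<longleftrightarrow> (x \<le> \<alpha> \<and> y \<le> f x) \<or> (y \<le> f \<alpha> \<and> x \<le> g y)"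
        using under_graph_iff[OF xy] f_le[of \<alpha> x] \<alpha> \<beta> xy by (cases "\<alpha> \<le> x") auto
      then show ?thesis using z sw memA memB memS True unfolding x_def y_def by auto
    qed
  qed
  have I: "A \<inter> prod.swap ` B = multiples \<eta> 0 \<alpha> \<times> multiples \<eta>' 0 (f \<alpha>)"
  proof (intro set_eqI)
    fix z :: "int \<times> int"
    obtain j k where z: "z = (j, k)" by (cases z)
    have sw: "z \<in> prod.swap ` B \<longleftrightarrow> (k, j) \<in> B" using z by (force simp: image_iff)
    define x where "x = of_int j * \<eta>"
    define y where "y = of_int k * \<eta>'"
    have "(x \<le> \<alpha> \<and> y \<le> f x) \<and> (y \<le> f \<alpha> \<and> x \<le> g y) \<longleftrightarrow> x \<le> \<alpha> \<and> y \<le> f \<alpha>" if xy: "0 < x" "0 < y"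
    proof -
      have "y \<le> f x \<and> x \<le> g y" if "x \<le> \<alpha>" "y \<le> f \<alpha>"
      proof -
        have "f \<alpha> \<le> f x" using f_le[of x \<alpha>] that xy \<alpha> by auto
        moreover have "g (f \<alpha>) \<le> g y" using inv.f_le[of y "f \<alpha>"] that xy \<beta> by auto
        ultimately show ?thesis using that g_f[OF \<alpha>] by auto
      qed
      then show ?thesis by auto
    qed
    moreover have "0 < j \<longleftrightarrow> 0 < x" "0 < k \<longleftrightarrow> 0 < y" using \<eta> by (auto simp: x_def y_def zero_less_mult_iff)
    ultimately show "z \<in> A \<inter> prod.swap ` B \<longleftrightarrow> z \<in> multiples \<eta> 0 \<alpha> \<times> multiples \<eta>' 0 (f \<alpha>)"
      using z sw memA[of j k] memB[of k j] unfolding multiples_def x_def[symmetric] y_def[symmetric]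
      by (auto simp: x_def[symmetric] y_def[symmetric])
  qed
  have "card A + card (prod.swap ` B) = card S + card (multiples \<eta> 0 \<alpha> \<times> multiples \<eta>' 0 (f \<alpha>))"
    unfolding S I[symmetric] using finAB by (intro card_Un_Int) auto
  moreover have "card (prod.swap ` B) = card B" by (rule card_image) (auto simp: inj_on_def)
  moreover have "card S = lattice_count f L r s"
    unfolding lattice_count_eq_card[OF rs] S_def using \<eta> by (simp add: \<eta>_def)
  moreover have "real (card (multiples \<eta> 0 \<alpha> \<times> multiples \<eta>' 0 (f \<alpha>))) = of_int \<lfloor>\<alpha> * r / s\<rfloor> * of_int \<lfloor>r * s * f \<alpha>\<rfloor>"
  proof -
    have "\<alpha> / \<eta> = \<alpha> * r / s" "f \<alpha> / \<eta>' = r * s * f \<alpha>" by (auto simp: \<eta>_def \<eta>'_def)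
    moreover have "0 \<le> \<lfloor>\<alpha> * r / s\<rfloor>" "0 \<le> \<lfloor>r * s * f \<alpha>\<rfloor>" using \<alpha> \<beta> rs by auto
    ultimately show ?thesis using \<eta> by (simp add: card_cartesian_product multiples_eq)
  qed
  ultimately have "real (lattice_count f L r s) = real (card A) + real (card B) - of_int \<lfloor>\<alpha> * r / s\<rfloor> * of_int \<lfloor>r * s * f \<alpha>\<rfloor>"
    by linarith
  also have "real (card A) = (\<Sum>j\<in>multiples \<eta> 0 \<alpha>. of_int \<lfloor>1 / \<eta>' * f (of_int j * \<eta>)\<rfloor>)"
    unfolding A_def using \<eta> \<alpha> by (intro card_under_graph) auto
  also have "real (card B) = (\<Sum>k\<in>multiples \<eta>' 0 (f \<alpha>). of_int \<lfloor>1 / \<eta> * g (of_int k * \<eta>')\<rfloor>)"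
    unfolding B_def using \<eta> \<beta> by (intro inv.card_under_graph) auto
  finally show ?thesis unfolding \<eta>_def[symmetric] \<eta>'_def[symmetric] \<eta>(3,4) by simp
qed

text \<open>
  Reflection in the diagonal, obtained from the splitting of the count for \<open>g\<close> at \<open>\<alpha> = 0\<close>, where only rows
  remain.
\<close>

lemma lattice_count_inverse:
  assumes "0 < r" "0 < s"
  shows "lattice_count f L r s = lattice_count g L r (1 / s)"
proof -
  interpret inv: concave_curve g f L by (rule inverse_curve)
  have "real (lattice_count f L r s) = (\<Sum>j\<in>multiples (s / r) 0 L. of_int \<lfloor>r * s * f (of_int j * (s / r))\<rfloor>)"
    using assms L unfolding lattice_count_eq_card[OF assms] by (intro card_under_graph) auto
  moreover have "real (lattice_count g L r (1 / s)) = (\<Sum>j\<in>multiples (s / r) 0 L. of_int \<lfloor>r * s * f (of_int j * (s / r))\<rfloor>)"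
  proof -
    have m0: "multiples (1 / s / r) 0 0 = {}" using assms by (auto simp: multiples_def)
    show ?thesis
      using inv.lattice_count_split[of r "1 / s" 0] assms L inv.f_0 m0 by simp
  qed
  ultimately show ?thesis by simp
qed

lemma lattice_count_le_area:
  assumes "0 < r" "0 < s" "s \<le> r * L"
  shows "real (lattice_count f L r s) \<le> r\<^sup>2 * curve_area f L - r * s * (L - f (L/2)) / 2"
proof -
  have \<eta>: "0 < s / r" "s / r \<le> L" using assms by (auto simp: field_simps)
  have "real (lattice_count f L r s) = (\<Sum>j\<in>multiples (s / r) 0 L. of_int \<lfloor>r * s * f (of_int j * (s / r))\<rfloor>)"
    using assms L unfolding lattice_count_eq_card[OF assms(1,2)] by (intro card_under_graph) auto
  also have "\<dots> \<le> (\<Sum>j\<in>multiples (s / r) 0 L. r * s * f (of_int j * (s / r)))"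
    by (intro sum_mono) simp
  also have "\<dots> = r\<^sup>2 * (s / r * (\<Sum>j\<in>multiples (s / r) 0 L. f (of_int j * (s / r))))"
    using assms by (simp add: sum_distrib_left power2_eq_square mult.assoc)
  also have "\<dots> \<le> r\<^sup>2 * (integral {0..L} f - s / r * (L - f (L/2)) / 2)"
    by (intro mult_left_mono riemann_sum_upper \<eta>) auto
  also have "\<dots> = r\<^sup>2 * curve_area f L - r * s * (L - f (L/2)) / 2"
    using assms by (simp add: curve_area_eq right_diff_distrib power2_eq_square)
  finally show ?thesis .
qed

lemma lattice_count_eq_0:
  assumes "0 < r" "0 < s" "r * L < s"
  shows "lattice_count f L r s = 0"
proof -
  have "\<lfloor>L / (s / r)\<rfloor> \<le> 0" using assms by (simp add: floor_le_iff field_simps)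
  then have "multiples (s / r) 0 L = {}" using assms by (simp add: multiples_eq)
  then show ?thesis unfolding lattice_count_eq_card[OF assms(1,2)] by simp
qed

text \<open>
  With \<open>a = \<alpha> * r / s\<close>, \<open>b = r * s * f \<alpha>\<close> and their integer parts \<open>m\<close>, \<open>n\<close>, the terms of order \<open>r\<close> that belong to
  the cut at \<open>(\<alpha>, f \<alpha>)\<close> all cancel, leaving only
  \<open>(a - m) / 2 + (b - n) / 2 - (a - m) * (b - n)\<close>.
\<close>

lemma lattice_count_two_term:
  assumes rs: "0 < r" "0 < s" and \<alpha>: "0 < \<alpha>" "\<alpha> < L"
  shows "\<bar>real (lattice_count f L r s) - (r\<^sup>2 * curve_area f L - r * L * (s + 1 / s) / 2)\<bar>
    \<le> \<bar>\<Sum>j\<in>multiples (s / r) 0 \<alpha>. sawtooth (r * s * f (of_int j * (s / r)))\<bar>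
     + \<bar>\<Sum>k\<in>multiples (1 / s / r) 0 (f \<alpha>). sawtooth (r * (1 / s) * g (of_int k * (1 / s / r)))\<bar>
     + 2 + 2 * (f \<alpha> / (L - \<alpha>)) * s\<^sup>2 + 2 * (\<alpha> / (L - f \<alpha>)) * (1 / s)\<^sup>2"
proof -
  interpret inv: concave_curve g f L by (rule inverse_curve)
  have \<alpha>': "\<alpha> \<in> {0..L}" using \<alpha> by auto
  have \<beta>: "0 < f \<alpha>" "f \<alpha> < L" using f_less[of \<alpha> L] f_less[of 0 \<alpha>] \<alpha> f_L f_0 by auto
  have gb: "g (f \<alpha>) = \<alpha>" using g_f \<alpha>' by auto
  define a b where "a = \<alpha> * r / s" and "b = r * s * f \<alpha>"
  define m n where "m = real_of_int \<lfloor>a\<rfloor>" and "n = real_of_int \<lfloor>b\<rfloor>"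
  have mn: "m \<le> a" "a < m + 1" "n \<le> b" "b < n + 1" "0 \<le> m" "0 \<le> n"
    using \<alpha> \<beta> rs unfolding m_def n_def a_def b_def by (auto intro!: floor_correct; linarith)+
  define \<eta> \<eta>' where "\<eta> = s / r" and "\<eta>' = 1 / s / r"
  have \<eta>: "0 < \<eta>" "0 < \<eta>'" using rs by (auto simp: \<eta>_def \<eta>'_def)
  have e: "\<alpha> / \<eta> = a" "f \<alpha> / \<eta>' = b" by (auto simp: \<eta>_def \<eta>'_def a_def b_def)
  define F where "F = (\<Sum>j\<in>multiples \<eta> 0 \<alpha>. f (of_int j * \<eta>))"
  define G where "G = (\<Sum>k\<in>multiples \<eta>' 0 (f \<alpha>). g (of_int k * \<eta>'))"
  define \<Psi> where "\<Psi> = (\<Sum>j\<in>multiples \<eta> 0 \<alpha>. sawtooth (r * s * f (of_int j * \<eta>)))"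
  define \<Psi>' where "\<Psi>' = (\<Sum>k\<in>multiples \<eta>' 0 (f \<alpha>). sawtooth (r * (1 / s) * g (of_int k * \<eta>')))"
  define K where "K = f \<alpha> / (L - \<alpha>)"
  define K' where "K' = \<alpha> / (L - f \<alpha>)"
  have fl: "real_of_int \<lfloor>x\<rfloor> = x - 1/2 - sawtooth x" for x by (simp add: sawtooth_def frac_def)
  have cards: "real (card (multiples \<eta> 0 \<alpha>)) = m" "real (card (multiples \<eta>' 0 (f \<alpha>))) = n"
    using mn(5,6) \<eta> by (auto simp: multiples_eq e m_def n_def)
  have 1: "(\<Sum>j\<in>multiples \<eta> 0 \<alpha>. real_of_int \<lfloor>r * s * f (of_int j * \<eta>)\<rfloor>) = r * s * F - m / 2 - \<Psi>"
    unfolding fl sum_subtractf F_def \<Psi>_def sum_distrib_left using cards by simp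
  have 2: "(\<Sum>k\<in>multiples \<eta>' 0 (f \<alpha>). real_of_int \<lfloor>r * (1 / s) * g (of_int k * \<eta>')\<rfloor>) = r * (1 / s) * G - n / 2 - \<Psi>'"
    unfolding fl sum_subtractf G_def \<Psi>'_def sum_distrib_left using cards by simp
  have count: "real (lattice_count f L r s) = r * s * F + r * (1 / s) * G - m / 2 - n / 2 - m * n - \<Psi> - \<Psi>'"
  proof -
    have "1 / (r * s) = \<eta>'" "r / s = r * (1 / s)" by (simp_all add: \<eta>'_def mult.commute)
    then show ?thesis
      using lattice_count_split[OF rs \<alpha>'] 1 2
      unfolding \<eta>_def[symmetric] a_def[symmetric] b_def[symmetric] m_def[symmetric] n_def[symmetric] by simp
  qed
  have R1: "\<bar>r * s * F - (r\<^sup>2 * integral {0..\<alpha>} f - (a - m) * b - (r * s * L - b) / 2)\<bar> \<le> 2 * K * s\<^sup>2"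
  proof -
    have "r\<^sup>2 * \<bar>\<eta> * F - (integral {0..\<alpha>} f - (\<alpha> - m * \<eta>) * f \<alpha> - \<eta> * (L - f \<alpha>) / 2)\<bar> \<le> r\<^sup>2 * (2 * K * \<eta>\<^sup>2)"
      unfolding F_def K_def m_def e[symmetric] using \<eta> \<alpha> by (intro mult_left_mono riemann_sum) auto
    moreover have "r\<^sup>2 * (2 * K * \<eta>\<^sup>2) = 2 * K * s\<^sup>2" using rs by (simp add: \<eta>_def power2_eq_square)
    moreover have "r\<^sup>2 * (\<eta> * F - (integral {0..\<alpha>} f - (\<alpha> - m * \<eta>) * f \<alpha> - \<eta> * (L - f \<alpha>) / 2))
       = r * s * F - (r\<^sup>2 * integral {0..\<alpha>} f - (a - m) * b - (r * s * L - b) / 2)"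
      using rs by (simp add: \<eta>_def a_def b_def field_simps power2_eq_square)
    ultimately show ?thesis by (metis abs_mult abs_power2)
  qed
  have R2: "\<bar>r * (1/s) * G - (r\<^sup>2 * integral {0..f \<alpha>} g - (b - n) * a - (r * (1/s) * L - a) / 2)\<bar> \<le> 2 * K' * (1/s)\<^sup>2"
  proof -
    have "r\<^sup>2 * \<bar>\<eta>' * G - (integral {0..f \<alpha>} g - (f \<alpha> - n * \<eta>') * \<alpha> - \<eta>' * (L - \<alpha>) / 2)\<bar> \<le> r\<^sup>2 * (2 * K' * \<eta>'\<^sup>2)"
      using inv.riemann_sum[of \<eta>' "f \<alpha>"] \<eta> \<beta> unfolding gb e(2) G_def K'_def n_def
      by (intro mult_left_mono) auto
    moreover have "r\<^sup>2 * (2 * K' * \<eta>'\<^sup>2) = 2 * K' * (1/s)\<^sup>2" using rs by (simp add: \<eta>'_def power2_eq_square)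
    moreover have "r\<^sup>2 * (\<eta>' * G - (integral {0..f \<alpha>} g - (f \<alpha> - n * \<eta>') * \<alpha> - \<eta>' * (L - \<alpha>) / 2))
       = r * (1/s) * G - (r\<^sup>2 * integral {0..f \<alpha>} g - (b - n) * a - (r * (1/s) * L - a) / 2)"
      using rs by (simp add: \<eta>'_def a_def b_def field_simps power2_eq_square)
    ultimately show ?thesis by (metis abs_mult abs_power2)
  qed
  have area: "r\<^sup>2 * curve_area f L = r\<^sup>2 * integral {0..\<alpha>} f + r\<^sup>2 * integral {0..f \<alpha>} g - a * b"
    unfolding curve_area_eq integral_split[OF \<alpha>'] integral_tail[OF \<alpha>'] a_def b_def
    using rs by (simp add: field_simps power2_eq_square)
  define X where "X = r * s * F - (r\<^sup>2 * integral {0..\<alpha>} f - (a - m) * b - (r * s * L - b) / 2)"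
  define Y where "Y = r * (1/s) * G - (r\<^sup>2 * integral {0..f \<alpha>} g - (b - n) * a - (r * (1/s) * L - a) / 2)"
  have main: "real (lattice_count f L r s) - (r\<^sup>2 * curve_area f L - r * L * (s + 1 / s) / 2)
     = X + Y - \<Psi> - \<Psi>' + ((a - m) / 2 + (b - n) / 2 - (a - m) * (b - n))"
    unfolding count area X_def Y_def by (simp add: field_simps)
  have "0 \<le> (a - m) * (b - n)" using mn by simp
  moreover have "(a - m) * (b - n) \<le> 1 * 1" by (rule mult_mono) (use mn in auto)
  moreover have "\<bar>(a - m) / 2 + (b - n) / 2 - z\<bar> \<le> 2" if z: "0 \<le> z" "z \<le> 1 * 1" for z
  proof -
    have "0 \<le> (a - m) / 2" "(a - m) / 2 \<le> 1" "0 \<le> (b - n) / 2" "(b - n) / 2 \<le> 1"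
      using mn by simp_all
    then show ?thesis using z unfolding abs_le_iff by linarith
  qed
  ultimately have "\<bar>(a - m) / 2 + (b - n) / 2 - (a - m) * (b - n)\<bar> \<le> 2" by blast
  then have "\<bar>X + Y - \<Psi> - \<Psi>' + ((a - m) / 2 + (b - n) / 2 - (a - m) * (b - n))\<bar>
     \<le> \<bar>\<Psi>\<bar> + \<bar>\<Psi>'\<bar> + 2 + 2 * K * s\<^sup>2 + 2 * K' * (1/s)\<^sup>2"
    using R1[folded X_def] R2[folded Y_def] by linarith
  then show ?thesis unfolding main \<Psi>_def \<Psi>'_def K_def K'_def \<eta>_def \<eta>'_def .
qed

end

section \<open>Bounds for sawtooth sums that are uniform in the stretch factor\<close>

definition sawtooth_sum :: "(real \<Rightarrow> real) \<Rightarrow> real \<Rightarrow> real \<Rightarrow> real \<Rightarrow> real \<Rightarrow> real" where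
  "sawtooth_sum f r s a b = (\<Sum>j\<in>multiples (s / r) a b. sawtooth (r * s * f (of_int j * (s / r))))"

text \<open>
  The bound required by the theorem, uniform for \<open>s\<close> in \<open>[1/c, c]\<close>. The set of these \<open>s\<close> is closed under
  \<open>s \<mapsto> 1/s\<close>, so the same property serves for rows and columns.
\<close>

definition small_sawtooth_sums :: "real \<Rightarrow> real \<Rightarrow> (real \<Rightarrow> real) \<Rightarrow> real \<Rightarrow> real \<Rightarrow> bool" where
  "small_sawtooth_sums e c f a b \<longleftrightarrow>
     (\<exists>C. \<forall>\<^sub>F r in at_top. \<forall>s\<in>{1/c..c}. \<bar>sawtooth_sum f r s a b\<bar> \<le> C * r powr (1 - 2 * e))"

lemma sawtooth_sum_split:
  assumes "a \<le> b" "b \<le> d" "0 < r" "0 < s"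
  shows "sawtooth_sum f r s a d = sawtooth_sum f r s a b + sawtooth_sum f r s b d"
  unfolding sawtooth_sum_def using assms by (intro sum_multiples_split) auto

lemma small_sawtooth_sums_append:
  assumes "a \<le> b" "b \<le> d" "1 \<le> c" "small_sawtooth_sums e c f a b" "small_sawtooth_sums e c f b d"
  shows "small_sawtooth_sums e c f a d"
proof -
  obtain C where C: "\<forall>\<^sub>F r in at_top. \<forall>s\<in>{1/c..c}. \<bar>sawtooth_sum f r s a b\<bar> \<le> C * r powr (1 - 2 * e)"
    using assms(4) unfolding small_sawtooth_sums_def by blast
  obtain C' where C': "\<forall>\<^sub>F r in at_top. \<forall>s\<in>{1/c..c}. \<bar>sawtooth_sum f r s b d\<bar> \<le> C' * r powr (1 - 2 * e)"
    using assms(5) unfolding small_sawtooth_sums_def by blast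
  show ?thesis unfolding small_sawtooth_sums_def
  proof (intro exI[of _ "C + C'"])
    show "\<forall>\<^sub>F r in at_top. \<forall>s\<in>{1/c..c}. \<bar>sawtooth_sum f r s a d\<bar> \<le> (C + C') * r powr (1 - 2 * e)"
      using C C' eventually_gt_at_top[of 0]
    proof eventually_elim
      case (elim r)
      show ?case
      proof
        fix s assume s: "s \<in> {1/c..c}"
        have "0 < 1 / c" using assms by simp
        then have "0 < s" using s by (intro less_le_trans[of 0 "1 / c" s]) auto
        then have "sawtooth_sum f r s a d = sawtooth_sum f r s a b + sawtooth_sum f r s b d"
          using assms elim by (intro sawtooth_sum_split) auto
        moreover have "\<bar>sawtooth_sum f r s a b\<bar> \<le> C * r powr (1 - 2 * e)"
          "\<bar>sawtooth_sum f r s b d\<bar> \<le> C' * r powr (1 - 2 * e)" using elim s by auto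
        ultimately show "\<bar>sawtooth_sum f r s a d\<bar> \<le> (C + C') * r powr (1 - 2 * e)"
          unfolding distrib_right by linarith
      qed
    qed
  qed
qed

text \<open>
  Substituting \<open>r = q ^ 6\<close> makes the powers \<open>r\<^bsup>1/2\<^esup>\<close>, \<open>r\<^bsup>2/3\<^esup>\<close> and the window length \<open>t = r\<^bsup>-1/3\<^esup> = 1 / q\<^sup>2\<close>
  integral powers of \<open>q\<close>. The expressions under the roots are those in the bounds for sawtooth sums, with
  \<open>\<rho> = r * s\<close> and \<open>\<eta> = s / r\<close>.
\<close>

lemma scaled_sqrt_identities:
  assumes "0 < q" "0 < s" "0 < l"
  shows "sqrt (q ^ 6 * s * (s / q ^ 6)\<^sup>2 * l) = s * sqrt s * sqrt l / q ^ 3"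
    and "sqrt (q ^ 6 * s * (s / q ^ 6)\<^sup>2 * l * (1 / q\<^sup>2)) = s * sqrt s * sqrt l / q ^ 4"
    and "sqrt (q ^ 6 * s * l / (1 / q\<^sup>2)) = sqrt s * sqrt l * q ^ 4"
proof -
  have s: "sqrt s * sqrt s = s" "sqrt l * sqrt l = l" using assms by auto
  have m: "(s * sqrt s * sqrt l / q ^ n)\<^sup>2 = s ^ 3 * l / q ^ (2 * n)" for n
  proof -
    have "(s * sqrt s * sqrt l / q ^ n)\<^sup>2 = s * s * (sqrt s * sqrt s) * (sqrt l * sqrt l) / (q ^ n * q ^ n)"
      by (simp add: power2_eq_square mult_ac)
    then show ?thesis unfolding s by (simp add: power_add[symmetric] mult_2 power3_eq_cube)
  qed
  show "sqrt (q ^ 6 * s * (s / q ^ 6)\<^sup>2 * l) = s * sqrt s * sqrt l / q ^ 3"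
    by (rule real_sqrt_unique) (use assms m[of 3] in \<open>auto simp: field_simps eval_nat_numeral\<close>)
  show "sqrt (q ^ 6 * s * (s / q ^ 6)\<^sup>2 * l * (1 / q\<^sup>2)) = s * sqrt s * sqrt l / q ^ 4"
    by (rule real_sqrt_unique) (use assms m[of 4] in \<open>auto simp: field_simps eval_nat_numeral\<close>)
  have "(sqrt s * sqrt l * q ^ 4)\<^sup>2 = (sqrt s * sqrt s) * (sqrt l * sqrt l) * (q ^ 4 * q ^ 4)"
    by (simp add: power2_eq_square mult_ac)
  then show "sqrt (q ^ 6 * s * l / (1 / q\<^sup>2)) = sqrt s * sqrt l * q ^ 4"
    unfolding s by (intro real_sqrt_unique) (use assms in \<open>auto simp: field_simps eval_nat_numeral\<close>)
qed

lemma sixth_root: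
  fixes r :: real
  assumes "1 \<le> r"
  obtains q where "1 \<le> q" "r = q ^ 6" "q ^ 4 = r powr (2/3)" "q ^ 3 = r powr (1/2)"
proof
  define q where "q = r powr (1/6)"
  show "1 \<le> r powr (1/6)" using assms by (simp add: ge_one_powr_ge_zero)
  have "0 < q" using assms by (simp add: q_def)
  have p: "(r powr (1/6)) ^ n = r powr (real n / 6)" for n
    using assms by (simp add: powr_powr flip: powr_realpow)
  show "r = (r powr (1/6)) ^ 6" "(r powr (1/6)) ^ 4 = r powr (2/3)" "(r powr (1/6)) ^ 3 = r powr (1/2)"
    unfolding p using assms by auto
qed

lemma scale_bounds:
  fixes s c :: real
  assumes "1 \<le> c" "s \<in> {1/c..c}"
  shows "0 < s" "1 / s \<le> c" "sqrt s \<le> c" "1 / (s * sqrt s) \<le> c\<^sup>2"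
proof -
  have "0 < 1 / c" using assms by simp
  then show s: "0 < s" using assms(2) by (intro less_le_trans[of 0 "1 / c" s]) auto
  show 1: "1 / s \<le> c" using assms s by (auto simp: field_simps)
  have "sqrt x \<le> c" if "x \<le> c" "0 < x" for x
  proof (rule real_le_lsqrt)
    show "x \<le> c\<^sup>2" using that assms self_le_power[of c 2] by auto
  qed (use assms in auto)
  from this[of s] this[of "1 / s"] show 2: "sqrt s \<le> c" using assms s by auto
  have "sqrt (1 / s) \<le> c" using \<open>\<And>x. x \<le> c \<Longrightarrow> 0 < x \<Longrightarrow> sqrt x \<le> c\<close>[of "1/s"] 1 s by auto
  then have "(1 / s) * sqrt (1 / s) \<le> c * c" using 1 s assms by (intro mult_mono) auto
  then show "1 / (s * sqrt s) \<le> c\<^sup>2" by (simp add: real_sqrt_divide power2_eq_square)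
qed

lemma card_multiples_scaled_le:
  assumes "1 \<le> c" "s \<in> {1/c..c}" "1 \<le> q" "0 \<le> a" "a \<le> b"
  shows "real (card (multiples (s / q ^ 6) a b)) * (1 / q\<^sup>2) \<le> b * c * q ^ 4"
proof -
  note s = scale_bounds[OF assms(1,2)]
  have "real (card (multiples (s / q ^ 6) a b)) \<le> b / (s / q ^ 6)"
    using assms s by (intro card_multiples_le) auto
  also have "\<dots> = b * (1 / s) * q ^ 6" by simp
  also have "\<dots> \<le> b * c * q ^ 6" using s assms by (intro mult_right_mono mult_left_mono) auto
  finally have "real (card (multiples (s / q ^ 6) a b)) * (1 / q\<^sup>2) \<le> b * c * q ^ 6 * (1 / q\<^sup>2)"
    by (intro mult_right_mono) auto
  also have "\<dots> = b * c * q ^ 4" using assms by (simp add: field_simps eval_nat_numeral)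
  finally show ?thesis .
qed

lemma spacing_condition:
  fixes c s q l :: real
  assumes "1 \<le> c" "s \<in> {1/c..c}" "1 \<le> q" "0 \<le> l" "(c ^ 3 * l)\<^sup>2 \<le> q ^ 6"
  shows "(q ^ 6 * s * (s / q ^ 6)\<^sup>2 * l)\<^sup>2 \<le> 1 / q\<^sup>2"
proof -
  note s = scale_bounds[OF assms(1,2)]
  have "q ^ 6 * s * (s / q ^ 6)\<^sup>2 * l = s ^ 3 * l / q ^ 6"
    using assms by (simp add: field_simps eval_nat_numeral)
  also have "\<dots>\<^sup>2 = (s ^ 3 * l)\<^sup>2 / q ^ 12" by (simp add: power_divide flip: power_mult)
  also have "\<dots> \<le> (c ^ 3 * l)\<^sup>2 / q ^ 12"
    using s assms by (intro divide_right_mono power_mono mult_right_mono) auto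
  also have "\<dots> \<le> q ^ 6 / q ^ 12" using assms by (intro divide_right_mono) auto
  also have "\<dots> = 1 / q ^ 6" using assms by (simp add: field_simps flip: power_add)
  also have "\<dots> \<le> 1 / q\<^sup>2" using assms by (intro divide_left_mono power_increasing) auto
  finally show ?thesis .
qed

lemma small_sawtooth_sums_strongly_concave:
  fixes f D :: "real \<Rightarrow> real"
  assumes der: "\<And>x. x \<in> {a<..b} \<Longrightarrow> (f has_real_derivative D x) (at x within {a<..b})"
    and gap: "\<And>x y. x \<in> {a<..b} \<Longrightarrow> y \<in> {a<..b} \<Longrightarrow> x \<le> y \<Longrightarrow> D y + l0 * (y - x) \<le> D x"
    and V: "\<And>x y. x \<in> {a<..b} \<Longrightarrow> y \<in> {a<..b} \<Longrightarrow> x \<le> y \<Longrightarrow> D x - D y \<le> V0" "0 \<le> V0"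
    and ab: "0 \<le> a" "a \<le> b" and l0: "0 < l0" and c: "1 \<le> c" and e: "e \<le> 1/6"
  shows "small_sawtooth_sums e c f a b"
  unfolding small_sawtooth_sums_def
proof (intro exI)
  define K where "K = b * c + 60 * (c * V0 / sqrt l0 + c\<^sup>2 / sqrt l0)"
  have K: "0 \<le> K" unfolding K_def using ab c V l0 by (intro add_nonneg_nonneg mult_nonneg_nonneg divide_nonneg_nonneg) auto
  show "\<forall>\<^sub>F r in at_top. \<forall>s\<in>{1/c..c}. \<bar>sawtooth_sum f r s a b\<bar> \<le> K * r powr (1 - 2 * e)"
    using eventually_gt_at_top[of "1::real"] eventually_ge_at_top[of "(c ^ 3 * l0)\<^sup>2"]
  proof eventually_elim
    case (elim r)
    obtain q where q: "1 \<le> q" "r = q ^ 6" "q ^ 4 = r powr (2/3)" using sixth_root[of r] elim by auto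
    have q1: "1 < q" using q elim by (cases "q = 1") auto
    show ?case
    proof
      fix s assume s: "s \<in> {1/c..c}"
      note sb = scale_bounds[OF c s]
      let ?M = "multiples (s / q ^ 6) a b"
      have "\<bar>sawtooth_sum f r s a b\<bar> \<le> real (card ?M) * (1 / q\<^sup>2)
        + 60 * ((q ^ 6 * s) * (s / q ^ 6) * V0 / sqrt (q ^ 6 * s * (s / q ^ 6)\<^sup>2 * l0 * (1 / q\<^sup>2))
               + 1 / sqrt (q ^ 6 * s * (s / q ^ 6)\<^sup>2 * l0))"
        unfolding sawtooth_sum_def q(2)
      proof (rule sum_sawtooth_strongly_concave[OF der gap V])
        show "(q ^ 6 * s * (s / q ^ 6)\<^sup>2 * l0)\<^sup>2 \<le> 1 / q\<^sup>2"
          using spacing_condition[OF c s q(1), of l0] l0 elim q by simp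
      qed (use l0 sb q1 in \<open>auto simp: power_gt1\<close>)
      also have "(q ^ 6 * s) * (s / q ^ 6) * V0 / sqrt (q ^ 6 * s * (s / q ^ 6)\<^sup>2 * l0 * (1 / q\<^sup>2))
           = sqrt s * (V0 / sqrt l0) * q ^ 4"
      proof -
        have gen: "x * x * s * V0 / (s * x * y / z) = x * (V0 / y) * z" if "0 < x" "0 < y" "0 < z" for x y z
          using that sb by (simp add: field_simps)
        have eq1: "(q ^ 6 * s) * (s / q ^ 6) * V0 = sqrt s * sqrt s * s * V0" using sb q1 by simp
        have eq2: "sqrt (q ^ 6 * s * (s / q ^ 6)\<^sup>2 * l0 * (1 / q\<^sup>2)) = s * sqrt s * sqrt l0 / q ^ 4"
          using sb l0 q1 by (intro scaled_sqrt_identities) auto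
        show ?thesis unfolding eq1 eq2 by (rule gen) (use sb l0 q1 in auto)
      qed
      also have "1 / sqrt (q ^ 6 * s * (s / q ^ 6)\<^sup>2 * l0) = 1 / (s * sqrt s) * (1 / sqrt l0) * q ^ 3"
        using sb l0 q1 by (simp add: scaled_sqrt_identities)
      also have "real (card ?M) * (1 / q\<^sup>2) + 60 * (sqrt s * (V0 / sqrt l0) * q ^ 4 + 1 / (s * sqrt s) * (1 / sqrt l0) * q ^ 3)
         \<le> b * c * q ^ 4 + 60 * (c * (V0 / sqrt l0) * q ^ 4 + c\<^sup>2 * (1 / sqrt l0) * q ^ 4)"
        using sb V l0 q c ab s
        by (intro add_mono mult_mono card_multiples_scaled_le power_increasing) auto
      also have "\<dots> = K * q ^ 4" by (simp add: K_def algebra_simps)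
      also have "\<dots> \<le> K * r powr (1 - 2 * e)"
        unfolding q(3) using K elim e by (intro mult_left_mono powr_mono) auto
      finally show "\<bar>sawtooth_sum f r s a b\<bar> \<le> K * r powr (1 - 2 * e)" .
    qed
  qed
qed

lemma eventually_less_of_bigo_powr:
  fixes \<delta> :: "real \<Rightarrow> real"
  assumes "\<delta> \<in> O(\<lambda>r. r powr (-2 * a))" "0 < a" "0 < b"
  shows "\<forall>\<^sub>F r in at_top. \<delta> r < b"
proof -
  obtain C where C: "0 < C" "\<forall>\<^sub>F r in at_top. norm (\<delta> r) \<le> C * norm (r powr (-2 * a))"
    using assms(1) by (elim landau_o.bigE)
  have "((\<lambda>r. C * r powr (-2 * a)) \<longlongrightarrow> C * 0) at_top"
    using assms by (intro tendsto_mult tendsto_const tendsto_neg_powr filterlim_ident) auto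
  then have "\<forall>\<^sub>F r in at_top. C * r powr (-2 * a) < b"
    using assms by (intro order_tendstoD(2)) auto
  with C(2) show ?thesis by eventually_elim auto
qed

text \<open>
  The second derivative may vanish at the origin. Up to \<open>d = \<delta> r\<close> the number of terms is at most \<open>d * r / s\<close>. Beyond
  \<open>d\<close> the dyadic bound applies, and its only term that can exceed \<open>O(r\<^bsup>2/3\<^esup>)\<close> is a multiple of
  \<open>r\<^bsup>1/2\<^esup> / sqrt (F d)\<close>.
\<close>

lemma small_sawtooth_sums_degenerate:
  fixes f D F \<delta> :: "real \<Rightarrow> real"
  assumes f: "\<And>x. x \<in> {0<..b} \<Longrightarrow> (f has_real_derivative D x) (at x within {0<..b})"
    and D: "\<And>x. x \<in> {0<..b} \<Longrightarrow> (D has_real_derivative - F x) (at x within {0<..b})"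
    and F: "continuous_on {0<..b} F" "mono_on {0<..b} F" "\<And>x. x \<in> {0<..b} \<Longrightarrow> 0 < F x"
    and b: "0 < b" and \<delta>: "\<And>r. 0 < r \<Longrightarrow> 0 < \<delta> r"
    and c: "1 \<le> c" and e: "e \<le> 1/6" "e \<le> a1" "e \<le> a2" and a1: "0 < a1"
    and O1: "\<delta> \<in> O(\<lambda>r. r powr (-2 * a1))"
    and O2: "(\<lambda>r. inverse (F (\<delta> r))) \<in> O(\<lambda>r. r powr (1 - 4 * a2))"
  shows "small_sawtooth_sums e c f 0 b"
proof -
  obtain C1 where C1: "0 < C1" "\<forall>\<^sub>F r in at_top. norm (\<delta> r) \<le> C1 * norm (r powr (-2 * a1))"
    using O1 by (elim landau_o.bigE)
  obtain C2 where C2: "0 < C2" "\<forall>\<^sub>F r in at_top. norm (inverse (F (\<delta> r))) \<le> C2 * norm (r powr (1 - 4 * a2))"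
    using O2 by (elim landau_o.bigE)
  have small: "\<forall>\<^sub>F r in at_top. \<delta> r < b"
    by (rule eventually_less_of_bigo_powr[OF O1 a1 b])
  define K where "K = c * C1 + b * c + 60 * (2 * b * (c * sqrt (F b)) + 4 * c\<^sup>2 * sqrt C2)"
  have Fb: "0 < F b" using F(3) b by auto
  show ?thesis unfolding small_sawtooth_sums_def
  proof (intro exI)
    show "\<forall>\<^sub>F r in at_top. \<forall>s\<in>{1/c..c}. \<bar>sawtooth_sum f r s 0 b\<bar> \<le> K * r powr (1 - 2 * e)"
      using eventually_gt_at_top[of "1::real"] eventually_ge_at_top[of "(c ^ 3 * F b)\<^sup>2"] C1(2) C2(2) small
    proof eventually_elim
      case (elim r)
      define d where "d = \<delta> r"
      define R where "R = r powr (1 - 2 * e)"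
      have R: "0 < R" using elim by (simp add: R_def)
      have d: "0 < d" "d \<le> C1 * r powr (-2 * a1)" "d < b"
        using elim \<delta>[of r] by (auto simp: d_def)
      have Fd: "0 < F d" "inverse (F d) \<le> C2 * r powr (1 - 4 * a2)"
        using elim F(3)[of d] d by (auto simp: d_def)
      obtain q where q: "1 \<le> q" "r = q ^ 6" "q ^ 4 = r powr (2/3)" "q ^ 3 = r powr (1/2)" using sixth_root[of r] elim by auto
      have q1: "1 < q" using q elim by (cases "q = 1") auto
      have q4: "q ^ 4 \<le> R" unfolding q(3) R_def using elim e by (intro powr_mono) auto
      have Fd2: "1 / sqrt (F d) * q ^ 3 \<le> sqrt C2 * R"
      proof -
        have "1 / sqrt (F d) = sqrt (inverse (F d))" by (simp add: real_sqrt_inverse divide_inverse)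
        also have "\<dots> \<le> sqrt (C2 * r powr (1 - 4 * a2))" using Fd by simp
        also have "\<dots> = sqrt C2 * r powr ((1 - 4 * a2) / 2)"
          using elim by (simp add: real_sqrt_mult powr_half_sqrt[symmetric] powr_powr)
        finally have "1 / sqrt (F d) * q ^ 3 \<le> sqrt C2 * r powr ((1 - 4 * a2) / 2) * r powr (1/2)"
          unfolding q(4) by (intro mult_right_mono) auto
        also have "\<dots> = sqrt C2 * r powr (1 - 2 * a2)"
        proof -
          have "(1 - 4 * a2) / 2 + 1/2 = 1 - 2 * a2" by (simp add: field_simps)
          then have "r powr ((1 - 4 * a2) / 2) * r powr (1/2) = r powr (1 - 2 * a2)"
            by (simp only: powr_add[symmetric])
          then show ?thesis by (simp only: mult.assoc)
        qed
        also have "\<dots> \<le> sqrt C2 * R" unfolding R_def using elim e C2 by (intro mult_left_mono powr_mono) auto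
        finally show ?thesis .
      qed
      show ?case unfolding R_def[symmetric]
      proof
        fix s assume s: "s \<in> {1/c..c}"
        note sb = scale_bounds[OF c s]
        have r0: "0 < r" using elim by simp
        have "\<bar>sawtooth_sum f r s 0 d\<bar> \<le> (\<Sum>j\<in>multiples (s / r) 0 d. \<bar>sawtooth (r * s * f (of_int j * (s / r)))\<bar>)"
          unfolding sawtooth_sum_def by (rule sum_abs)
        also have "\<dots> \<le> (\<Sum>j\<in>multiples (s / r) 0 d. 1)"
        proof (rule sum_mono)
          fix j
          show "\<bar>sawtooth (r * s * f (of_int j * (s / r)))\<bar> \<le> 1"
            unfolding sawtooth_def abs_le_iff
            using frac_ge_0[of "r * s * f (of_int j * (s / r))"] frac_lt_1[of "r * s * f (of_int j * (s / r))"]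
            by linarith
        qed
        also have "\<dots> \<le> d / (s / r)" using card_multiples_le[of "s / r" 0 d] d sb r0 by simp
        also have "\<dots> = (1 / s) * d * r" by simp
        also have "\<dots> \<le> c * (C1 * r powr (-2 * a1)) * r"
          using sb d r0 c C1(1) by (intro mult_mono mult_nonneg_nonneg) auto
        also have "\<dots> = c * C1 * (r powr (-2 * a1) * r powr 1)" using r0 by simp
        also have "\<dots> = c * C1 * r powr (1 - 2 * a1)"
        proof -
          have "-2 * a1 + 1 = 1 - 2 * a1" by simp
          then show ?thesis by (simp only: powr_add[symmetric])
        qed
        also have "\<dots> \<le> c * C1 * R"
          unfolding R_def using elim e C1 c by (intro mult_left_mono powr_mono) auto
        finally have 1: "\<bar>sawtooth_sum f r s 0 d\<bar> \<le> c * C1 * R" .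
        have sub: "{d..b} \<subseteq> {0<..b}" using d by auto
        have "\<bar>sawtooth_sum f r s d b\<bar> \<le> real (card (multiples (s / q ^ 6) d b)) * (1 / q\<^sup>2)
          + 60 * (2 * (b - d) * sqrt (q ^ 6 * s * F b / (1 / q\<^sup>2)) + 4 / sqrt (q ^ 6 * s * (s / q ^ 6)\<^sup>2 * F d))"
          unfolding sawtooth_sum_def q(2)
        proof (rule sum_sawtooth_dyadic[where D = D])
          show "(f has_real_derivative D x) (at x within {d..b})" if "x \<in> {d..b}" for x
            by (rule DERIV_subset[OF f sub]) (use that sub in auto)
          show "(D has_real_derivative - F x) (at x within {d..b})" if "x \<in> {d..b}" for x
            by (rule DERIV_subset[OF D sub]) (use that sub in auto)
          show "continuous_on {d..b} F" using F(1) sub by (rule continuous_on_subset)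
          show "mono_on {d..b} F" using F(2) sub by (rule mono_on_subset)
          show "(q ^ 6 * s * (s / q ^ 6)\<^sup>2 * F b)\<^sup>2 \<le> 1 / q\<^sup>2"
            using spacing_condition[OF c s q(1), of "F b"] Fb elim q by simp
        qed (use Fd d sb q1 in \<open>auto simp: power_gt1\<close>)
        also have "sqrt (q ^ 6 * s * F b / (1 / q\<^sup>2)) = sqrt s * sqrt (F b) * q ^ 4"
          using sb Fb q1 by (intro scaled_sqrt_identities) auto
        also have "4 / sqrt (q ^ 6 * s * (s / q ^ 6)\<^sup>2 * F d) = 4 * (1 / (s * sqrt s)) * (1 / sqrt (F d) * q ^ 3)"
          using sb Fd q1 by (simp add: scaled_sqrt_identities)
        also have "real (card (multiples (s / q ^ 6) d b)) * (1 / q\<^sup>2)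
            + 60 * (2 * (b - d) * (sqrt s * sqrt (F b) * q ^ 4) + 4 * (1 / (s * sqrt s)) * (1 / sqrt (F d) * q ^ 3))
          \<le> b * c * R + 60 * (2 * b * (c * sqrt (F b) * R) + 4 * c\<^sup>2 * (sqrt C2 * R))"
        proof (intro add_mono mult_left_mono)
          have "b * c * q ^ 4 \<le> b * c * R" using q4 b c by (intro mult_left_mono) auto
          then show "real (card (multiples (s / q ^ 6) d b)) * (1 / q\<^sup>2) \<le> b * c * R"
            using card_multiples_scaled_le[OF c s q(1), of d b] d by linarith
          have "sqrt s * sqrt (F b) * q ^ 4 \<le> c * sqrt (F b) * R"
            using sb q4 Fb c by (intro mult_mono) auto
          then show "2 * (b - d) * (sqrt s * sqrt (F b) * q ^ 4) \<le> 2 * b * (c * sqrt (F b) * R)"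
            by (rule mult_mono[rotated]) (use d sb Fb in auto)
          have "4 * (1 / (s * sqrt s)) \<le> 4 * c\<^sup>2" using sb by (intro mult_left_mono) auto
          from mult_mono[OF this Fd2]
          show "4 * (1 / (s * sqrt s)) * (1 / sqrt (F d) * q ^ 3) \<le> 4 * c\<^sup>2 * (sqrt C2 * R)"
            using Fd q by auto
        qed simp
        also have "\<dots> = (K - c * C1) * R" by (simp add: K_def algebra_simps)
        finally have "\<bar>sawtooth_sum f r s d b\<bar> \<le> (K - c * C1) * R" .
        moreover have "sawtooth_sum f r s 0 b = sawtooth_sum f r s 0 d + sawtooth_sum f r s d b"
          using d r0 sb by (intro sawtooth_sum_split) auto
        ultimately show "\<bar>sawtooth_sum f r s 0 b\<bar> \<le> K * R" using 1 unfolding left_diff_distrib by linarith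
      qed
    qed
  qed
qed

lemma C2_on_has_derivatives:
  assumes "C2_on I f" "x \<in> I"
  shows "(f has_real_derivative deriv1_on I f x) (at x within I)"
    and "(deriv1_on I f has_real_derivative deriv2_on I f x) (at x within I)"
proof -
  have d: "f differentiable (at x within I)" "deriv1_on I f differentiable (at x within I)"
    using assms unfolding C2_on_def differentiable_on_def by blast+
  have e: "deriv1_on I f x = vector_derivative f (at x within I)"
    "deriv2_on I f x = vector_derivative (deriv1_on I f) (at x within I)"
    unfolding deriv2_on_def by (rule deriv1_on_def)+
  show "(f has_real_derivative deriv1_on I f x) (at x within I)"
    "(deriv1_on I f has_real_derivative deriv2_on I f x) (at x within I)"
    using d unfolding e has_real_derivative_iff_has_vector_derivative vector_derivative_works by blast+
qed

lemma deriv_deriv_eq_deriv2_on: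
  assumes "C2_on {0<..b} f" "x \<in> {0<..<b}"
  shows "deriv (deriv f) x = deriv2_on {0<..b} f x"
proof -
  let ?I = "{0<..b}"
  have at: "at y within ?I = at y" if "y \<in> {0<..<b}" for y
    using that by (intro at_within_interior) (auto intro: interiorI[of "{0<..<b}"])
  have eq: "deriv1_on ?I f y = deriv f y" if y: "y \<in> {0<..<b}" for y
  proof -
    have "(f has_real_derivative deriv1_on ?I f y) (at y within ?I)"
      by (rule C2_on_has_derivatives(1)[OF assms(1)]) (use y in simp)
    then show ?thesis unfolding at[OF y] by (rule DERIV_imp_deriv[symmetric])
  qed
  have "(deriv1_on ?I f has_real_derivative deriv2_on ?I f x) (at x within ?I)"
    by (rule C2_on_has_derivatives(2)[OF assms(1)]) (use assms(2) in simp)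
  then have "(deriv1_on ?I f has_real_derivative deriv2_on ?I f x) (at x)"
    unfolding at[OF assms(2)] .
  then have "(deriv f has_real_derivative deriv2_on ?I f x) (at x)"
    by (rule has_field_derivative_transform_within_open[OF _ open_greaterThanLessThan assms(2) eq])
  then show ?thesis by (rule DERIV_imp_deriv)
qed

text \<open>
  The first derivative is negative and decreasing, hence on \<open>(a, b]\<close> it varies by at most its absolute value
  at \<open>b\<close>. This also covers a half-open first piece on which the second derivative is unbounded near 0.
\<close>

lemma small_sawtooth_sums_C2_piece:
  assumes I: "is_interval I" "{a<..b} \<subseteq> I" "0 \<le> a" "a < b" and C2: "C2_on I f"
    and neg: "\<And>x. x \<in> I \<Longrightarrow> deriv1_on I f x < 0"
    and l0: "0 < l0" "\<And>x. x \<in> I \<Longrightarrow> deriv2_on I f x \<le> - l0"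
    and c: "1 \<le> c" and e: "e \<le> 1/6"
  shows "small_sawtooth_sums e c f a b"
proof -
  let ?D = "deriv1_on I f"
  have mem: "x \<in> I" if "x \<in> {a<..b}" for x using that I(2) by blast
  have b: "b \<in> I" using I(4) by (intro mem) simp
  have gap: "?D y + l0 * (y - x) \<le> ?D x" if xy: "x \<in> I" "y \<in> I" "x \<le> y" for x y
  proof (cases "x = y")
    case False
    then obtain z where z: "z \<in> I" "?D y - ?D x = (y - x) * deriv2_on I f z"
      using mvt_within[OF C2_on_has_derivatives(2)[OF C2] I(1) xy(1,2)] xy by auto
    have "(y - x) * deriv2_on I f z \<le> (y - x) * (- l0)"
      using l0(2)[OF z(1)] xy by (intro mult_left_mono) auto
    then show ?thesis using z(2) by (simp add: algebra_simps)
  qed simp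
  show ?thesis
  proof (rule small_sawtooth_sums_strongly_concave[where D = ?D and ?l0.0 = l0 and ?V0.0 = "- ?D b"])
    show "(f has_real_derivative ?D x) (at x within {a<..b})" if "x \<in> {a<..b}" for x
      by (rule DERIV_subset[OF C2_on_has_derivatives(1)[OF C2] I(2)]) (use that mem in blast)+
    show "?D y + l0 * (y - x) \<le> ?D x" if "x \<in> {a<..b}" "y \<in> {a<..b}" "x \<le> y" for x y
      by (rule gap[OF mem mem]) (use that in blast)+
    show "?D x - ?D y \<le> - ?D b" if xy: "x \<in> {a<..b}" "y \<in> {a<..b}" "x \<le> y" for x y
    proof -
      have m: "x \<in> I" "y \<in> I" "b \<in> I" using mem[OF xy(1)] mem[OF xy(2)] b by blast+
      have "0 \<le> l0 * (b - y)" using xy l0 by simp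
      then have "?D b \<le> ?D y" using gap[OF m(2,3)] xy by simp
      then show ?thesis using neg[OF m(1)] by linarith
    qed
    show "0 \<le> - ?D b" using neg[OF b] by simp
  qed (use I l0 c e in auto)
qed

text \<open>
  A monotone second derivative is bounded away from 0 by its value at an endpoint of the piece. The only endpoint
  that does not belong to its piece is 0, so the degenerate case is a first piece on which the
  second derivative is decreasing.
\<close>

lemma small_sawtooth_sums_PC2:
  assumes PC2: "PC2_on \<alpha> l p f"
    and neg1: "\<And>i x. i < l \<Longrightarrow> x \<in> subinterval p i \<Longrightarrow> deriv1_on (subinterval p i) f x < 0"
    and neg2: "\<And>i x. i < l \<Longrightarrow> x \<in> subinterval p i \<Longrightarrow> deriv2_on (subinterval p i) f x < 0"
    and monot: "\<And>i. i < l \<Longrightarrow> mono_on (subinterval p i) (deriv2_on (subinterval p i) f)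
                      \<or> antimono_on (subinterval p i) (deriv2_on (subinterval p i) f)"
    and a1: "0 < a1" and \<delta>: "\<And>r. 0 < r \<Longrightarrow> 0 < \<delta> r"
    and O1: "\<delta> \<in> O(\<lambda>r. r powr (-2 * a1))"
    and O2: "(\<lambda>r. inverse (deriv (deriv f) (\<delta> r))) \<in> O(\<lambda>r. r powr (1 - 4 * a2))"
    and c: "1 \<le> c" and e: "e \<le> 1/6" "e \<le> a1" "e \<le> a2"
  shows "small_sawtooth_sums e c f 0 \<alpha>"
proof -
  have part: "p 0 = 0" "p l = \<alpha>" "\<And>i. i < l \<Longrightarrow> p i < p (Suc i)"
    and C2: "\<And>i. i < l \<Longrightarrow> C2_on (subinterval p i) f"
    using PC2 unfolding PC2_on_def is_partition_def by auto
  have p0: "0 \<le> p i" if "i \<le> l" for i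
    using that by (induction i) (use part in \<open>auto intro: less_imp_le order_trans simp: Suc_le_eq\<close>)
  have piece: "small_sawtooth_sums e c f (p i) (p (Suc i))" if i: "i < l" for i
  proof -
    let ?I = "subinterval p i"
    let ?D2 = "deriv2_on ?I f"
    have int: "is_interval ?I" by (auto simp: subinterval_def is_interval_oc is_interval_cc)
    have sub: "{p i<..p (Suc i)} \<subseteq> ?I" using part by (auto simp: subinterval_def)
    have b: "p (Suc i) \<in> ?I" using sub part(3)[OF i] by auto
    have le: "x \<le> p (Suc i)" if "x \<in> ?I" for x using that by (auto simp: subinterval_def split: if_splits)
    have bounded: "small_sawtooth_sums e c f (p i) (p (Suc i))"
      if y: "y \<in> ?I" "\<And>x. x \<in> ?I \<Longrightarrow> ?D2 x \<le> ?D2 y" for y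
      by (rule small_sawtooth_sums_C2_piece[OF int sub p0 part(3) C2 neg1, where ?l0.0 = "- ?D2 y"])
         (use i y neg2[OF i] c e in auto)
    show ?thesis
    proof (cases "mono_on ?I ?D2")
      case True
      show ?thesis
        by (rule bounded[OF b]) (use mono_onD[OF True _ b] le in auto)
    next
      case False
      then have anti: "antimono_on ?I ?D2" using monot[OF i] by auto
      show ?thesis
      proof (cases "i = 0")
        case False
        then have a: "p i \<in> ?I" using part(3)[OF i] by (auto simp: subinterval_def)
        show ?thesis
          by (rule bounded[OF a]) (use False anti a in \<open>auto simp: subinterval_def monotone_on_def\<close>)
      next
        case True
        have I: "?I = {0<..p 1}" using True by (simp add: subinterval_def)
        have p1: "0 < p 1" using part(1,3) i True by force
        have ev: "\<forall>\<^sub>F r in at_top. - inverse (deriv (deriv f) (\<delta> r)) = inverse (- ?D2 (\<delta> r))"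
          using eventually_less_of_bigo_powr[OF O1 a1 p1] eventually_gt_at_top[of 0]
        proof eventually_elim
          case (elim r)
          then have "deriv (deriv f) (\<delta> r) = ?D2 (\<delta> r)"
            using deriv_deriv_eq_deriv2_on[of "p 1" f "\<delta> r"] C2[OF i] \<delta>[of r] unfolding I by auto
          then show ?case by simp
        qed
        have "(\<lambda>r. - inverse (deriv (deriv f) (\<delta> r))) \<in> O(\<lambda>r. r powr (1 - 4 * a2))"
          using O2 by simp
        then have O2': "(\<lambda>r. inverse (- ?D2 (\<delta> r))) \<in> O(\<lambda>r. r powr (1 - 4 * a2))"
          using landau_o.big.in_cong[OF ev] by blast
        have "small_sawtooth_sums e c f 0 (p 1)"
        proof (rule small_sawtooth_sums_degenerate[where F = "\<lambda>x. - ?D2 x" and D = "deriv1_on ?I f" and \<delta> = \<delta> and ?a1.0 = a1 and ?a2.0 = a2])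
          show "(f has_real_derivative deriv1_on ?I f x) (at x within {0<..p 1})" if "x \<in> {0<..p 1}" for x
            using C2_on_has_derivatives(1)[OF C2[OF i], of x] that unfolding I by simp
          show "(deriv1_on ?I f has_real_derivative - (- ?D2 x)) (at x within {0<..p 1})" if "x \<in> {0<..p 1}" for x
            using C2_on_has_derivatives(2)[OF C2[OF i], of x] that unfolding I by simp
          show "continuous_on {0<..p 1} (\<lambda>x. - ?D2 x)"
            using C2[OF i] unfolding C2_on_def I by (intro continuous_on_minus) auto
          show "mono_on {0<..p 1} (\<lambda>x. - ?D2 x)"
            using anti unfolding I by (auto simp: monotone_on_def)
          show "0 < - ?D2 x" if "x \<in> {0<..p 1}" for x
            using neg2[OF i, of x] that unfolding I by simp
        qed (use p1 \<delta> c e a1 O1 O2' in auto)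
        then show ?thesis using True part by simp
      qed
    qed
  qed
  have "small_sawtooth_sums e c f 0 (p i)" if "i \<le> l" for i
    using that
  proof (induction i)
    case 0
    have "sawtooth_sum f r s 0 0 = 0" for r s
      by (simp add: sawtooth_sum_def multiples_def not_less[symmetric])
    then show ?case unfolding small_sawtooth_sums_def part(1) by (intro exI[of _ 1]) simp
  next
    case (Suc i)
    then show ?case
      using small_sawtooth_sums_append[of 0 "p i" "p (Suc i)" c e f] piece[of i] p0[of i] part(3)[of i] c by auto
  qed
  from this[of l] show ?thesis using part by simp
qed

section \<open>Optimal stretch factors\<close>

lemma (in concave_curve) two_term_estimate:
  assumes \<alpha>: "0 < \<alpha>" "\<alpha> < L" and c: "1 \<le> c" and e: "e \<le> 1/6"
    and small: "small_sawtooth_sums e c f 0 \<alpha>" "small_sawtooth_sums e c g 0 (f \<alpha>)"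
  obtains C where "0 \<le> C"
    "\<forall>\<^sub>F r in at_top. \<forall>s\<in>{1/c..c}. \<bar>real (lattice_count f L r s) - (r\<^sup>2 * curve_area f L - r * L * (s + 1 / s) / 2)\<bar> \<le> C * r powr (1 - 2 * e)"
proof -
  obtain C1 where C1: "\<forall>\<^sub>F r in at_top. \<forall>s\<in>{1/c..c}. \<bar>sawtooth_sum f r s 0 \<alpha>\<bar> \<le> C1 * r powr (1 - 2 * e)"
    using small(1) unfolding small_sawtooth_sums_def by blast
  obtain C2 where C2: "\<forall>\<^sub>F r in at_top. \<forall>s\<in>{1/c..c}. \<bar>sawtooth_sum g r s 0 (f \<alpha>)\<bar> \<le> C2 * r powr (1 - 2 * e)"
    using small(2) unfolding small_sawtooth_sums_def by blast
  have \<beta>: "0 < f \<alpha>" "f \<alpha> < L" using f_less[of \<alpha> L] f_less[of 0 \<alpha>] \<alpha> f_L f_0 by auto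
  define K where "K = 2 * (f \<alpha> / (L - \<alpha>))"
  define K' where "K' = 2 * (\<alpha> / (L - f \<alpha>))"
  have K: "0 \<le> K" "0 \<le> K'" using \<alpha> \<beta> by (auto simp: K_def K'_def)
  define C where "C = \<bar>C1\<bar> + \<bar>C2\<bar> + (2 + K * c\<^sup>2 + K' * c\<^sup>2)"
  have C0: "0 \<le> C" using K by (simp add: C_def)
  have "\<forall>\<^sub>F r in at_top. \<forall>s\<in>{1/c..c}. \<bar>real (lattice_count f L r s) - (r\<^sup>2 * curve_area f L - r * L * (s + 1 / s) / 2)\<bar> \<le> C * r powr (1 - 2 * e)"
    using C1 C2 eventually_ge_at_top[of 1]
  proof eventually_elim
    case (elim r)
    define R where "R = r powr (1 - 2 * e)"
    have R: "1 \<le> R" unfolding R_def using elim e by (intro ge_one_powr_ge_zero) auto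
    show ?case unfolding R_def[symmetric]
    proof
      fix s assume s: "s \<in> {1/c..c}"
      note sb = scale_bounds[OF c s]
      have s': "1 / s \<in> {1/c..c}" using sb s c by (auto simp: field_simps)
      have "\<bar>sawtooth_sum f r s 0 \<alpha>\<bar> \<le> C1 * R" using elim s unfolding R_def by blast
      also have "\<dots> \<le> \<bar>C1\<bar> * R" using R by (intro mult_right_mono) auto
      finally have 1: "\<bar>sawtooth_sum f r s 0 \<alpha>\<bar> \<le> \<bar>C1\<bar> * R" .
      have "\<bar>sawtooth_sum g r (1 / s) 0 (f \<alpha>)\<bar> \<le> C2 * R" using elim s' unfolding R_def by blast
      also have "\<dots> \<le> \<bar>C2\<bar> * R" using R by (intro mult_right_mono) auto
      finally have 2: "\<bar>sawtooth_sum g r (1 / s) 0 (f \<alpha>)\<bar> \<le> \<bar>C2\<bar> * R" .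
      have "K * s\<^sup>2 \<le> K * c\<^sup>2" using K s sb by (intro mult_left_mono power_mono) auto
      moreover have "K' * (1 / s)\<^sup>2 \<le> K' * c\<^sup>2" using K sb by (intro mult_left_mono power_mono) auto
      ultimately have "2 + K * s\<^sup>2 + K' * (1 / s)\<^sup>2 \<le> (2 + K * c\<^sup>2 + K' * c\<^sup>2) * 1" by simp
      also have "\<dots> \<le> (2 + K * c\<^sup>2 + K' * c\<^sup>2) * R" using K R by (intro mult_left_mono) auto
      finally have 3: "2 + K * s\<^sup>2 + K' * (1 / s)\<^sup>2 \<le> (2 + K * c\<^sup>2 + K' * c\<^sup>2) * R" .
      have "\<bar>real (lattice_count f L r s) - (r\<^sup>2 * curve_area f L - r * L * (s + 1 / s) / 2)\<bar>
        \<le> \<bar>sawtooth_sum f r s 0 \<alpha>\<bar> + \<bar>sawtooth_sum g r (1 / s) 0 (f \<alpha>)\<bar> + 2 + K * s\<^sup>2 + K' * (1 / s)\<^sup>2"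
        unfolding sawtooth_sum_def K_def K'_def using elim sb \<alpha> by (intro lattice_count_two_term) auto
      also have "\<dots> \<le> \<bar>C1\<bar> * R + \<bar>C2\<bar> * R + (2 + K * c\<^sup>2 + K' * c\<^sup>2) * R"
        using 1 2 3 by linarith
      also have "\<dots> = C * R" by (simp add: C_def algebra_simps)
      finally show "\<bar>real (lattice_count f L r s) - (r\<^sup>2 * curve_area f L - r * L * (s + 1 / s) / 2)\<bar> \<le> C * R" .
    qed
  qed
  with C0 that show ?thesis by blast
qed

text \<open>
  A count within \<open>O(r)\<close> of \<open>r\<^sup>2\<close> times the area forces a bounded stretch factor, because the crude upper bound
  loses a multiple of \<open>r * s\<close>. For \<open>s > r * L\<close>, where that bound is not available, the count is 0.
\<close>

lemma (in concave_curve) stretch_factor_le: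
  assumes rs: "0 < r" "0 < s" and B: "r\<^sup>2 * curve_area f L - B * r \<le> real (lattice_count f L r s)"
    and r: "B < r * curve_area f L"
  shows "s \<le> B / ((L - f (L/2)) / 2)"
proof -
  have k: "0 < (L - f (L/2)) / 2" using f_less[of 0 "L/2"] f_0 L by simp
  have "0 < r * (r * curve_area f L - B)" using rs r by simp
  also have "\<dots> = r\<^sup>2 * curve_area f L - B * r" by (simp add: algebra_simps power2_eq_square)
  finally have "lattice_count f L r s \<noteq> 0" using B by linarith
  then have "s \<le> r * L" using lattice_count_eq_0[OF rs] by (meson not_less)
  then have "r\<^sup>2 * curve_area f L - B * r \<le> r\<^sup>2 * curve_area f L - r * s * (L - f (L/2)) / 2"
    using lattice_count_le_area[OF rs] B by linarith
  then have "r * (s * ((L - f (L/2)) / 2)) \<le> r * B" by (simp add: mult.commute mult.left_commute)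
  then have "s * ((L - f (L/2)) / 2) \<le> B" using rs by simp
  then show ?thesis using k by (simp add: pos_le_divide_eq)
qed

lemma (in concave_curve) curve_area_pos: "0 < curve_area f L"
proof -
  have "0 \<le> real (lattice_count f L 1 (L/2))" by simp
  also have "\<dots> \<le> 1\<^sup>2 * curve_area f L - 1 * (L/2) * (L - f (L/2)) / 2"
    using L by (intro lattice_count_le_area) auto
  finally have "L/2 * (L - f (L/2)) / 2 \<le> curve_area f L" by simp
  moreover have "0 < L/2 * (L - f (L/2)) / 2" using f_less[of 0 "L/2"] f_0 L by simp
  ultimately show ?thesis by linarith
qed

lemma optimal_stretch_ge:
  assumes "s \<in> optimal_stretch f L r" "0 < s'"
  shows "0 < s" "lattice_count f L r s' \<le> lattice_count f L r s"
  using assms unfolding optimal_stretch_def is_arg_max_def mem_Collect_eq by (blast, meson not_less)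

lemma (in concave_curve) max_lattice_count_attained:
  assumes "0 < r"
  obtains s where "s \<in> optimal_stretch f L r" "max_lattice_count f L r = lattice_count f L r s"
proof -
  let ?N = "lattice_count f L r ` {0<..}"
  have fin: "finite ?N" using f_leL L assms by (intro finite_lattice_counts) auto
  have "?N \<noteq> {}" by (auto intro: gt_ex)
  with fin have "max_lattice_count f L r \<in> ?N" unfolding max_lattice_count_def by (intro Max_in)
  then obtain s where s: "0 < s" "max_lattice_count f L r = lattice_count f L r s" by auto
  have "lattice_count f L r s' \<le> lattice_count f L r s" if "0 < s'" for s'
    using Max_ge[OF fin, of "lattice_count f L r s'"] that s(2) unfolding max_lattice_count_def by auto
  then have "s \<in> optimal_stretch f L r" using s(1)
    unfolding optimal_stretch_def is_arg_max_def mem_Collect_eq by (meson not_less)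
  with s that show ?thesis by blast
qed

text \<open>
  The two-term estimate is used twice: for \<open>s = 1\<close> alone, to find an interval \<open>[1/c, c]\<close> that contains all
  maximizers, and then on that interval. The identity \<open>s + 1/s - 2 = (s - 1)\<^sup>2 / s\<close> turns the loss in
  the second term into the distance from 1.
\<close>

lemma (in concave_curve) optimal_stretch_asymptotics:
  assumes e: "0 < e" "e \<le> 1/6" and \<alpha>: "0 < \<alpha>" "\<alpha> < L"
    and small: "\<And>c. 1 \<le> c \<Longrightarrow> small_sawtooth_sums e c f 0 \<alpha>" "\<And>c. 1 \<le> c \<Longrightarrow> small_sawtooth_sums e c g 0 (f \<alpha>)"
  shows "\<exists>C>0. \<forall>\<^sub>F r in at_top. \<forall>s\<in>optimal_stretch f L r. \<bar>s - 1\<bar> \<le> C * r powr (- e)"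
    and "(\<lambda>r. real (max_lattice_count f L r) - (r\<^sup>2 * curve_area f L - r * L)) \<in> O(\<lambda>r. r powr (1 - 2 * e))"
proof -
  interpret inv: concave_curve g f L by (rule inverse_curve)
  define A where "A = curve_area f L"
  have A: "0 < A" unfolding A_def by (rule curve_area_pos)
  obtain C1 where C1: "0 \<le> C1" "\<forall>\<^sub>F r in at_top. \<forall>s\<in>{1/1..1}. \<bar>real (lattice_count f L r s) - (r\<^sup>2 * A - r * L * (s + 1 / s) / 2)\<bar> \<le> C1 * r powr (1 - 2 * e)"
    unfolding A_def using two_term_estimate[OF \<alpha> order_refl e(2) small[OF order_refl]] by blast
  (* Since r powr (1 - 2 e) <= r, the count for s = 1 is at least r^2 A - B r. *)
  define B where "B = L + C1"
  define c where "c = max 1 (max (B / ((L - f (L/2)) / 2)) (B / ((L - g (L/2)) / 2)))"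
  have c: "1 \<le> c" by (simp add: c_def)
  obtain C2 where C2: "0 \<le> C2" "\<forall>\<^sub>F r in at_top. \<forall>s\<in>{1/c..c}. \<bar>real (lattice_count f L r s) - (r\<^sup>2 * A - r * L * (s + 1 / s) / 2)\<bar> \<le> C2 * r powr (1 - 2 * e)"
    unfolding A_def using two_term_estimate[OF \<alpha> c e(2) small[OF c]] by blast
  have bounded: "\<forall>\<^sub>F r in at_top. \<forall>s\<in>optimal_stretch f L r. s \<in> {1/c..c}"
    using C1(2) eventually_ge_at_top[of 1] eventually_gt_at_top[of "B / A"]
  proof eventually_elim
    case (elim r)
    have rB: "B < r * A" using elim A by (simp add: pos_divide_less_eq)
    have "\<bar>real (lattice_count f L r 1) - (r\<^sup>2 * A - r * L)\<bar> \<le> C1 * r powr (1 - 2 * e)"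
      using elim(1) by simp
    also have "\<dots> \<le> C1 * r powr 1" using elim e C1 by (intro mult_left_mono powr_mono) auto
    also have "\<dots> = C1 * r" using elim by simp
    finally have N1: "r\<^sup>2 * A - B * r \<le> real (lattice_count f L r 1)" by (simp add: B_def algebra_simps abs_le_iff)
    show ?case
    proof
      fix s assume s: "s \<in> optimal_stretch f L r"
      have s0: "0 < s" "lattice_count f L r 1 \<le> lattice_count f L r s"
        using optimal_stretch_ge[OF s, of 1] by auto
      then have N: "r\<^sup>2 * A - B * r \<le> real (lattice_count f L r s)" using N1 by linarith
      have "s \<le> B / ((L - f (L/2)) / 2)"
        using elim s0 N rB unfolding A_def by (intro stretch_factor_le) auto
      then have 1: "s \<le> c" by (simp add: c_def)
      have "1 / s \<le> B / ((L - g (L/2)) / 2)"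
        using elim s0 N rB lattice_count_inverse[of r s] curve_area_inverse unfolding A_def
        by (intro inv.stretch_factor_le) auto
      then have "1 / s \<le> c" by (simp add: c_def)
      then show "s \<in> {1/c..c}" using 1 s0 c by (auto simp: field_simps)
    qed
  qed
  have est: "\<forall>\<^sub>F r in at_top. \<forall>s\<in>optimal_stretch f L r.
      s \<in> {1/c..c} \<and> 0 < s \<and> 1 \<le> r \<and>
      r\<^sup>2 * A - r * L - C2 * r powr (1 - 2 * e) \<le> real (lattice_count f L r s) \<and>
      real (lattice_count f L r s) \<le> r\<^sup>2 * A - r * L * (s + 1 / s) / 2 + C2 * r powr (1 - 2 * e)"
    using bounded C2(2) eventually_ge_at_top[of 1]
  proof eventually_elim
    case (elim r)
    show ?case
    proof
      fix s assume s: "s \<in> optimal_stretch f L r"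
      have s0: "0 < s" "lattice_count f L r 1 \<le> lattice_count f L r s"
        using optimal_stretch_ge[OF s, of 1] by auto
      have sc: "s \<in> {1/c..c}" using elim s by blast
      have "1 \<in> {1/c..c}" using c by auto
      then have "\<bar>real (lattice_count f L r 1) - (r\<^sup>2 * A - r * L * (1 + 1 / 1) / 2)\<bar> \<le> C2 * r powr (1 - 2 * e)"
        using elim by blast
      then have "r\<^sup>2 * A - r * L - C2 * r powr (1 - 2 * e) \<le> real (lattice_count f L r s)"
        using s0(2) by (auto simp: abs_le_iff)
      moreover have "\<bar>real (lattice_count f L r s) - (r\<^sup>2 * A - r * L * (s + 1 / s) / 2)\<bar> \<le> C2 * r powr (1 - 2 * e)"
        using elim sc by blast
      then have "real (lattice_count f L r s) \<le> r\<^sup>2 * A - r * L * (s + 1 / s) / 2 + C2 * r powr (1 - 2 * e)"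
        unfolding abs_diff_le_iff by (rule conjunct2)
      ultimately show "s \<in> {1/c..c} \<and> 0 < s \<and> 1 \<le> r \<and>
      r\<^sup>2 * A - r * L - C2 * r powr (1 - 2 * e) \<le> real (lattice_count f L r s) \<and>
      real (lattice_count f L r s) \<le> r\<^sup>2 * A - r * L * (s + 1 / s) / 2 + C2 * r powr (1 - 2 * e)"
        using sc s0(1) elim(3) by blast
    qed
  qed
  (* The summand 1 makes the constant of the theorem positive even if C2 = 0. *)
  define M where "M = 4 * C2 / L * c + 1"
  have M: "0 < M" using C2 L c by (simp add: M_def add_nonneg_pos)
  have "\<forall>\<^sub>F r in at_top. \<forall>s\<in>optimal_stretch f L r. \<bar>s - 1\<bar> \<le> sqrt M * r powr (- e)"
    using est
  proof eventually_elim
    case (elim r)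
    show ?case
    proof
      fix s assume "s \<in> optimal_stretch f L r"
      with elim have sc: "s \<in> {1/c..c}" and s: "0 < s" and r: "1 \<le> r"
        and lo: "r\<^sup>2 * A - r * L - C2 * r powr (1 - 2 * e) \<le> real (lattice_count f L r s)"
        and up: "real (lattice_count f L r s) \<le> r\<^sup>2 * A - r * L * (s + 1 / s) / 2 + C2 * r powr (1 - 2 * e)"
        by blast+
      from order_trans[OF lo up]
      have "r * L * (s + 1 / s) / 2 - r * L \<le> 2 * C2 * r powr (1 - 2 * e)" by linarith
      moreover have "r * L * (s + 1 / s) / 2 - r * L = r * L * ((s - 1)\<^sup>2 / s) / 2"
        using s by (simp add: field_simps power2_eq_square)
      moreover have "r powr (1 - 2 * e) = r * r powr (- (2 * e))"
        using r by (simp add: powr_diff powr_minus divide_inverse)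
      ultimately have "r * (L * ((s - 1)\<^sup>2 / s) / 2) \<le> r * (2 * C2 * r powr (- (2 * e)))" by (simp add: mult_ac)
      then have "L * ((s - 1)\<^sup>2 / s) / 2 \<le> 2 * C2 * r powr (- (2 * e))"
        by (rule mult_left_le_imp_le) (use r in simp)
      moreover have "x \<le> 4 * C2 / L * s * y" if "L * (x / s) / 2 \<le> 2 * C2 * y" for x y
        using that s L by (simp add: field_simps)
      ultimately have "(s - 1)\<^sup>2 \<le> 4 * C2 / L * s * r powr (- (2 * e))" by blast
      also have "\<dots> \<le> M * r powr (- (2 * e))"
      proof (rule mult_right_mono)
        have "4 * C2 / L * s \<le> 4 * C2 / L * c" using sc C2 L by (intro mult_left_mono) auto
        then show "4 * C2 / L * s \<le> M" by (simp add: M_def)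
      qed simp
      also have "\<dots> = (sqrt M * r powr (- e))\<^sup>2"
      proof -
        have "r powr (- (2 * e)) = (r powr (- e))\<^sup>2"
          unfolding power2_eq_square powr_add[symmetric] by simp
        then show ?thesis using M by (simp add: power_mult_distrib)
      qed
      finally have "\<bar>s - 1\<bar>\<^sup>2 \<le> (sqrt M * r powr (- e))\<^sup>2"
        unfolding power2_abs .
      then show "\<bar>s - 1\<bar> \<le> sqrt M * r powr (- e)"
        by (rule power2_le_imp_le) (use M in simp)
    qed
  qed
  then show "\<exists>C>0. \<forall>\<^sub>F r in at_top. \<forall>s\<in>optimal_stretch f L r. \<bar>s - 1\<bar> \<le> C * r powr (- e)"
    using M by (intro exI[of _ "sqrt M"]) simp
  show "(\<lambda>r. real (max_lattice_count f L r) - (r\<^sup>2 * curve_area f L - r * L)) \<in> O(\<lambda>r. r powr (1 - 2 * e))"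
  proof (rule landau_o.bigI[of "C2 + 1"])
    show "\<forall>\<^sub>F r in at_top. norm (real (max_lattice_count f L r) - (r\<^sup>2 * curve_area f L - r * L)) \<le> (C2 + 1) * norm (r powr (1 - 2 * e))"
      using est eventually_ge_at_top[of 1]
    proof eventually_elim
      case (elim r)
      obtain s where s: "s \<in> optimal_stretch f L r" "max_lattice_count f L r = lattice_count f L r s"
        using max_lattice_count_attained[of r] elim by auto
      define N where "N = real (lattice_count f L r s)"
      define R where "R = C2 * r powr (1 - 2 * e)"
      have e1: "0 < s" "1 \<le> r" "r\<^sup>2 * A - r * L - R \<le> N" "N \<le> r\<^sup>2 * A - r * L * (s + 1 / s) / 2 + R"
        using elim s(1) unfolding N_def R_def by blast+
      have "2 \<le> s + 1 / s"
      proof -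
        have "0 \<le> (s - 1)\<^sup>2 / s" using e1 by simp
        also have "\<dots> = s + 1 / s - 2" using e1 by (simp add: field_simps power2_eq_square)
        finally show ?thesis by simp
      qed
      then have "r * L * 2 \<le> r * L * (s + 1 / s)" using e1 L by (intro mult_left_mono) auto
      then have "r * L \<le> r * L * (s + 1 / s) / 2" by simp
      then have "r\<^sup>2 * A - r * L * (s + 1 / s) / 2 + R \<le> r\<^sup>2 * A - r * L + R"
        by (intro add_right_mono diff_left_mono)
      then have "\<bar>N - (r\<^sup>2 * A - r * L)\<bar> \<le> R"
        using order_trans[OF e1(4)] e1(3) unfolding abs_diff_le_iff by blast
      also have "R \<le> (C2 + 1) * r powr (1 - 2 * e)" unfolding R_def by (intro mult_right_mono) auto
      finally show ?case by (simp add: N_def s(2) A_def)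
    qed
  qed (use C2 in simp)
qed

theorem theorem4:
  fixes f g :: "real \<Rightarrow> real" and L \<alpha> \<beta> a1 a2 b1 b2 e :: real
    and l m :: nat and p q :: "nat \<Rightarrow> real" and \<delta> \<epsilon> :: "real \<Rightarrow> real"
  assumes "0 < L"
    and "f \<in> {0..L} \<rightarrow> {0..L}" and "continuous_on {0..L} f" and "concave_on {0..L} f"
    and "strict_antimono_on {0..L} f" and "f 0 = L" and "f L = 0"
    and "g \<in> {0..L} \<rightarrow> {0..L}"
    and "\<And>x. x \<in> {0..L} \<Longrightarrow> g (f x) = x" and "\<And>y. y \<in> {0..L} \<Longrightarrow> f (g y) = y"
    and "\<alpha> \<in> {0..L}" and "\<beta> = f \<alpha>" and "0 < \<alpha>" and "0 < \<beta>"
    and "PC2_on \<alpha> l p f"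
    and "\<And>i x. i < l \<Longrightarrow> x \<in> subinterval p i \<Longrightarrow> deriv1_on (subinterval p i) f x < 0"
    and "\<And>i x. i < l \<Longrightarrow> x \<in> subinterval p i \<Longrightarrow> deriv2_on (subinterval p i) f x < 0"
    and "\<And>i. i < l \<Longrightarrow> mono_on (subinterval p i) (deriv2_on (subinterval p i) f)
                      \<or> antimono_on (subinterval p i) (deriv2_on (subinterval p i) f)"
    and "PC2_on \<beta> m q g"
    and "\<And>i y. i < m \<Longrightarrow> y \<in> subinterval q i \<Longrightarrow> deriv1_on (subinterval q i) g y < 0"
    and "\<And>i y. i < m \<Longrightarrow> y \<in> subinterval q i \<Longrightarrow> deriv2_on (subinterval q i) g y < 0"
    and "\<And>i. i < m \<Longrightarrow> mono_on (subinterval q i) (deriv2_on (subinterval q i) g)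
                      \<or> antimono_on (subinterval q i) (deriv2_on (subinterval q i) g)"
    and "0 < a1" and "0 < a2" and "0 < b1" and "0 < b2"
    and "\<And>r. 0 < r \<Longrightarrow> 0 < \<delta> r" and "\<And>r. 0 < r \<Longrightarrow> 0 < \<epsilon> r"
    and "\<delta> \<in> O(\<lambda>r. r powr (-2 * a1))"
    and "(\<lambda>r. inverse (deriv (deriv f) (\<delta> r))) \<in> O(\<lambda>r. r powr (1 - 4 * a2))"
    and "\<epsilon> \<in> O(\<lambda>r. r powr (-2 * b1))"
    and "(\<lambda>r. inverse (deriv (deriv g) (\<epsilon> r))) \<in> O(\<lambda>r. r powr (1 - 4 * b2))"
    and "e = Min {1/6, a1, a2, b1, b2}"
  shows "(\<forall>\<eta>>0. \<forall>\<^sub>F r in at_top. \<forall>s\<in>optimal_stretch f L r. \<bar>s - 1\<bar> < \<eta>)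
    \<and> (\<exists>C>0. \<exists>r0>0. \<forall>r\<ge>r0. \<forall>s\<in>optimal_stretch f L r. \<bar>s - 1\<bar> \<le> C * r powr (- e))
    \<and> (\<lambda>r. real (max_lattice_count f L r) - (r\<^sup>2 * curve_area f L - r * L))
         \<in> O(\<lambda>r. r powr (1 - 2 * e))"
proof -
  interpret concave_curve f g L
    by (rule concave_curve.intro[OF assms(1-10)])
  have e: "0 < e" "e \<le> 1/6" "e \<le> a1" "e \<le> a2" "e \<le> b1" "e \<le> b2"
    using assms(23-26) by (simp_all add: \<open>e = _\<close>)
  have \<alpha>: "0 < \<alpha>" "\<alpha> < L"
  proof -
    show "0 < \<alpha>" by fact
    have "\<alpha> \<noteq> L" using \<open>0 < \<beta>\<close> \<open>\<beta> = f \<alpha>\<close> f_L by auto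
    then show "\<alpha> < L" using \<open>\<alpha> \<in> {0..L}\<close> by simp
  qed
  have small: "small_sawtooth_sums e c f 0 \<alpha>" "small_sawtooth_sums e c g 0 (f \<alpha>)" if "1 \<le> c" for c
  proof -
    show "small_sawtooth_sums e c f 0 \<alpha>"
      by (rule small_sawtooth_sums_PC2[OF assms(15-18,23,27,29,30) that e(2-4)])
    show "small_sawtooth_sums e c g 0 (f \<alpha>)"
      unfolding \<open>\<beta> = f \<alpha>\<close>[symmetric]
      by (rule small_sawtooth_sums_PC2[OF assms(19-22,25,28,31,32) that e(2,5,6)])
  qed
  note asym = optimal_stretch_asymptotics[OF e(1,2) \<alpha> small]
  from asym(1) obtain C where C: "0 < C"
    "\<forall>\<^sub>F r in at_top. \<forall>s\<in>optimal_stretch f L r. \<bar>s - 1\<bar> \<le> C * r powr (- e)" by blast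
  have "\<forall>\<^sub>F r in at_top. \<forall>s\<in>optimal_stretch f L r. \<bar>s - 1\<bar> < \<eta>" if "0 < \<eta>" for \<eta>
  proof -
    have "((\<lambda>r. C * r powr (- e)) \<longlongrightarrow> C * 0) at_top"
      using e by (intro tendsto_mult tendsto_const tendsto_neg_powr filterlim_ident) auto
    then have "\<forall>\<^sub>F r in at_top. C * r powr (- e) < \<eta>"
      using that by (intro order_tendstoD(2)) auto
    with C(2) show ?thesis by eventually_elim force
  qed
  moreover have "\<exists>r0>0. \<forall>r\<ge>r0. \<forall>s\<in>optimal_stretch f L r. \<bar>s - 1\<bar> \<le> C * r powr (- e)"
  proof -
    obtain r0 where r0: "\<And>r. r0 \<le> r \<Longrightarrow> \<forall>s\<in>optimal_stretch f L r. \<bar>s - 1\<bar> \<le> C * r powr (- e)"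
      using C(2) unfolding eventually_at_top_linorder by blast
    show ?thesis by (rule exI[of _ "max 1 r0"]) (use r0 in auto)
  qed
  ultimately show ?thesis using C(1) asym(2) by blast
qed

end
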